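(* Let $R\subset\mathbb R^N$ be a root system with multiplicity function $k\ge0$. For all $x,\lambda\in\mathbb R^N$ and $j,l=1,\ldots,N$, $$L_k^{\lambda,Dunkl}m_{2;j,l}(x)=\delta_{j,l}+\lambda_jm_{1;l}(x)+\lambda_lm_{1;j}(x).$$ Moreover, if $(X_t^\lambda)_{t\ge0}$ is a Dunkl process of type $R$ with multiplicity $k$ and drift $\lambda$ such that the starting distribution $P_{X_0^\lambda}$ has second moments, then for all $j,l=1,\ldots,N$, $$\Bigl(m_{2;j,l}(X_t^\lambda)-E(m_{2;j,l}(X_t^\lambda))-m_{1;l}(X_t^\lambda)E(m_{1;j}(X_t^\lambda))-m_{1;j}(X_t^\lambda)E(m_{1;l}(X_t^\lambda))+2E(m_{1;l}(X_t^\lambda))E(m_{1;j}(X_t^\lambda))\Bigr)_{t\ge0}$$ is a martingale. In particular, for $P_{X_0^\lambda}=\delta_0$ and $l,j=1,\ldots,N$, $$E(m_{2;l,j}(X_t^\lambda))=t\,\delta_{j,l}+t^2\lambda_j\lambda_l.$$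
   Context: $\mathbb R^N$ carries the usual scalar product $\langle\cdot,\cdot\rangle$ (extended bilinearly to $\mathbb C^N$) and norm $\|\cdot\|$. A root system $R\subset\mathbb R^N\setminus\{0\}$ is a finite set with $\sigma_\alpha(R)=R$ for all $\alpha\in R$, where $\sigma_\alpha$ is the orthogonal reflection in the hyperplane $\alpha^\perp$; $W$ is the finite group generated by the $\sigma_\alpha$; $R_+\subset R$ is a fixed positive subsystem; $k:R\to[0,\infty)$ is a $W$-invariant multiplicity function; $\gamma=\sum_{\alpha\in R_+}k(\alpha)$. Dunkl operators: $T_\xi(k)f(x)=\partial_\xi f(x)+\sum_{\alpha\in R_+}k(\alpha)\langle\alpha,\xi\rangle\frac{f(x)-f(\sigma_\alpha x)}{\langle\alpha,x\rangle}$. For $w\in\mathbb C^N$ the Dunkl kernel $E_k(\cdot,w)$ is the unique holomorphic $f$ on $\mathbb C^N$ with $T_\xi(k)f=\langle\xi,w\rangle f$ for all $\xi\in\mathbb C^N$ and $f(0)=1$; it is positive on $\mathbb R^N\times\mathbb R^N$. Let $w_k(x)=\prod_{\alpha\in R_+}|\langle\alpha,x\rangle|^{2k(\alpha)}$ and $c_k>0$ with $c_k\int_{\mathbb R^N}e^{-\|y\|^2/2}w_k(y)\,dy=1$. For $f\in C^{(2)}(\mathbb R^N)$, $$L_k^{\lambda,Dunkl}f(x)=\frac12\Delta f(x)+\sum_{\alpha\in R_+}k(\alpha)\frac{\langle\nabla f(x),\alpha\rangle}{\langle\alpha,x\rangle}+\frac{\langle\nabla_xE_k(x,\lambda),\nabla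 f(x)\rangle}{E_k(x,\lambda)}-\sum_{\alpha\in R_+}\frac{k(\alpha)\|\alpha\|^2}{2}\frac{E_k(\sigma_\alpha x,\lambda)}{E_k(x,\lambda)}\frac{f(x)-f(\sigma_\alpha x)}{\langle\alpha,x\rangle^2},$$ with singular terms at $\langle\alpha,x\rangle=0$ understood by continuous extension. Modified moment functions (depending on $\lambda$): $m_{1;j}(x)=\frac{\partial_{\lambda_j}E_k(x,\lambda)}{E_k(x,\lambda)}$ and $m_{2;j,l}(x)=\frac{\partial_{\lambda_j}\partial_{\lambda_l}E_k(x,\lambda)}{E_k(x,\lambda)}$. A Dunkl process with drift $\lambda\in\mathbb R^N$ is a time-homogeneous Feller process on $\mathbb R^N$ with RCLL paths and transition kernels $$K_t^{\lambda,k,Dunkl}(x,A)=\frac{c_k\,e^{-\|\lambda\|^2t/2}}{t^{\gamma+N/2}}\int_Ae^{-(\|x\|^2+\|y\|^2)/(2t)}\,\frac{E_k(\frac x{\sqrt t},\frac y{\sqrt t})E_k(y,\lambda)}{E_k(x,\lambda)}\,w_k(y)\,dy\quad(t>0).$$ Martingales are with respect to the canonical filtration of $(X_t^\lambda)_{t\ge0}$. *)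

theory Defs
  imports "HOL-Probability.Probability"
begin

section \<open>Root systems\<close>

definition refl_along :: "real^'n \<Rightarrow> real^'n \<Rightarrow> real^'n" where
  "refl_along \<alpha> x = x - (2 * (\<alpha> \<bullet> x) / (\<alpha> \<bullet> \<alpha>)) *\<^sub>R \<alpha>"

text \<open>Neither crystallographic nor reduced: multiples of a root may occur.\<close>

definition root_system :: "(real^'n) set \<Rightarrow> bool" where
  "root_system R \<longleftrightarrow> finite R \<and> 0 \<notin> R \<and> (\<forall>\<alpha>\<in>R. refl_along \<alpha> ` R = R)"

text \<open>Reflections are involutions, so closing under composition already gives the generated group.\<close>

inductive_set reflection_group :: "(real^'n) set \<Rightarrow> (real^'n \<Rightarrow> real^'n) set"
  for R :: "(real^'n) set" where
  reflection_group_id: "id \<in> reflection_group R"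
| reflection_group_comp:
    "w \<in> reflection_group R \<Longrightarrow> \<alpha> \<in> R \<Longrightarrow> refl_along \<alpha> \<circ> w \<in> reflection_group R"

definition positive_subsystem :: "(real^'n) set \<Rightarrow> (real^'n) set \<Rightarrow> bool" where
  "positive_subsystem R Rp \<longleftrightarrow>
     (\<exists>\<beta>. (\<forall>\<alpha>\<in>R. \<beta> \<bullet> \<alpha> \<noteq> 0) \<and> Rp = {\<alpha>\<in>R. \<beta> \<bullet> \<alpha> > 0})"

definition multiplicity_function :: "(real^'n) set \<Rightarrow> (real^'n \<Rightarrow> real) \<Rightarrow> bool" where
  "multiplicity_function R k \<longleftrightarrow>
     (\<forall>\<alpha>\<in>R. 0 \<le> k \<alpha>) \<and> (\<forall>w\<in>reflection_group R. \<forall>\<alpha>\<in>R. k (w \<alpha>) = k \<alpha>)"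

section \<open>Dunkl operators and the Dunkl kernel\<close>

definition cvec :: "real^'n \<Rightarrow> complex^'n" where
  "cvec x = (\<chi> i. complex_of_real (x $ i))"

text \<open>The bilinear (not sesquilinear) extension of the scalar product.\<close>

definition cdot :: "complex^'n \<Rightarrow> complex^'n \<Rightarrow> complex" where
  "cdot z w = (\<Sum>i\<in>UNIV. z $ i * w $ i)"

definition crefl_along :: "real^'n \<Rightarrow> complex^'n \<Rightarrow> complex^'n" where
  "crefl_along \<alpha> z = z - (2 * cdot (cvec \<alpha>) z / cdot (cvec \<alpha>) (cvec \<alpha>)) *s cvec \<alpha>"

definition entire_several :: "(complex^'n \<Rightarrow> complex) \<Rightarrow> bool" where
  "entire_several f \<longleftrightarrow>
     (\<forall>z. \<exists>f'. (f has_derivative f') (at z) \<and> (\<forall>c v. f' (c *s v) = c * f' v))"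

text \<open>The value at \<open>x\<close> of the continuous extension of \<open>g\<close> from the set \<open>S\<close>.\<close>

definition cont_ext :: "'a::topological_space set \<Rightarrow> ('a \<Rightarrow> 'b::t2_space) \<Rightarrow> 'a \<Rightarrow> 'b" where
  "cont_ext S g x = (if x \<in> S then g x else Lim (at x within S) g)"

definition dunkl_op ::
  "(real^'n) set \<Rightarrow> (real^'n \<Rightarrow> real) \<Rightarrow> complex^'n \<Rightarrow> (complex^'n \<Rightarrow> complex) \<Rightarrow> complex^'n \<Rightarrow> complex"
  where
  "dunkl_op Rp k \<xi> f z =
     frechet_derivative f (at z) \<xi> +
     (\<Sum>\<alpha>\<in>Rp. complex_of_real (k \<alpha>) * cdot (cvec \<alpha>) \<xi> *
        cont_ext {y. cdot (cvec \<alpha>) y \<noteq> 0}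
          (\<lambda>y. (f y - f (crefl_along \<alpha> y)) / cdot (cvec \<alpha>) y) z)"

definition dunkl_kernel_complex ::
  "(real^'n) set \<Rightarrow> (real^'n \<Rightarrow> real) \<Rightarrow> complex^'n \<Rightarrow> complex^'n \<Rightarrow> complex" where
  "dunkl_kernel_complex Rp k z w =
     (THE f. entire_several f \<and> (\<forall>\<xi> y. dunkl_op Rp k \<xi> f y = cdot \<xi> w * f y) \<and> f 0 = 1) z"

text \<open>On real arguments the kernel is real (and positive), so that taking the real part is only
  a change of type.\<close>

definition dunkl_kernel ::
  "(real^'n) set \<Rightarrow> (real^'n \<Rightarrow> real) \<Rightarrow> real^'n \<Rightarrow> real^'n \<Rightarrow> real" where
  "dunkl_kernel Rp k x y = Re (dunkl_kernel_complex Rp k (cvec x) (cvec y))"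

section \<open>The generator with drift and the modified moment functions\<close>

definition partial_deriv :: "'n::finite \<Rightarrow> (real^'n \<Rightarrow> real) \<Rightarrow> real^'n \<Rightarrow> real" where
  "partial_deriv i f x = deriv (\<lambda>s. f (x + s *\<^sub>R axis i 1)) 0"

definition gradient :: "(real^'n \<Rightarrow> real) \<Rightarrow> real^'n \<Rightarrow> real^'n" where
  "gradient f x = (\<chi> i. partial_deriv i f x)"

definition laplacian :: "(real^'n \<Rightarrow> real) \<Rightarrow> real^'n \<Rightarrow> real" where
  "laplacian f x = (\<Sum>i\<in>UNIV. partial_deriv i (partial_deriv i f) x)"

text \<open>The gradient term and the difference term belonging to one root are singular on its
  hyperplane individually; only their difference extends continuously (for twice continuously
  differentiable \<open>f\<close>), so they are grouped before extending.\<close>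

definition dunkl_drift_generator ::
  "(real^'n) set \<Rightarrow> (real^'n \<Rightarrow> real) \<Rightarrow> real^'n \<Rightarrow> (real^'n \<Rightarrow> real) \<Rightarrow> real^'n \<Rightarrow> real" where
  "dunkl_drift_generator Rp k lam f x =
     laplacian f x / 2 +
     (gradient (\<lambda>y. dunkl_kernel Rp k y lam) x \<bullet> gradient f x) / dunkl_kernel Rp k x lam +
     (\<Sum>\<alpha>\<in>Rp. cont_ext {y. \<alpha> \<bullet> y \<noteq> 0}
        (\<lambda>y. k \<alpha> * ((gradient f y \<bullet> \<alpha>) / (\<alpha> \<bullet> y))
           - k \<alpha> * (norm \<alpha>)\<^sup>2 / 2
             * (dunkl_kernel Rp k (refl_along \<alpha> y) lam / dunkl_kernel Rp k y lam)
             * ((f y - f (refl_along \<alpha> y)) / (\<alpha> \<bullet> y)\<^sup>2)) x)"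

definition moment1 ::
  "(real^'n) set \<Rightarrow> (real^'n \<Rightarrow> real) \<Rightarrow> real^'n \<Rightarrow> 'n \<Rightarrow> real^'n \<Rightarrow> real" where
  "moment1 Rp k lam j x =
     partial_deriv j (\<lambda>\<mu>. dunkl_kernel Rp k x \<mu>) lam / dunkl_kernel Rp k x lam"

definition moment2 ::
  "(real^'n) set \<Rightarrow> (real^'n \<Rightarrow> real) \<Rightarrow> real^'n \<Rightarrow> 'n \<Rightarrow> 'n \<Rightarrow> real^'n \<Rightarrow> real" where
  "moment2 Rp k lam j l x =
     partial_deriv j (partial_deriv l (\<lambda>\<mu>. dunkl_kernel Rp k x \<mu>)) lam / dunkl_kernel Rp k x lam"

section \<open>Transition kernels\<close>

text \<open>The case distinction is needed because \<open>0 powr 0 = 0\<close>.\<close>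

definition dunkl_weight :: "(real^'n) set \<Rightarrow> (real^'n \<Rightarrow> real) \<Rightarrow> real^'n \<Rightarrow> real" where
  "dunkl_weight Rp k x = (\<Prod>\<alpha>\<in>Rp. if k \<alpha> = 0 then 1 else \<bar>\<alpha> \<bullet> x\<bar> powr (2 * k \<alpha>))"

definition dunkl_const :: "(real^'n) set \<Rightarrow> (real^'n \<Rightarrow> real) \<Rightarrow> real" where
  "dunkl_const Rp k = 1 / (LINT y|lborel. exp (- (norm y)\<^sup>2 / 2) * dunkl_weight Rp k y)"

definition dunkl_gamma :: "(real^'n) set \<Rightarrow> (real^'n \<Rightarrow> real) \<Rightarrow> real" where
  "dunkl_gamma Rp k = (\<Sum>\<alpha>\<in>Rp. k \<alpha>)"

text \<open>Only meaningful for \<open>t > 0\<close>.\<close>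

definition dunkl_drift_kernel ::
  "(real^'n) set \<Rightarrow> (real^'n \<Rightarrow> real) \<Rightarrow> real^'n \<Rightarrow> real \<Rightarrow> real^'n \<Rightarrow> (real^'n) measure" where
  "dunkl_drift_kernel Rp k lam t x = density lborel (\<lambda>y. ennreal (
     dunkl_const Rp k * exp (- (norm lam)\<^sup>2 * t / 2)
       / t powr (dunkl_gamma Rp k + real CARD('n) / 2)
     * exp (- ((norm x)\<^sup>2 + (norm y)\<^sup>2) / (2 * t))
     * (dunkl_kernel Rp k (x /\<^sub>R sqrt t) (y /\<^sub>R sqrt t) * dunkl_kernel Rp k y lam
         / dunkl_kernel Rp k x lam)
     * dunkl_weight Rp k y))"

section \<open>Feller processes and martingales\<close>

definition C0_fun :: "(real^'n \<Rightarrow> real) \<Rightarrow> bool" where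
  "C0_fun f \<longleftrightarrow> continuous_on UNIV f \<and> (f \<longlongrightarrow> 0) at_infinity"

text \<open>A family of kernels, indexed by \<open>t > 0\<close>, forming a conservative Feller semigroup.\<close>

definition feller_semigroup :: "(real \<Rightarrow> real^'n \<Rightarrow> (real^'n) measure) \<Rightarrow> bool" where
  "feller_semigroup K \<longleftrightarrow>
     (\<forall>t>0. K t \<in> borel \<rightarrow>\<^sub>M prob_algebra borel) \<and>
     (\<forall>s>0. \<forall>t>0. \<forall>x. K (s + t) x = K s x \<bind> K t) \<and>
     (\<forall>f. C0_fun f \<longrightarrow>
        (\<forall>t>0. C0_fun (\<lambda>x. LINT y|K t x. f y)) \<and>
        uniform_limit UNIV (\<lambda>t x. LINT y|K t x. f y) f (at_right 0))"

definition canonical_filtration ::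
  "'a measure \<Rightarrow> (real \<Rightarrow> 'a \<Rightarrow> real^'n) \<Rightarrow> real \<Rightarrow> 'a measure" where
  "canonical_filtration M X t =
     sigma (space M) {X u -` A \<inter> space M | u A. 0 \<le> u \<and> u \<le> t \<and> A \<in> sets borel}"

definition rcll :: "(real \<Rightarrow> 'b::topological_space) \<Rightarrow> bool" where
  "rcll p \<longleftrightarrow> (\<forall>t\<ge>0. (p \<longlongrightarrow> p t) (at_right t)) \<and> (\<forall>t>0. \<exists>b. (p \<longlongrightarrow> b) (at_left t))"

definition feller_process ::
  "(real \<Rightarrow> real^'n \<Rightarrow> (real^'n) measure) \<Rightarrow> 'a measure \<Rightarrow> (real \<Rightarrow> 'a \<Rightarrow> real^'n) \<Rightarrow> bool" where
  "feller_process K M X \<longleftrightarrow>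
     feller_semigroup K \<and> prob_space M \<and>
     (\<forall>t\<ge>0. X t \<in> borel_measurable M) \<and>
     (\<forall>\<omega>\<in>space M. rcll (\<lambda>t. X t \<omega>)) \<and>
     (\<forall>s\<ge>0. \<forall>t>0. \<forall>A\<in>sets borel. AE \<omega> in M.
        real_cond_exp M (canonical_filtration M X s) (\<lambda>\<omega>'. indicator A (X (s + t) \<omega>')) \<omega>
          = measure (K t (X s \<omega>)) A)"

definition dunkl_process ::
  "(real^'n) set \<Rightarrow> (real^'n \<Rightarrow> real) \<Rightarrow> real^'n \<Rightarrow> 'a measure \<Rightarrow> (real \<Rightarrow> 'a \<Rightarrow> real^'n) \<Rightarrow> bool" where
  "dunkl_process Rp k lam M X \<longleftrightarrow> feller_process (dunkl_drift_kernel Rp k lam) M X"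

definition martingale ::
  "'a measure \<Rightarrow> (real \<Rightarrow> 'a measure) \<Rightarrow> (real \<Rightarrow> 'a \<Rightarrow> real) \<Rightarrow> bool" where
  "martingale M F Y \<longleftrightarrow>
     (\<forall>t\<ge>0. integrable M (Y t) \<and> Y t \<in> borel_measurable (F t)) \<and>
     (\<forall>s t. 0 \<le> s \<and> s \<le> t \<longrightarrow> (AE \<omega> in M. real_cond_exp M (F s) (Y t) \<omega> = Y s \<omega>))"

end

theory Submission
  imports Defs
begin

text \<open>
The moment functions are derivatives in \<open>\<lambda>\<close> of the Dunkl kernel \<open>E(x,\<lambda>)\<close>, divided by \<open>E(x,\<lambda>)\<close>.
Both halves of the result come from differentiating an identity for \<open>E\<close> twice in \<open>\<lambda>\<close>.

For the generator the identity is \<open>\<Delta>E(\<cdot>,\<lambda>) = \<bar>\<lambda>\<bar>\<^sup>2 E(\<cdot>,\<lambda>)\<close> with the Dunkl Laplacian \<open>\<Delta>\<close>. The generator with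
drift is a Doob transform: for \<open>f = g / E(\<cdot>,\<lambda>)\<close> it equals \<open>(\<Delta>g / 2 - f \<Delta>E / 2) / E\<close>
(\<open>generator_quotient\<close>). With \<open>g = \<partial>\<^sub>j\<partial>\<^sub>l E\<close> only the terms in which a derivative hits
\<open>\<bar>\<lambda>\<bar>\<^sup>2\<close> survive, and these are the right-hand side of the claim (\<open>generator_moment2\<close>).

For the process the identity says that \<open>E(\<cdot>,\<mu>) / E(\<cdot>,\<lambda>)\<close> is an eigenfunction of the transition kernel
of time \<open>t\<close> with eigenvalue \<open>exp (t (\<bar>\<mu>\<bar>\<^sup>2 - \<bar>\<lambda>\<bar>\<^sup>2) / 2)\<close> (\<open>Kt_laplace\<close>). It can be read off from the
Chapman-Kolmogorov equation: in the product of two densities the factor \<open>E(y,\<lambda>)\<close> at the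
intermediate point cancels, and the end point, suitably scaled, plays the role of \<open>\<mu>\<close>.
Derivatives at \<open>\<mu> = \<lambda>\<close> give the conditional expectations of the moment functions
(\<open>Kt_m1\<close>, \<open>Kt_m2\<close>), and the martingale property is then algebra (\<open>moment_martingale\<close>).

The kernel is a series \<open>\<Sum>E\<^sub>n\<close> of polynomials, homogeneous of degree \<open>n\<close> in each variable. The Dunkl
equations in the direction \<open>\<xi> = x\<close> alone give the radial equation
\<open>(n + \<gamma>) E\<^sub>n - (\<Sum>\<alpha>. k(\<alpha>) E\<^sub>n \<circ> \<sigma>\<^sub>\<alpha>) = \<langle>x,\<lambda>\<rangle> E\<^sub>n\<^sub>-\<^sub>1\<close>, which is solved by a resolvent in the group algebra of the
finite reflection group. That its solution satisfies the Dunkl equations in all directions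
(\<open>T_kernel_poly\<close>) rests on the commutativity of the Dunkl operators (\<open>T_commute\<close>): their commutator
commutes with multiplication by linear forms, by Jacobi's identity, and annihilates the constants.
The same device identifies \<open>\<Sum>\<^sub>i T\<^sub>i\<^sup>2\<close> with the explicit form of \<open>\<Delta>\<close>.

Uniqueness, positivity and growth of \<open>E\<close> follow from maximum principles for the radial equation:
at an extremum over a ball the reflection terms have a sign, because reflections preserve the ball
(\<open>radial_unique\<close>, \<open>comparison_principle\<close>). Comparison yields \<open>E > 0\<close>, exponential bounds,
\<open>\<bar>\<partial>\<^sub>b E\<bar> \<le> \<bar>b\<bar>\<bar>x\<bar>E\<close>, the analogous quadratic bound for second derivatives, and log-convexity in \<open>\<lambda>\<close>. These
estimates justify all integrability statements and the differentiation under the integral.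
\<close>

section \<open>Entire series of polynomials\<close>

text \<open>A polynomial together with a majorant \<open>b r\<close> on the ball of radius \<open>r\<close>. Recording the majorant
makes the estimate of a derivative independent of the degree, so that termwise differentiation
of series needs no bookkeeping of degrees.\<close>

inductive bounded_poly :: "('v::real_normed_vector \<Rightarrow> complex) \<Rightarrow> (real \<Rightarrow> real) \<Rightarrow> bool" where
  bounded_poly_const: "bounded_poly (\<lambda>_. c) (\<lambda>_. norm c)"
| bounded_poly_linear: "bounded_linear l \<Longrightarrow> (\<And>v. norm (l v) \<le> K * norm v) \<Longrightarrow> 0 \<le> K \<Longrightarrow>
    bounded_poly f b \<Longrightarrow> bounded_poly (\<lambda>v. l v * f v) (\<lambda>r. K * r * b r)"
| bounded_poly_add: "bounded_poly f b \<Longrightarrow> bounded_poly g c \<Longrightarrow>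
    bounded_poly (\<lambda>v. f v + g v) (\<lambda>r. b r + c r)"

lemma bounded_poly_nonneg: "bounded_poly f b \<Longrightarrow> 0 \<le> r \<Longrightarrow> 0 \<le> b r"
  by (induction rule: bounded_poly.induct) auto

lemma bounded_poly_mono: "bounded_poly f b \<Longrightarrow> 0 \<le> r \<Longrightarrow> r \<le> s \<Longrightarrow> b r \<le> b s"
proof (induction rule: bounded_poly.induct)
  case (bounded_poly_linear l K f b)
  then show ?case
    by (intro mult_mono) (auto intro: bounded_poly_nonneg)
qed (auto intro: add_mono)

lemma bounded_poly_bound: "bounded_poly f b \<Longrightarrow> norm v \<le> r \<Longrightarrow> norm (f v) \<le> b r"
proof (induction rule: bounded_poly.induct)
  case (bounded_poly_linear l K f b)
  have "norm (l v) \<le> K * r"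
    using bounded_poly_linear(2)[of v] mult_left_mono[OF bounded_poly_linear.prems bounded_poly_linear(3)] by linarith
  moreover have "0 \<le> K * r"
    using bounded_poly_linear(3) bounded_poly_linear.prems order_trans[OF norm_ge_zero] by fastforce
  ultimately show ?case
    using bounded_poly_linear by (auto simp: norm_mult intro!: mult_mono)
qed (auto intro: norm_triangle_mono)

lemma bounded_poly_cmult: "bounded_poly f b \<Longrightarrow> bounded_poly (\<lambda>v. c * f v) (\<lambda>r. norm c * b r)"
proof (induction rule: bounded_poly.induct)
  case (bounded_poly_const d)
  show ?case using bounded_poly.bounded_poly_const[of "c * d"] by (simp add: norm_mult)
next
  case (bounded_poly_linear l K f b)
  show ?case using bounded_poly.bounded_poly_linear[OF bounded_poly_linear(1-3,5)]
    by (simp add: algebra_simps)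
next
  case (bounded_poly_add f b g d)
  show ?case using bounded_poly.bounded_poly_add[OF bounded_poly_add(3,4)]
    by (simp add: algebra_simps)
qed

text \<open>The majorant is a polynomial with nonnegative coefficients; by convexity its derivative at \<open>r\<close>
is at most \<open>b (r + 1) - b r\<close>. Hence the shift of the radius.\<close>

lemma bounded_poly_derivative:
  assumes "bounded_poly f b"
  shows "\<exists>f'. (\<forall>v. (f has_derivative f' v) (at v)) \<and>
     (\<forall>h. \<exists>b'. bounded_poly (\<lambda>v. f' v h) b' \<and> (\<forall>r\<ge>0. b' r \<le> norm h * b (r + 1)))"
  using assms
proof (induction rule: bounded_poly.induct)
  case (bounded_poly_const c)
  show ?case
    by (rule exI[of _ "\<lambda>v h. 0"]) (auto intro!: exI[of _ "\<lambda>r::real. 0"]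
        bounded_poly.bounded_poly_const[of "0::complex", simplified] simp: zero_le_mult_iff)
next
  case (bounded_poly_linear l K f b)
  then obtain f' where f': "\<And>v. (f has_derivative f' v) (at v)"
    and b': "\<And>h. \<exists>b'. bounded_poly (\<lambda>v. f' v h) b' \<and> (\<forall>r\<ge>0. b' r \<le> norm h * b (r + 1))" by blast
  let ?g = "\<lambda>v h. l v * f' v h + l h * f v"
  have "((\<lambda>v. l v * f v) has_derivative ?g v) (at v)" for v
    by (rule has_derivative_mult[OF bounded_linear.has_derivative[OF bounded_poly_linear(1) has_derivative_ident] f'])
  moreover have "\<exists>b'. bounded_poly (\<lambda>v. ?g v h) b' \<and> (\<forall>r\<ge>0. b' r \<le> norm h * (K * (r + 1) * b (r + 1)))" for h
  proof -
    obtain b1 where b1: "bounded_poly (\<lambda>v. f' v h) b1" "\<And>r. r \<ge> 0 \<Longrightarrow> b1 r \<le> norm h * b (r + 1)"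
      using b' by blast
    have "bounded_poly (\<lambda>v. ?g v h) (\<lambda>r. K * r * b1 r + norm (l h) * b r)"
      by (intro bounded_poly.bounded_poly_add bounded_poly.bounded_poly_linear[OF bounded_poly_linear(1-3)] b1
          bounded_poly_cmult[OF bounded_poly_linear(4)])
    moreover have "K * r * b1 r + norm (l h) * b r \<le> norm h * (K * (r + 1) * b (r + 1))" if "r \<ge> 0" for r
    proof -
      have "K * r * b1 r \<le> K * r * (norm h * b (r + 1))"
        by (intro mult_left_mono b1 that) (use that bounded_poly_linear(3) in auto)
      moreover have "norm (l h) * b r \<le> (K * norm h) * b (r + 1)"
        using bounded_poly_linear that
        by (intro mult_mono bounded_poly_mono[OF bounded_poly_linear(4)])
           (auto intro: bounded_poly_nonneg[OF bounded_poly_linear(4)])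
      ultimately show ?thesis by (simp add: algebra_simps)
    qed
    ultimately show ?thesis by blast
  qed
  ultimately show ?case by (intro exI[of _ ?g]) blast
next
  case (bounded_poly_add f b g c)
  then obtain f' g' where f': "\<And>v. (f has_derivative f' v) (at v)" "\<And>v. (g has_derivative g' v) (at v)"
    and b': "\<And>h. \<exists>b'. bounded_poly (\<lambda>v. f' v h) b' \<and> (\<forall>r\<ge>0. b' r \<le> norm h * b (r + 1))"
    and c': "\<And>h. \<exists>b'. bounded_poly (\<lambda>v. g' v h) b' \<and> (\<forall>r\<ge>0. b' r \<le> norm h * c (r + 1))"
    by (elim exE conjE) metis
  let ?g = "\<lambda>v h. f' v h + g' v h"
  have "\<exists>b'. bounded_poly (\<lambda>v. ?g v h) b' \<and> (\<forall>r\<ge>0. b' r \<le> norm h * (b (r + 1) + c (r + 1)))" for h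
  proof -
    obtain b1 c1 where *: "bounded_poly (\<lambda>v. f' v h) b1" "\<And>r. r \<ge> 0 \<Longrightarrow> b1 r \<le> norm h * b (r + 1)"
      "bounded_poly (\<lambda>v. g' v h) c1" "\<And>r. r \<ge> 0 \<Longrightarrow> c1 r \<le> norm h * c (r + 1)"
      using b' c' by blast
    show ?thesis
      by (rule exI[of _ "\<lambda>r. b1 r + c1 r"])
        (use bounded_poly.bounded_poly_add[OF *(1,3)] *(2,4) in \<open>auto simp: distrib_left intro: add_mono\<close>)
  qed
  then show ?case by (intro exI[of _ ?g]) (auto intro: has_derivative_add f')
qed

lemma bounded_poly_compose:
  assumes "bounded_poly f b" and A: "bounded_linear A" and n: "\<And>v. norm (A v) \<le> norm v"
  shows "bounded_poly (\<lambda>v. f (A v)) b"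
  using assms(1)
proof (induction rule: bounded_poly.induct)
  case (bounded_poly_linear l K f b)
  have "norm (l (A v)) \<le> K * norm v" for v
    using bounded_poly_linear(2)[of "A v"] mult_left_mono[OF n[of v] bounded_poly_linear(3)] by linarith
  then show ?case
    using bounded_linear_compose[OF bounded_poly_linear(1) A] bounded_poly_linear(3,5)
    by (intro bounded_poly.bounded_poly_linear) auto
qed (auto intro: bounded_poly.intros)

lemma bounded_poly_sum:
  "finite A \<Longrightarrow> (\<And>i. i \<in> A \<Longrightarrow> bounded_poly (f i) (b i)) \<Longrightarrow>
    bounded_poly (\<lambda>v. \<Sum>i\<in>A. f i v) (\<lambda>r. \<Sum>i\<in>A. b i r)"
  by (induction rule: finite_induct)
    (auto intro: bounded_poly_add bounded_poly_const[of "0::complex", simplified])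

definition dir_deriv :: "'v::real_normed_vector \<Rightarrow> ('v \<Rightarrow> complex) \<Rightarrow> 'v \<Rightarrow> complex" where
  "dir_deriv h f v = frechet_derivative f (at v) h"

lemma dir_deriv_eq: "(f has_derivative f') (at v) \<Longrightarrow> dir_deriv h f v = f' h"
  unfolding dir_deriv_def by (metis frechet_derivative_at)

lemma bounded_poly_differentiable: "bounded_poly f b \<Longrightarrow> f differentiable at v"
  using bounded_poly_derivative[of f b] unfolding differentiable_def by blast

lemma has_derivative_dir_deriv:
  "f differentiable at v \<Longrightarrow> (f has_derivative (\<lambda>h. dir_deriv h f v)) (at v)"
  unfolding dir_deriv_def using frechet_derivative_works by blast

lemma bounded_poly_dir_deriv:
  assumes "bounded_poly f b"
  shows "\<exists>b'. bounded_poly (dir_deriv h f) b' \<and> (\<forall>r\<ge>0. b' r \<le> norm h * b (r + 1))"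
proof -
  from bounded_poly_derivative[OF assms] obtain f' where f': "\<And>v. (f has_derivative f' v) (at v)"
    "\<And>h. \<exists>b'. bounded_poly (\<lambda>v. f' v h) b' \<and> (\<forall>r\<ge>0. b' r \<le> norm h * b (r + 1))" by blast
  have "dir_deriv h f = (\<lambda>v. f' v h)" using dir_deriv_eq[OF f'(1)] by auto
  with f'(2) show ?thesis by simp
qed

lemma dir_deriv_bound: "bounded_poly f b \<Longrightarrow> norm v \<le> r \<Longrightarrow> norm (dir_deriv h f v) \<le> norm h * b (r + 1)"
  using bounded_poly_dir_deriv[of f b h] bounded_poly_bound[of "dir_deriv h f" _ v r]
  by (meson norm_ge_zero order_trans)

lemma dir_deriv_mult:
  assumes "f differentiable at v" "g differentiable at v"
  shows "dir_deriv h (\<lambda>v. f v * g v) v = f v * dir_deriv h g v + dir_deriv h f v * g v"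
  by (rule dir_deriv_eq[OF has_derivative_mult[OF assms[THEN has_derivative_dir_deriv]]])

lemma dir_deriv_add:
  assumes "f differentiable at v" "g differentiable at v"
  shows "dir_deriv h (\<lambda>v. f v + g v) v = dir_deriv h f v + dir_deriv h g v"
  by (rule dir_deriv_eq[OF has_derivative_add[OF assms[THEN has_derivative_dir_deriv]]])

lemma dir_deriv_linear: "bounded_linear l \<Longrightarrow> dir_deriv h l v = l h"
  by (rule dir_deriv_eq[OF bounded_linear.has_derivative[OF _ has_derivative_ident]])

lemma bounded_linear_differentiable: "bounded_linear l \<Longrightarrow> l differentiable at v"
  using bounded_linear.has_derivative[OF _ has_derivative_ident] differentiable_def by blast

lemma dir_deriv_const [simp]: "dir_deriv h (\<lambda>_. c) v = 0"
  by (rule dir_deriv_eq) auto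

lemma bounded_poly_dir_deriv_commute:
  "bounded_poly f b \<Longrightarrow> dir_deriv h (dir_deriv k f) = dir_deriv k (dir_deriv h f)"
proof (induction rule: bounded_poly.induct)
  case (bounded_poly_const c)
  have "dir_deriv h (\<lambda>_::'a. c) = (\<lambda>_. 0)" for h by auto
  then show ?case by auto
next
  case (bounded_poly_linear l K f b)
  note l = bounded_poly_linear(1) and f = bounded_poly_linear(4)
  have 1: "dir_deriv h (\<lambda>v. l v * f v) = (\<lambda>v. l v * dir_deriv h f v + l h * f v)" for h
    using bounded_poly_differentiable[OF f] bounded_linear_differentiable[OF l]
    by (auto simp: dir_deriv_mult dir_deriv_linear[OF l])
  obtain b' where b': "\<And>h. bounded_poly (dir_deriv h f) (b' h)" using bounded_poly_dir_deriv[OF f] by metis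
  note d = bounded_poly_differentiable[OF b'] bounded_poly_differentiable[OF f] bounded_linear_differentiable[OF l]
  have "dir_deriv k (\<lambda>v. l v * dir_deriv h f v + l h * f v) v =
     l v * dir_deriv k (dir_deriv h f) v + l k * dir_deriv h f v + l h * dir_deriv k f v" for h k v
    by (subst dir_deriv_add) (auto intro!: derivative_intros d simp: dir_deriv_mult d dir_deriv_linear[OF l])
  then show ?case unfolding 1 using bounded_poly_linear.IH by auto
next
  case (bounded_poly_add f b g c)
  note d = bounded_poly_add(1,2)[THEN bounded_poly_differentiable]
  have 1: "dir_deriv h (\<lambda>v. f v + g v) = (\<lambda>v. dir_deriv h f v + dir_deriv h g v)" for h
    using d by (auto simp: dir_deriv_add)
  obtain b' c' where "\<And>h. bounded_poly (dir_deriv h f) (b' h)" "\<And>h. bounded_poly (dir_deriv h g) (c' h)"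
    using bounded_poly_dir_deriv bounded_poly_add(1,2) by metis
  note e = this[THEN bounded_poly_differentiable]
  show ?case unfolding 1 using bounded_poly_add.IH by (auto simp: dir_deriv_add e)
qed

text \<open>Summability of the majorants is required for every radius, so that it survives the shift of the
radius caused by a derivative.\<close>

definition poly_series :: "(nat \<Rightarrow> 'v::real_normed_vector \<Rightarrow> complex) \<Rightarrow> ('v \<Rightarrow> complex) \<Rightarrow> bool" where
  "poly_series p F \<longleftrightarrow>
     (\<exists>b. (\<forall>n. bounded_poly (p n) (b n)) \<and> (\<forall>r\<ge>0. summable (\<lambda>n. b n r))) \<and> (\<forall>v. (\<lambda>n. p n v) sums F v)"

text \<open>The tails of the differentiated series are uniformly small on each ball, because the shifted
majorants are summable.\<close>

lemma poly_series_derivative: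
  fixes F :: "'v::real_normed_vector \<Rightarrow> complex"
  assumes "poly_series p F"
  shows "(F has_derivative (\<lambda>h. \<Sum>n. dir_deriv h (p n) v)) (at v)"
    and "(\<lambda>n. dir_deriv h (p n) v) sums dir_deriv h F v"
proof -
  obtain b where b: "\<And>n. bounded_poly (p n) (b n)" "\<And>r. r \<ge> 0 \<Longrightarrow> summable (\<lambda>n. b n r)"
    and F: "\<And>v. (\<lambda>n. p n v) sums F v"
    using assms unfolding poly_series_def by blast
  have s: "summable (\<lambda>n. dir_deriv h (p n) v)" for h v
    by (rule summable_comparison_test'[OF summable_mult[OF b(2)[of "norm v + 1"], of "norm h"]])
      (auto intro: dir_deriv_bound[OF b(1)])
  have *: "(F has_derivative (\<lambda>h. \<Sum>n. dir_deriv h (p n) v)) (at v)" for v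
  proof -
    define r where "r = norm v + 1"
    define S where "S = ball (0::'v) r"
    have r: "r > 0" unfolding r_def by (smt (verit) norm_ge_zero)
    have vS: "v \<in> S" by (auto simp: S_def r_def)
    have "\<exists>g. \<forall>x\<in>S. (\<lambda>n. p n x) sums (g x) \<and> (g has_derivative (\<lambda>h. \<Sum>n. dir_deriv h (p n) x)) (at x within S)"
    proof (rule has_derivative_series)
      show "convex S" by (simp add: S_def)
      show "(p n has_derivative (\<lambda>h. dir_deriv h (p n) x)) (at x within S)" for n x
        using has_derivative_dir_deriv[OF bounded_poly_differentiable[OF b(1)]] has_derivative_at_withinI by blast
      show "v \<in> S" by fact
      show "(\<lambda>n. p n v) sums F v" by (rule F)
      fix e :: real assume e: "e > 0"
      obtain N where N: "\<And>n. n \<ge> N \<Longrightarrow> norm (\<Sum>i. b (i + n) (r + 1)) < e"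
        using suminf_exist_split[OF e b(2)[of "r+1"]] r by auto
      show "\<forall>\<^sub>F n in sequentially. \<forall>x\<in>S. \<forall>h. norm ((\<Sum>i<n. dir_deriv h (p i) x) - (\<Sum>n. dir_deriv h (p n) x)) \<le> e * norm h"
        unfolding eventually_sequentially
      proof (intro exI[of _ N] allI impI ballI)
        fix n and x h :: 'v assume n: "n \<ge> N" and x: "x \<in> S"
        have x': "norm x \<le> r" using x by (simp add: S_def)
        have sb: "summable (\<lambda>i. norm h * b (i + n) (r + 1))"
          using b(2)[of "r+1"] r by (intro summable_mult) (simp add: summable_iff_shift[of "\<lambda>i. b i (r+1)"])
        have "norm ((\<Sum>i<n. dir_deriv h (p i) x) - (\<Sum>n. dir_deriv h (p n) x)) = norm (\<Sum>i. dir_deriv h (p (i + n)) x)"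
          by (subst suminf_split_initial_segment[OF s, of _ _ n]) (simp add: norm_minus_commute)
        also have "\<dots> \<le> (\<Sum>i. norm h * b (i + n) (r + 1))"
          by (rule norm_suminf_le[OF _ sb]) (rule dir_deriv_bound[OF b(1) x'])
        also have "\<dots> = norm h * (\<Sum>i. b (i + n) (r + 1))"
          using b(2)[of "r+1"] r by (intro suminf_mult) (simp add: summable_iff_shift[of "\<lambda>i. b i (r+1)"])
        also have "\<dots> \<le> norm h * e" using N[OF n] by (intro mult_left_mono) auto
        finally show "norm ((\<Sum>i<n. dir_deriv h (p i) x) - (\<Sum>n. dir_deriv h (p n) x)) \<le> e * norm h"
          by (simp add: mult.commute)
      qed
    qed
    then obtain g where g: "\<And>x. x \<in> S \<Longrightarrow> (\<lambda>n. p n x) sums (g x)"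
      "(g has_derivative (\<lambda>h. \<Sum>n. dir_deriv h (p n) v)) (at v within S)" using vS by blast
    have "(g has_derivative (\<lambda>h. \<Sum>n. dir_deriv h (p n) v)) (at v)"
      using g(2) vS by (metis S_def at_within_open open_ball)
    then show ?thesis
      by (rule has_derivative_transform_within_open[OF _ _ vS])
        (use sums_unique2[OF g(1) F] in \<open>auto simp: S_def\<close>)
  qed
  then show "(F has_derivative (\<lambda>h. \<Sum>n. dir_deriv h (p n) v)) (at v)" .
  show "(\<lambda>n. dir_deriv h (p n) v) sums dir_deriv h F v"
    unfolding dir_deriv_eq[OF *] using s by (rule summable_sums)
qed

lemma poly_series_differentiable: "poly_series p F \<Longrightarrow> F differentiable at v"
  using poly_series_derivative(1) differentiable_def by blast

lemma poly_series_dir_deriv: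
  assumes "poly_series p F"
  shows "poly_series (\<lambda>n. dir_deriv h (p n)) (dir_deriv h F)"
proof -
  obtain b where b: "\<And>n. bounded_poly (p n) (b n)" "\<And>r. r \<ge> 0 \<Longrightarrow> summable (\<lambda>n. b n r)"
    using assms unfolding poly_series_def by blast
  obtain b' where b': "\<And>n. bounded_poly (dir_deriv h (p n)) (b' n)" "\<And>n r. r \<ge> 0 \<Longrightarrow> b' n r \<le> norm h * b n (r + 1)"
    using bounded_poly_dir_deriv[OF b(1)] by metis
  have "summable (\<lambda>n. b' n r)" if "r \<ge> 0" for r
    using b'(2) bounded_poly_nonneg[OF b'(1)] that
    by (intro summable_comparison_test'[OF summable_mult[OF b(2)[of "r + 1"], of "norm h"]]) auto
  with b'(1) poly_series_derivative(2)[OF assms] show ?thesis unfolding poly_series_def by blast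
qed

lemma poly_series_dir_deriv_commute:
  assumes "poly_series p F"
  shows "dir_deriv h (dir_deriv k F) = dir_deriv k (dir_deriv h F)"
proof
  fix v
  have "dir_deriv h (dir_deriv k (p n)) = dir_deriv k (dir_deriv h (p n))" for n
    using assms bounded_poly_dir_deriv_commute unfolding poly_series_def by blast
  with poly_series_derivative(2)[OF poly_series_dir_deriv[OF assms], of h k v]
    poly_series_derivative(2)[OF poly_series_dir_deriv[OF assms], of k h v]
  show "dir_deriv h (dir_deriv k F) v = dir_deriv k (dir_deriv h F) v"
    by (simp add: sums_unique2)
qed

section \<open>The bilinear form and reflections\<close>

lemma cdot_add_left: "cdot (x + y) w = cdot x w + cdot y w"
  and cdot_add_right: "cdot w (x + y) = cdot w x + cdot w y"
  and cdot_diff_left: "cdot (x - y) w = cdot x w - cdot y w"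
  and cdot_diff_right: "cdot w (x - y) = cdot w x - cdot w y"
  and cdot_scale_left: "cdot (c *s x) w = c * cdot x w"
  and cdot_scale_right: "cdot w (c *s x) = c * cdot w x"
  and cdot_zero_left [simp]: "cdot 0 w = 0"
  and cdot_zero_right [simp]: "cdot w 0 = 0"
  by (simp_all add: cdot_def algebra_simps sum.distrib sum_subtractf sum_distrib_left)

lemmas cdot_linear = cdot_add_left cdot_add_right cdot_diff_left cdot_diff_right
  cdot_scale_left cdot_scale_right

lemma cdot_commute: "cdot x y = cdot y x"
  by (simp add: cdot_def mult.commute)

lemma cdot_sum_right: "cdot w (\<Sum>i\<in>A. f i) = (\<Sum>i\<in>A. cdot w (f i))"
  by (induction A rule: infinite_finite_induct) (auto simp: cdot_linear)

lemma cdot_cvec: "cdot (cvec x) (cvec y) = complex_of_real (x \<bullet> y)"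
  by (simp add: cdot_def cvec_def inner_vec_def)

lemma cvec_add: "cvec (x + y) = cvec x + cvec y"
  and cvec_diff: "cvec (x - y) = cvec x - cvec y"
  and cvec_scaleR: "cvec (r *\<^sub>R x) = complex_of_real r *s cvec x"
  and cvec_minus: "cvec (- x) = - cvec x"
  and cvec_0 [simp]: "cvec 0 = 0"
  by (simp_all add: cvec_def vec_eq_iff)

lemma cdot_minus_left: "cdot (- x) w = - cdot x w" and cdot_minus_right: "cdot w (- x) = - cdot w x"
  by (simp_all add: cdot_def sum_negf)

lemma cdot_axis: "cdot (axis i 1) w = w $ i" "cdot w (axis i 1) = w $ i"
  by (simp_all add: cdot_def axis_def if_distrib[of "\<lambda>x. x * _"] if_distrib[of "\<lambda>x. _ * x"] cong: if_cong)

lemma cdot_bound: "norm (cdot z w) \<le> norm z * norm w"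
proof -
  have "norm (cdot z w) \<le> (\<Sum>i\<in>UNIV. norm (z $ i) * norm (w $ i))"
    unfolding cdot_def by (rule norm_sum[THEN order_trans]) (simp add: norm_mult)
  also have "\<dots> \<le> norm z * norm w"
    using L2_set_mult_ineq[of "\<lambda>i. norm (z $ i)" "\<lambda>i. norm (w $ i)" UNIV] by (simp add: norm_vec_def)
  finally show ?thesis .
qed

lemma scaleC_norm: "norm (c *s (z::complex^'n)) = norm c * norm z"
  by (simp add: norm_vec_def L2_set_def norm_mult power_mult_distrib real_sqrt_mult flip: sum_distrib_left)

lemma scaleR_scaleC: "r *\<^sub>R (z::complex^'n) = complex_of_real r *s z"
  by (simp only: vec_eq_iff vector_scaleR_component vector_smult_component) (simp add: scaleR_conv_of_real)

lemma norm_cvec [simp]: "norm (cvec x) = norm x"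
  by (simp add: cvec_def norm_vec_def)

lemma bounded_linear_cvec: "bounded_linear cvec"
  by (intro bounded_linear_intro[where K=1]) (auto simp: cvec_add cvec_scaleR scaleR_scaleC)

lemma bounded_linear_cdot_right: "bounded_linear (cdot a)"
  by (rule bounded_linear_intro[where K="norm a"])
    (auto simp: cdot_linear scaleR_scaleC mult.commute[of _ "norm a"] cdot_bound scaleR_conv_of_real)

lemma bounded_linear_cdot_left: "bounded_linear (\<lambda>z. cdot z a)"
proof -
  have "(\<lambda>z. cdot z a) = cdot a" by (auto simp: cdot_commute)
  then show ?thesis by (simp add: bounded_linear_cdot_right)
qed

lemma refl_along_involution: "\<alpha> \<noteq> 0 \<Longrightarrow> refl_along \<alpha> (refl_along \<alpha> x) = x"
  by (simp add: refl_along_def inner_diff_right inner_scaleR_right algebra_simps)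

lemma refl_along_inner: "\<alpha> \<noteq> 0 \<Longrightarrow> refl_along \<alpha> x \<bullet> refl_along \<alpha> y = x \<bullet> y"
  by (simp add: refl_along_def inner_diff_right inner_diff_left inner_commute[of x \<alpha>] field_simps)

lemma norm_refl_along: "\<alpha> \<noteq> 0 \<Longrightarrow> norm (refl_along \<alpha> x) = norm x"
  by (simp add: norm_eq_sqrt_inner refl_along_inner)

lemma refl_along_self: "\<alpha> \<noteq> 0 \<Longrightarrow> refl_along \<alpha> \<alpha> = - \<alpha>"
  by (simp add: refl_along_def scaleR_2)

lemma cdot_cvec_self_nonzero: "\<alpha> \<noteq> 0 \<Longrightarrow> cdot (cvec \<alpha>) (cvec \<alpha>) \<noteq> 0"
  by (simp add: cdot_cvec)

lemma crefl_along_cvec: "crefl_along \<alpha> (cvec x) = cvec (refl_along \<alpha> x)"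
  unfolding crefl_along_def refl_along_def cvec_diff cvec_scaleR cdot_cvec by simp

lemma crefl_along_add: "crefl_along \<alpha> (x + y) = crefl_along \<alpha> x + crefl_along \<alpha> y"
  and crefl_along_diff: "crefl_along \<alpha> (x - y) = crefl_along \<alpha> x - crefl_along \<alpha> y"
  and crefl_along_scale: "crefl_along \<alpha> (c *s x) = c *s crefl_along \<alpha> x"
  by (simp_all add: crefl_along_def cdot_linear vec_eq_iff add_divide_distrib diff_divide_distrib ring_distribs)

lemma cdot_crefl_along: "\<alpha> \<noteq> 0 \<Longrightarrow> cdot (cvec \<alpha>) (crefl_along \<alpha> z) = - cdot (cvec \<alpha>) z"
  using cdot_cvec_self_nonzero[of \<alpha>] by (simp add: crefl_along_def cdot_linear)

lemma crefl_along_involution: "\<alpha> \<noteq> 0 \<Longrightarrow> crefl_along \<alpha> (crefl_along \<alpha> z) = z"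
  using cdot_crefl_along[of \<alpha> z] by (simp add: crefl_along_def[of \<alpha> "crefl_along \<alpha> z"])
    (simp add: crefl_along_def vec_eq_iff)

lemma crefl_along_cdot: "\<alpha> \<noteq> 0 \<Longrightarrow> cdot (crefl_along \<alpha> x) (crefl_along \<alpha> y) = cdot x y"
  using cdot_cvec_self_nonzero[of \<alpha>]
  by (simp add: crefl_along_def cdot_linear cdot_commute[of x "cvec \<alpha>"] field_simps)

lemma crefl_along_fixed: "cdot (cvec \<alpha>) z = 0 \<Longrightarrow> crefl_along \<alpha> z = z"
  by (simp add: crefl_along_def)

text \<open>Conjugating a reflection by another reflection gives the reflection in the image of the root;
this is what moves Dunkl operators past reflections.\<close>

lemma crefl_along_conj:
  assumes "\<alpha> \<noteq> 0"
  shows "crefl_along \<alpha> (crefl_along \<beta> z) = crefl_along (refl_along \<alpha> \<beta>) (crefl_along \<alpha> z)"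
proof -
  have "cdot (cvec (refl_along \<alpha> \<beta>)) (crefl_along \<alpha> z) = cdot (cvec \<beta>) z"
    using assms by (simp flip: crefl_along_cvec add: crefl_along_cdot)
  moreover have "cdot (cvec (refl_along \<alpha> \<beta>)) (cvec (refl_along \<alpha> \<beta>)) = cdot (cvec \<beta>) (cvec \<beta>)"
    using assms by (simp flip: crefl_along_cvec add: crefl_along_cdot)
  ultimately show ?thesis
    unfolding crefl_along_def[of "refl_along \<alpha> \<beta>"]
    by (simp add: crefl_along_def[of \<beta>] crefl_along_diff crefl_along_scale crefl_along_cvec)
qed

lemma cdot_cnj: "cdot d (\<chi> i. cnj (d $ i)) = complex_of_real ((norm d)\<^sup>2)"
proof -
  have "(norm d)\<^sup>2 = (\<Sum>i\<in>UNIV. (norm (d $ i))\<^sup>2)"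
    by (simp add: norm_vec_def L2_set_def sum_nonneg)
  then show ?thesis by (simp add: cdot_def complex_norm_square del: of_real_power)
qed

text \<open>The reflection preserves the bilinear form, and it commutes with complex conjugation since its
root is real; the Hermitian norm is expressed by these two.\<close>

lemma norm_crefl_along:
  assumes "\<alpha> \<noteq> 0"
  shows "norm (crefl_along \<alpha> z) = norm z"
proof -
  define cj :: "complex^'a \<Rightarrow> complex^'a" where "cj = (\<lambda>d. \<chi> i. cnj (d $ i))"
  have "cj (crefl_along \<alpha> z) = crefl_along \<alpha> (cj z)"
    by (simp add: cj_def crefl_along_def vec_eq_iff cvec_def cdot_def)
  then have "complex_of_real ((norm (crefl_along \<alpha> z))\<^sup>2) = complex_of_real ((norm z)\<^sup>2)"
    using crefl_along_cdot[OF assms, of z "cj z"] cdot_cnj[of z] cdot_cnj[of "crefl_along \<alpha> z"]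
    by (simp add: cj_def)
  then show ?thesis by (metis norm_ge_zero of_real_eq_iff power2_eq_imp_eq)
qed

lemma bounded_linear_crefl_along: "\<alpha> \<noteq> 0 \<Longrightarrow> bounded_linear (crefl_along \<alpha>)"
  by (rule bounded_linear_intro[where K=1])
    (auto simp: crefl_along_add crefl_along_scale scaleR_scaleC norm_crefl_along)

section \<open>Root systems\<close>

locale dunkl_setup =
  fixes R Rp :: "(real^'n) set" and k :: "real^'n \<Rightarrow> real"
  assumes root_system: "root_system R" and positive_subsystem: "positive_subsystem R Rp"
    and multiplicity: "multiplicity_function R k"
begin

lemma finite_R: "finite R" and zero_notin_R: "0 \<notin> R"
  and refl_image_R: "\<alpha> \<in> R \<Longrightarrow> refl_along \<alpha> ` R = R"
  using root_system unfolding root_system_def by auto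

lemma Rp_subset: "Rp \<subseteq> R" using positive_subsystem unfolding positive_subsystem_def by auto

lemma finite_Rp [simp, intro]: "finite Rp" using finite_R Rp_subset finite_subset by blast

lemma R_nonzero: "\<alpha> \<in> R \<Longrightarrow> \<alpha> \<noteq> 0" using zero_notin_R by auto

lemma Rp_nonzero: "\<alpha> \<in> Rp \<Longrightarrow> \<alpha> \<noteq> 0" using R_nonzero Rp_subset by auto

lemma Rp_R: "\<alpha> \<in> Rp \<Longrightarrow> \<alpha> \<in> R" using Rp_subset by auto

lemma refl_in_R: "\<alpha> \<in> R \<Longrightarrow> \<beta> \<in> R \<Longrightarrow> refl_along \<alpha> \<beta> \<in> R" using refl_image_R by blast

lemma minus_in_R: "\<alpha> \<in> R \<Longrightarrow> - \<alpha> \<in> R"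
  using refl_in_R[of \<alpha> \<alpha>] refl_along_self[OF R_nonzero, of \<alpha>] by simp

lemma k_nonneg: "\<alpha> \<in> R \<Longrightarrow> 0 \<le> k \<alpha>"
  using multiplicity unfolding multiplicity_function_def by blast

lemma k_nonneg': "\<alpha> \<in> Rp \<Longrightarrow> 0 \<le> k \<alpha>" using k_nonneg Rp_R by blast

lemma k_refl: "\<alpha> \<in> R \<Longrightarrow> \<beta> \<in> R \<Longrightarrow> k (refl_along \<alpha> \<beta>) = k \<beta>"
  using multiplicity reflection_group_comp[OF reflection_group_id, of \<alpha> R]
  unfolding multiplicity_function_def by auto

lemma k_minus: "\<alpha> \<in> R \<Longrightarrow> k (- \<alpha>) = k \<alpha>"
  using k_refl[of \<alpha> \<alpha>] refl_along_self[OF R_nonzero, of \<alpha>] by simp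

lemma R_eq: "R = Rp \<union> uminus ` Rp" and Rp_disjoint: "Rp \<inter> uminus ` Rp = {}"
proof -
  obtain b where b: "\<And>\<alpha>. \<alpha> \<in> R \<Longrightarrow> b \<bullet> \<alpha> \<noteq> 0" "Rp = {\<alpha>\<in>R. b \<bullet> \<alpha> > 0}"
    using positive_subsystem unfolding positive_subsystem_def by blast
  show "Rp \<inter> uminus ` Rp = {}" unfolding b(2) by auto
  show "R = Rp \<union> uminus ` Rp"
  proof (intro equalityI subsetI)
    fix x assume x: "x \<in> R"
    show "x \<in> Rp \<union> uminus ` Rp"
    proof (cases "b \<bullet> x > 0")
      case False
      then have "- x \<in> Rp" using b(1)[OF x] minus_in_R[OF x] unfolding b(2) by auto
      then have "x \<in> uminus ` Rp" by (metis image_eqI minus_minus)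
      then show ?thesis by blast
    qed (use x b in auto)
  qed (use Rp_R minus_in_R in auto)
qed

text \<open>\<open>R\<close> is the disjoint union of \<open>Rp\<close> and its negative.\<close>

lemma sum_even:
  fixes h :: "real^'n \<Rightarrow> complex"
  assumes "\<And>\<beta>. \<beta> \<in> R \<Longrightarrow> h (- \<beta>) = h \<beta>"
  shows "sum h R = 2 * sum h Rp"
proof -
  have "sum h R = sum h Rp + sum h (uminus ` Rp)"
    by (subst R_eq, rule sum.union_disjoint) (use Rp_disjoint in auto)
  also have "sum h (uminus ` Rp) = sum h Rp"
    by (subst sum.reindex) (auto simp: inj_on_def assms Rp_R intro!: sum.cong)
  finally show ?thesis by simp
qed

text \<open>Reflections do not preserve \<open>Rp\<close>, but an even summand sees \<open>Rp\<close> as one half of \<open>R\<close>, which they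
do preserve.\<close>

lemma sum_refl:
  fixes h :: "real^'n \<Rightarrow> complex"
  assumes \<alpha>: "\<alpha> \<in> R" and h: "\<And>\<beta>. \<beta> \<in> R \<Longrightarrow> h (- \<beta>) = h \<beta>"
  shows "(\<Sum>\<beta>\<in>Rp. h (refl_along \<alpha> \<beta>)) = sum h Rp"
proof -
  have m: "refl_along \<alpha> (- \<beta>) = - refl_along \<alpha> \<beta>" for \<beta> by (simp add: refl_along_def)
  have inj: "inj_on (refl_along \<alpha>) R" by (metis inj_onI refl_along_involution[OF R_nonzero[OF \<alpha>]])
  have "2 * (\<Sum>\<beta>\<in>Rp. h (refl_along \<alpha> \<beta>)) = (\<Sum>\<beta>\<in>R. h (refl_along \<alpha> \<beta>))"
    by (subst sum_even[symmetric]) (auto simp: m h refl_in_R[OF \<alpha>])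
  also have "\<dots> = sum h (refl_along \<alpha> ` R)" using inj by (simp add: sum.reindex)
  also have "\<dots> = 2 * sum h Rp" using refl_image_R[OF \<alpha>] sum_even[of h, OF h] by simp
  finally show ?thesis by simp
qed

lemma regular_direction: "\<exists>b. \<forall>\<alpha>\<in>Rp. \<alpha> \<bullet> b \<noteq> 0"
  using positive_subsystem unfolding positive_subsystem_def by (metis Rp_R inner_commute)

section \<open>The resolvent on the reflection group\<close>

text \<open>The group is built by multiplication from the right, since a reflection acts on a combination
\<open>\<Sum>u. c u * f (u z)\<close> by right multiplication of the indices \<open>u\<close>.\<close>

inductive_set W :: "(complex^'n \<Rightarrow> complex^'n) set" where
  W_id: "id \<in> W"
| W_comp: "u \<in> W \<Longrightarrow> \<alpha> \<in> Rp \<Longrightarrow> u \<circ> crefl_along \<alpha> \<in> W"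

lemma W_add: "u \<in> W \<Longrightarrow> u (x + y) = u x + u y"
  and W_scale: "u \<in> W \<Longrightarrow> u (c *s x) = c *s u x"
  and W_cdot: "u \<in> W \<Longrightarrow> cdot (u x) (u y) = cdot x y"
  and W_norm: "u \<in> W \<Longrightarrow> norm (u x) = norm x"
  by (induction arbitrary: x y rule: W.induct)
    (auto simp: crefl_along_add crefl_along_scale crefl_along_cdot norm_crefl_along Rp_nonzero)

lemma bounded_linear_W: "u \<in> W \<Longrightarrow> bounded_linear u"
  by (rule bounded_linear_intro[where K=1]) (auto simp: W_add W_scale W_norm scaleR_scaleC)

lemma W_cvec_R: "u \<in> W \<Longrightarrow> \<beta> \<in> R \<Longrightarrow> u (cvec \<beta>) \<in> cvec ` R"
  by (induction arbitrary: \<beta> rule: W.induct) (auto simp: crefl_along_cvec refl_in_R Rp_R)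

text \<open>Group elements fix the orthogonal complement of the roots; in this form the fact is available
for the complexified group as well.\<close>

lemma W_span: "u \<in> W \<Longrightarrow> \<exists>c. u z - z = (\<Sum>\<alpha>\<in>Rp. c \<alpha> *s cvec \<alpha>)"
proof (induction arbitrary: z rule: W.induct)
  case W_id
  show ?case by (rule exI[of _ "\<lambda>_. 0"]) simp
next
  case (W_comp u \<alpha>)
  obtain c where c: "u (crefl_along \<alpha> z) - crefl_along \<alpha> z = (\<Sum>\<alpha>\<in>Rp. c \<alpha> *s cvec \<alpha>)" using W_comp.IH by blast
  obtain d where d: "crefl_along \<alpha> z = z + d *s cvec \<alpha>"
    by (metis add_uminus_conv_diff crefl_along_def vector_smult_lneg)
  have "(\<Sum>\<beta>\<in>Rp. (c \<beta> + (if \<beta> = \<alpha> then d else 0)) *s cvec \<beta>) =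
     (\<Sum>\<beta>\<in>Rp. c \<beta> *s cvec \<beta>) + (\<Sum>\<beta>\<in>Rp. if \<beta> = \<alpha> then d *s cvec \<beta> else 0)"
    unfolding sum.distrib[symmetric] by (intro sum.cong) (auto simp: vec_eq_iff algebra_simps)
  also have "(\<Sum>\<beta>\<in>Rp. if \<beta> = \<alpha> then d *s cvec \<beta> else 0) = d *s cvec \<alpha>"
    using W_comp(2) by (simp add: sum.delta)
  finally show ?case
    using c d by (intro exI[of _ "\<lambda>\<beta>. c \<beta> + (if \<beta> = \<alpha> then d else 0)"]) (simp add: algebra_simps)
qed

lemma W_bij_R: 
  assumes "u \<in> W" shows "u ` cvec ` R = cvec ` R"
proof (rule card_subset_eq)
  show "u ` cvec ` R \<subseteq> cvec ` R" using W_cvec_R[OF assms] by auto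
  have "inj u"
    using assms by (intro injI) (metis W_norm W_add W_scale norm_eq_zero add_uminus_conv_diff eq_iff_diff_eq_0 vector_sneg_minus1)
  then show "card (u ` cvec ` R) = card (cvec ` R)" by (meson card_image inj_on_subset subset_UNIV)
qed (simp add: finite_R)

text \<open>An element is determined by its action on the finitely many roots: if \<open>u\<close> and \<open>u'\<close> agree there, then
\<open>u z - u' z\<close> is orthogonal to all roots and lies in their span. The span is closed under
conjugation, so this vector vanishes.\<close>

lemma finite_W: "finite W"
proof (rule finite_imageD)
  let ?f = "\<lambda>u. restrict (\<lambda>\<beta>. u (cvec \<beta>)) R"
  have "?f ` W \<subseteq> PiE R (\<lambda>_. cvec ` R)" using W_cvec_R by auto
  then show "finite (?f ` W)" by (rule finite_subset) (simp add: finite_PiE finite_R)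
  show "inj_on ?f W"
  proof (rule inj_onI)
    fix u u' assume u: "u \<in> W" "u' \<in> W" and eq: "?f u = ?f u'"
    have eq': "u (cvec \<beta>) = u' (cvec \<beta>)" if "\<beta> \<in> R" for \<beta>
      using fun_cong[OF eq, of \<beta>] that by simp
    show "u = u'"
    proof
      fix z
      define d where "d = u z - u' z"
      have o: "cdot d (cvec \<gamma>) = 0" if "\<gamma> \<in> R" for \<gamma>
      proof -
        have "cvec \<gamma> \<in> u ` cvec ` R" using W_bij_R[OF u(1)] that by simp
        then obtain \<beta> where \<beta>: "\<beta> \<in> R" "cvec \<gamma> = u (cvec \<beta>)" by auto
        have "cdot d (cvec \<gamma>) = cdot (u z) (u (cvec \<beta>)) - cdot (u' z) (u' (cvec \<beta>))"
          by (simp only: d_def \<beta>(2) cdot_diff_left eq'[OF \<beta>(1)])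
        then show ?thesis by (simp only: W_cdot[OF u(1)] W_cdot[OF u(2)]) simp
      qed
      obtain c c' where c: "u z - z = (\<Sum>\<alpha>\<in>Rp. c \<alpha> *s cvec \<alpha>)" "u' z - z = (\<Sum>\<alpha>\<in>Rp. c' \<alpha> *s cvec \<alpha>)"
        using W_span u by meson
      have "d = (u z - z) - (u' z - z)" by (simp add: d_def)
      also have "\<dots> = (\<Sum>\<alpha>\<in>Rp. (c \<alpha> - c' \<alpha>) *s cvec \<alpha>)"
        unfolding c by (simp add: vec_eq_iff sum_subtractf algebra_simps)
      finally have d: "d = (\<Sum>\<alpha>\<in>Rp. (c \<alpha> - c' \<alpha>) *s cvec \<alpha>)" .
      have "(\<chi> i. cnj (d $ i)) = (\<Sum>\<alpha>\<in>Rp. cnj (c \<alpha> - c' \<alpha>) *s cvec \<alpha>)"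
        by (subst d) (simp add: vec_eq_iff cvec_def)
      then have "complex_of_real ((norm d)\<^sup>2) = 0"
        using o Rp_R unfolding cdot_cnj[symmetric] by (simp add: cdot_sum_right cdot_linear)
      then show "u z = u' z" by (simp add: d_def)
    qed
  qed
qed

lemma sum_W_comp:
  assumes "\<alpha> \<in> Rp"
  shows "(\<Sum>u\<in>W. h (u \<circ> crefl_along \<alpha>)) = (\<Sum>u\<in>W. h u)"
proof -
  have i: "u \<circ> crefl_along \<alpha> \<circ> crefl_along \<alpha> = u" for u
    by (auto simp: crefl_along_involution[OF Rp_nonzero[OF assms]])
  have "bij_betw (\<lambda>u. u \<circ> crefl_along \<alpha>) W W"
    by (rule bij_betwI[where g="\<lambda>u. u \<circ> crefl_along \<alpha>"]) (auto simp: W_comp assms i)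
  then show ?thesis by (rule sum.reindex_bij_betw)
qed

abbreviation "\<gamma> \<equiv> sum k Rp"

lemma \<gamma>_nonneg: "0 \<le> \<gamma>" by (rule sum_nonneg) (rule k_nonneg')

text \<open>The coefficients of the powers of \<open>\<Sum>\<alpha>\<in>Rp. k \<alpha> \<sigma>\<^sub>\<alpha>\<close> in the group algebra.\<close>

primrec walk :: "nat \<Rightarrow> (complex^'n \<Rightarrow> complex^'n) \<Rightarrow> real" where
  "walk 0 u = of_bool (u = id)"
| "walk (Suc m) u = (\<Sum>\<alpha>\<in>Rp. k \<alpha> * walk m (u \<circ> crefl_along \<alpha>))"

lemma walk_nonneg: "0 \<le> walk m u"
  by (induction m arbitrary: u) (auto intro!: sum_nonneg mult_nonneg_nonneg k_nonneg')

lemma walk_le: "walk m u \<le> \<gamma> ^ m"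
proof (induction m arbitrary: u)
  case (Suc m)
  have "walk (Suc m) u \<le> (\<Sum>\<alpha>\<in>Rp. k \<alpha> * \<gamma> ^ m)"
    using Suc by (auto intro!: sum_mono mult_left_mono k_nonneg')
  then show ?case by (simp flip: sum_distrib_right)
qed auto

text \<open>The Neumann series of \<open>(\<nu> + \<gamma> - (\<Sum>\<alpha>\<in>Rp. k \<alpha> \<sigma>\<^sub>\<alpha>))\<^sup>-\<^sup>1\<close>; it converges since the sum of reflections has
norm at most \<open>\<gamma>\<close>.\<close>

definition resolvent :: "real \<Rightarrow> (complex^'n \<Rightarrow> complex^'n) \<Rightarrow> real" where
  "resolvent \<nu> u = (\<Sum>m. walk m u / (\<nu> + \<gamma>) ^ Suc m)"

lemma resolvent_summable:
  assumes "\<nu> > 0" shows "summable (\<lambda>m. walk m u / (\<nu> + \<gamma>) ^ Suc m)"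
proof (rule summable_comparison_test')
  have "\<nu> + \<gamma> > 0" using assms \<gamma>_nonneg by linarith
  then show "summable (\<lambda>m. (1 / (\<nu> + \<gamma>)) * (\<gamma> / (\<nu> + \<gamma>)) ^ m)"
    using assms \<gamma>_nonneg by (intro summable_mult summable_geometric) (simp add: field_simps)
  show "norm (walk m u / (\<nu> + \<gamma>) ^ Suc m) \<le> (1 / (\<nu> + \<gamma>)) * (\<gamma> / (\<nu> + \<gamma>)) ^ m" for m
    using walk_le[of m u] walk_nonneg[of m u] \<open>\<nu> + \<gamma> > 0\<close>
    by (simp add: power_divide divide_simps abs_mult)
qed

lemma resolvent_nonneg: "\<nu> > 0 \<Longrightarrow> 0 \<le> resolvent \<nu> u"
  unfolding resolvent_def using \<gamma>_nonneg
  by (intro suminf_nonneg resolvent_summable divide_nonneg_nonneg walk_nonneg) auto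

lemma resolvent_eq:
  assumes "\<nu> > 0"
  shows "(\<nu> + \<gamma>) * resolvent \<nu> u - (\<Sum>\<alpha>\<in>Rp. k \<alpha> * resolvent \<nu> (u \<circ> crefl_along \<alpha>)) = of_bool (u = id)"
proof -
  have p: "\<nu> + \<gamma> > 0" using assms \<gamma>_nonneg by linarith
  have "(\<Sum>\<alpha>\<in>Rp. k \<alpha> * resolvent \<nu> (u \<circ> crefl_along \<alpha>))
      = (\<Sum>\<alpha>\<in>Rp. \<Sum>m. k \<alpha> * (walk m (u \<circ> crefl_along \<alpha>) / (\<nu> + \<gamma>) ^ Suc m))"
    unfolding resolvent_def by (intro sum.cong refl suminf_mult[symmetric] resolvent_summable assms)
  also have "\<dots> = (\<Sum>m. \<Sum>\<alpha>\<in>Rp. k \<alpha> * (walk m (u \<circ> crefl_along \<alpha>) / (\<nu> + \<gamma>) ^ Suc m))"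
    by (rule suminf_sum[symmetric]) (intro summable_mult resolvent_summable assms)
  also have "\<dots> = (\<Sum>m. walk (Suc m) u / (\<nu> + \<gamma>) ^ Suc m)"
    by (simp add: sum_divide_distrib)
  also have "\<dots> = (\<Sum>m. (\<nu> + \<gamma>) * (walk (Suc m) u / (\<nu> + \<gamma>) ^ Suc (Suc m)))"
    using p by (intro suminf_cong) simp
  also have "\<dots> = (\<nu> + \<gamma>) * (\<Sum>m. walk (Suc m) u / (\<nu> + \<gamma>) ^ Suc (Suc m))"
    using resolvent_summable[OF assms, of u] summable_Suc_iff[of "\<lambda>m. walk m u / (\<nu> + \<gamma>) ^ Suc m"]
    by (intro suminf_mult) blast
  also have "(\<Sum>m. walk (Suc m) u / (\<nu> + \<gamma>) ^ Suc (Suc m)) = resolvent \<nu> u - walk 0 u / (\<nu> + \<gamma>) ^ Suc 0"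
    unfolding resolvent_def by (rule suminf_split_head[OF resolvent_summable[OF assms]])
  finally have "(\<Sum>\<alpha>\<in>Rp. k \<alpha> * resolvent \<nu> (u \<circ> crefl_along \<alpha>))
      = (\<nu> + \<gamma>) * (resolvent \<nu> u - walk 0 u / (\<nu> + \<gamma>) ^ Suc 0)" .
  moreover have "(\<nu> + \<gamma>) * (walk 0 u / (\<nu> + \<gamma>) ^ Suc 0) = of_bool (u = id)" using p by simp
  ultimately show ?thesis by (simp only: right_diff_distrib)
qed

text \<open>Summation of the resolvent equation over the group. The factors \<open>1 / n\<close> will multiply up to the
factorials that make the kernel series converge.\<close>

lemma resolvent_sum:
  assumes "\<nu> > 0" shows "(\<Sum>u\<in>W. resolvent \<nu> u) = 1 / \<nu>"
proof -
  have "1 = (\<Sum>u\<in>W. of_bool (u = id) :: real)"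
    using W_id finite_W by (simp add: of_bool_def)
  also have "\<dots> = (\<Sum>u\<in>W. (\<nu> + \<gamma>) * resolvent \<nu> u - (\<Sum>\<alpha>\<in>Rp. k \<alpha> * resolvent \<nu> (u \<circ> crefl_along \<alpha>)))"
    by (simp add: resolvent_eq[OF assms])
  also have "\<dots> = (\<nu> + \<gamma>) * (\<Sum>u\<in>W. resolvent \<nu> u) - (\<Sum>\<alpha>\<in>Rp. k \<alpha> * (\<Sum>u\<in>W. resolvent \<nu> (u \<circ> crefl_along \<alpha>)))"
    by (simp add: sum_subtractf sum_distrib_left sum.swap[of _ W])
  also have "\<dots> = \<nu> * (\<Sum>u\<in>W. resolvent \<nu> u)"
    by (simp add: sum_W_comp[where h="resolvent \<nu>"] algebra_simps flip: sum_distrib_right cong: sum.cong)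
  finally show ?thesis using assms by (simp add: field_simps)
qed

section \<open>The Dunkl kernel as a power series\<close>

text \<open>The homogeneous parts of the Dunkl kernel, defined by applying the resolvent with \<open>\<nu> = n\<close> to
\<open>\<langle>z,w\<rangle>\<close> times the previous part.\<close>

primrec kernel_poly :: "nat \<Rightarrow> complex^'n \<Rightarrow> complex^'n \<Rightarrow> complex" where
  "kernel_poly 0 z w = 1"
| "kernel_poly (Suc n) z w =
     (\<Sum>u\<in>W. complex_of_real (resolvent (real (Suc n)) u) * (cdot (u z) w * kernel_poly n (u z) w))"

text \<open>The radial equation in degree \<open>n + 1\<close>: the resolvent equation, transported from coefficients to
functions by reindexing the group.\<close>

lemma kernel_poly_radial:
  "(of_nat (Suc n) + complex_of_real \<gamma>) * kernel_poly (Suc n) z w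
     - (\<Sum>\<alpha>\<in>Rp. complex_of_real (k \<alpha>) * kernel_poly (Suc n) (crefl_along \<alpha> z) w)
   = cdot z w * kernel_poly n z w"
proof -
  define g where "g = (\<lambda>z. cdot z w * kernel_poly n z w)"
  define c where "c = (\<lambda>u. complex_of_real (resolvent (real (Suc n)) u))"
  have E: "kernel_poly (Suc n) z w = (\<Sum>u\<in>W. c u * g (u z))" for z by (simp add: g_def c_def)
  have ceq: "(of_nat (Suc n) + complex_of_real \<gamma>) * c u - (\<Sum>\<alpha>\<in>Rp. complex_of_real (k \<alpha>) * c (u \<circ> crefl_along \<alpha>))
      = of_bool (u = id)" for u
    using arg_cong[OF resolvent_eq[of "real (Suc n)" u], of complex_of_real] by (simp add: c_def)
  have "kernel_poly (Suc n) (crefl_along \<alpha> z) w = (\<Sum>u\<in>W. c (u \<circ> crefl_along \<alpha>) * g (u z))" if "\<alpha> \<in> Rp" for \<alpha>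
    unfolding E
    by (subst sum_W_comp[OF that, symmetric]) (simp add: crefl_along_involution[OF Rp_nonzero[OF that]])
  then have "(\<Sum>\<alpha>\<in>Rp. complex_of_real (k \<alpha>) * kernel_poly (Suc n) (crefl_along \<alpha> z) w)
      = (\<Sum>u\<in>W. \<Sum>\<alpha>\<in>Rp. complex_of_real (k \<alpha>) * (c (u \<circ> crefl_along \<alpha>) * g (u z)))"
    by (subst sum.swap) (simp add: sum_distrib_left)
  then have "(of_nat (Suc n) + complex_of_real \<gamma>) * kernel_poly (Suc n) z w
     - (\<Sum>\<alpha>\<in>Rp. complex_of_real (k \<alpha>) * kernel_poly (Suc n) (crefl_along \<alpha> z) w)
    = (\<Sum>u\<in>W. ((of_nat (Suc n) + complex_of_real \<gamma>) * c u - (\<Sum>\<alpha>\<in>Rp. complex_of_real (k \<alpha>) * c (u \<circ> crefl_along \<alpha>))) * g (u z))"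
    unfolding E by (simp add: sum_subtractf sum_distrib_left left_diff_distrib sum_distrib_right mult.assoc)
  also have "\<dots> = g z"
    unfolding ceq using finite_W W_id by (simp add: of_bool_def if_distrib[of "\<lambda>x. x * _"] cong: if_cong)
  finally show ?thesis by (simp add: g_def)
qed

text \<open>Group elements are isometries, so a step costs the factor \<open>CARD('n) * r\<^sup>2\<close> for the bilinear form
times the total mass \<open>1 / n\<close> of the resolvent.\<close>

lemma kernel_poly_bounded:
  "\<exists>b. bounded_poly (\<lambda>v. kernel_poly n (fst v) (snd v)) b \<and>
     (\<forall>r\<ge>0. b r \<le> (real CARD('n) * r\<^sup>2) ^ n / fact n)"
proof (induction n)
  case 0
  show ?case using bounded_poly_const[of "1::complex"] by (intro exI[of _ "\<lambda>r. 1"]) auto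
next
  case (Suc n)
  then obtain b where b: "bounded_poly (\<lambda>v. kernel_poly n (fst v) (snd v)) b"
    "\<And>r. r \<ge> 0 \<Longrightarrow> b r \<le> (real CARD('n) * r\<^sup>2) ^ n / fact n" by blast
  have 1: "bounded_poly (\<lambda>v. kernel_poly n (u (fst v)) (snd v)) b" if u: "u \<in> W" for u
  proof -
    have "bounded_linear (\<lambda>v::(complex^'n) \<times> (complex^'n). (u (fst v), snd v))"
      by (intro bounded_linear_Pair bounded_linear_compose[OF bounded_linear_W[OF u]] bounded_linear_fst bounded_linear_snd)
    from bounded_poly_compose[OF b(1) this] show ?thesis by (simp add: norm_prod_def W_norm[OF u])
  qed
  have 2: "bounded_poly (\<lambda>v. u (fst v) $ i * (snd v $ i * kernel_poly n (u (fst v)) (snd v)))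
       (\<lambda>r. 1 * r * (1 * r * b r))" if u: "u \<in> W" for u i
  proof (intro bounded_poly_linear 1[OF u])
    show "bounded_linear (\<lambda>v. u (fst v) $ i)"
      by (intro bounded_linear_compose[OF bounded_linear_vec_nth] bounded_linear_compose[OF bounded_linear_W[OF u]] bounded_linear_fst)
    show "bounded_linear (\<lambda>v. snd v $ i)"
      by (intro bounded_linear_compose[OF bounded_linear_vec_nth] bounded_linear_snd)
    show "norm (u (fst v) $ i) \<le> 1 * norm v" for v :: "(complex^'n) \<times> (complex^'n)"
      using Finite_Cartesian_Product.norm_nth_le[of "u (fst v)" i] norm_fst_le[of "fst v" "snd v"] W_norm[OF u, of "fst v"]
      by simp
    show "norm (snd v $ i) \<le> 1 * norm v" for v :: "(complex^'n) \<times> (complex^'n)"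
      using norm_snd_le[of "snd v" "fst v"] Finite_Cartesian_Product.norm_nth_le[of "snd v" i] by simp
  qed auto
  have "bounded_poly (\<lambda>v. \<Sum>u\<in>W. complex_of_real (resolvent (real (Suc n)) u) *
       (\<Sum>i\<in>UNIV. u (fst v) $ i * (snd v $ i * kernel_poly n (u (fst v)) (snd v))))
     (\<lambda>r. \<Sum>u\<in>W. norm (complex_of_real (resolvent (real (Suc n)) u)) * (\<Sum>i\<in>(UNIV::'n set). 1 * r * (1 * r * b r)))"
    by (intro bounded_poly_sum finite_W bounded_poly_cmult 2 finite)
  moreover have "(\<Sum>u\<in>W. norm (complex_of_real (resolvent (real (Suc n)) u)) * (\<Sum>i\<in>(UNIV::'n set). 1 * r * (1 * r * b r)))
     = (real CARD('n) * r\<^sup>2) * b r / real (Suc n)" for r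
    using resolvent_sum[of "real (Suc n)"] resolvent_nonneg[of "real (Suc n)"]
    by (simp add: power2_eq_square flip: sum_distrib_right)
  moreover have "(real CARD('n) * r\<^sup>2) * b r / real (Suc n) \<le> (real CARD('n) * r\<^sup>2) ^ Suc n / fact (Suc n)" if "r \<ge> 0" for r
  proof -
    have "(real CARD('n) * r\<^sup>2) * b r \<le> (real CARD('n) * r\<^sup>2) * ((real CARD('n) * r\<^sup>2) ^ n / fact n)"
      using b(2)[OF that] by (intro mult_left_mono) auto
    moreover have "A * (A ^ n / fact n) / real (Suc n) = A ^ Suc n / fact (Suc n)" for A :: real
      by (simp add: divide_simps)
    ultimately show ?thesis by (metis divide_right_mono of_nat_0_le_iff)
  qed
  ultimately show ?case
    by (intro exI[of _ "\<lambda>r. (real CARD('n) * r\<^sup>2) * b r / real (Suc n)"])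
      (simp add: cdot_def sum_distrib_right mult.assoc)
qed

definition kernel :: "(complex^'n) \<times> (complex^'n) \<Rightarrow> complex" where
  "kernel v = (\<Sum>n. kernel_poly n (fst v) (snd v))"

lemma kernel_series: "poly_series (\<lambda>n v. kernel_poly n (fst v) (snd v)) kernel"
proof -
  obtain b where b: "\<And>n. bounded_poly (\<lambda>v. kernel_poly n (fst v) (snd v)) (b n)"
     "\<And>n r. r \<ge> 0 \<Longrightarrow> b n r \<le> (real CARD('n) * r\<^sup>2) ^ n / fact n"
    using kernel_poly_bounded by metis
  have s: "summable (\<lambda>n. b n r)" if "r \<ge> 0" for r
  proof (rule summable_comparison_test'[OF summable_exp[of "real CARD('n) * r\<^sup>2"]])
    show "norm (b n r) \<le> inverse (fact n) * (real CARD('n) * r\<^sup>2) ^ n" for n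
      using b(2)[OF that, of n] bounded_poly_nonneg[OF b(1) that, of n] by (simp add: divide_inverse mult.commute)
  qed
  have "summable (\<lambda>n. kernel_poly n (fst v) (snd v))" for v
    using bounded_poly_bound[OF b(1) order_refl] by (intro summable_comparison_test'[OF s[of "norm v"], of 0]) auto
  with s b(1) show ?thesis unfolding poly_series_def kernel_def by (blast intro: summable_sums)
qed

end

section \<open>Dunkl operators\<close>

text \<open>Directional derivatives are taken over the reals; holomorphy is their complex homogeneity in the
direction.\<close>

lemma entire_several_iff:
  "entire_several f \<longleftrightarrow> (\<forall>z. f differentiable at z) \<and> (\<forall>z c v. dir_deriv (c *s v) f z = c * dir_deriv v f z)"
proof
  assume "entire_several f"
  then obtain f' where f': "\<And>z. (f has_derivative f' z) (at z)" "\<And>z c v. f' z (c *s v) = c * f' z v"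
    unfolding entire_several_def by metis
  show "(\<forall>z. f differentiable at z) \<and> (\<forall>z c v. dir_deriv (c *s v) f z = c * dir_deriv v f z)"
    using f' by (auto simp: differentiable_def dir_deriv_eq[OF f'(1)])
next
  assume "(\<forall>z. f differentiable at z) \<and> (\<forall>z c v. dir_deriv (c *s v) f z = c * dir_deriv v f z)"
  then show "entire_several f"
    unfolding entire_several_def using has_derivative_dir_deriv by blast
qed

lemma entire_several_differentiable: "entire_several f \<Longrightarrow> f differentiable at z"
  and dir_deriv_scale: "entire_several f \<Longrightarrow> dir_deriv (c *s v) f z = c * dir_deriv v f z"
  by (auto simp: entire_several_iff)

lemma dir_deriv_add_direction:
  assumes "f differentiable at z" shows "dir_deriv (v + w) f z = dir_deriv v f z + dir_deriv w f z"
proof -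
  interpret bounded_linear "\<lambda>h. dir_deriv h f z"
    using has_derivative_dir_deriv[OF assms] by (rule has_derivative_bounded_linear)
  show ?thesis by (rule add)
qed

lemma dir_deriv_minus_direction:
  assumes "f differentiable at z" shows "dir_deriv (- v) f z = - dir_deriv v f z"
proof -
  interpret bounded_linear "\<lambda>h. dir_deriv h f z"
    using has_derivative_dir_deriv[OF assms] by (rule has_derivative_bounded_linear)
  show ?thesis by (rule neg)
qed

lemma dir_deriv_cmult:
  "f differentiable at v \<Longrightarrow> dir_deriv h (\<lambda>v. c * f v) v = c * dir_deriv h f v"
  by (subst dir_deriv_mult) auto

lemma dir_deriv_compose:
  assumes "bounded_linear A" "f differentiable at (A z)"
  shows "dir_deriv h (\<lambda>z. f (A z)) z = dir_deriv (A h) f (A z)"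
  by (rule dir_deriv_eq[OF has_derivative_compose[OF bounded_linear.has_derivative[OF assms(1) has_derivative_ident]
        has_derivative_dir_deriv[OF assms(2)]]])

lemma entire_several_const: "entire_several (\<lambda>_. c)"
  by (auto simp: entire_several_iff)

lemma entire_several_add: "entire_several f \<Longrightarrow> entire_several g \<Longrightarrow> entire_several (\<lambda>z. f z + g z)"
  by (auto simp: entire_several_iff dir_deriv_add distrib_left)

lemma entire_several_mult: "entire_several f \<Longrightarrow> entire_several g \<Longrightarrow> entire_several (\<lambda>z. f z * g z)"
  by (auto simp: entire_several_iff dir_deriv_mult algebra_simps)

lemma entire_several_sum: "(\<And>i. i \<in> A \<Longrightarrow> entire_several (f i)) \<Longrightarrow> entire_several (\<lambda>z. \<Sum>i\<in>A. f i z)"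
  by (induction A rule: infinite_finite_induct) (auto intro: entire_several_const entire_several_add)

definition clinear_form :: "(complex^'n \<Rightarrow> complex) \<Rightarrow> bool" where
  "clinear_form l \<longleftrightarrow> (\<forall>x y. l (x + y) = l x + l y) \<and> (\<forall>c x. l (c *s x) = c * l x)"

lemma clinear_form_add: "clinear_form l \<Longrightarrow> l (x + y) = l x + l y"
  and clinear_form_scale: "clinear_form l \<Longrightarrow> l (c *s x) = c * l x"
  by (auto simp: clinear_form_def)

lemma clinear_form_diff: "clinear_form l \<Longrightarrow> l (x - y) = l x - l y"
  using clinear_form_add[of l "x - y" y] by simp

lemma clinear_form_sum: "clinear_form l \<Longrightarrow> l (\<Sum>i\<in>A. f i) = (\<Sum>i\<in>A. l (f i))"
  using clinear_form_scale[of l 0 0]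
  by (induction A rule: infinite_finite_induct) (auto simp: clinear_form_add)

lemma clinear_form_bounded: "clinear_form l \<Longrightarrow> bounded_linear l"
  by (auto simp: linear_conv_bounded_linear[symmetric] linear_iff clinear_form_add clinear_form_scale scaleR_scaleC scaleR_conv_of_real)

lemma clinear_form_cdot: "clinear_form (\<lambda>z. cdot z w)"
  by (simp add: clinear_form_def cdot_linear)

lemma clinear_form_nth: "clinear_form (\<lambda>z. z $ i)"
  by (simp add: clinear_form_def)

lemma clinear_form_entire: "clinear_form l \<Longrightarrow> entire_several l"
  by (auto simp: entire_several_iff bounded_linear_differentiable clinear_form_bounded dir_deriv_linear clinear_form_scale)

lemma vector_expansion: "(\<Sum>i\<in>UNIV. z $ i *s axis i 1) = (z :: complex^'n)"
  by (simp add: basis_expansion)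

lemma clinear_form_expansion: "clinear_form l \<Longrightarrow> (\<Sum>i\<in>UNIV. z $ i * l (axis i 1)) = l z"
  using arg_cong[OF vector_expansion[of z], of l] by (simp add: clinear_form_sum clinear_form_scale)

lemma cdot_expand: "(\<Sum>i\<in>UNIV. z $ i * z $ i) = cdot z z"
  by (simp add: cdot_def)

text \<open>Homogeneous polynomials in \<open>z\<close>, generated by linear forms, so that identities for Dunkl operators
can be proved by induction from their commutation with multiplication by a linear form.\<close>

inductive homog_poly :: "nat \<Rightarrow> (complex^'n \<Rightarrow> complex) \<Rightarrow> bool" where
  homog_poly_const: "homog_poly 0 (\<lambda>_. c)"
| homog_poly_linear: "clinear_form l \<Longrightarrow> homog_poly n f \<Longrightarrow> homog_poly (Suc n) (\<lambda>z. l z * f z)"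
| homog_poly_add: "homog_poly n f \<Longrightarrow> homog_poly n g \<Longrightarrow> homog_poly n (\<lambda>z. f z + g z)"

lemma homog_poly_entire: "homog_poly n f \<Longrightarrow> entire_several f"
  by (induction rule: homog_poly.induct)
    (auto intro: entire_several_const entire_several_add entire_several_mult clinear_form_entire)

lemmas homog_poly_differentiable = entire_several_differentiable[OF homog_poly_entire]

lemma homog_poly_zero: "homog_poly n (\<lambda>_. 0)"
proof (induction n)
  case (Suc n)
  from homog_poly_linear[OF clinear_form_cdot[of 0] this] show ?case by simp
qed (rule homog_poly_const)

lemma homog_poly_cmult: "homog_poly n f \<Longrightarrow> homog_poly n (\<lambda>z. c * f z)"
proof (induction rule: homog_poly.induct)
  case (homog_poly_linear l n f)
  from homog_poly.homog_poly_linear[OF homog_poly_linear(1,3)] show ?case by (simp add: algebra_simps)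
qed (auto simp: distrib_left intro: homog_poly.intros)

lemma homog_poly_sum: "(\<And>i. i \<in> A \<Longrightarrow> homog_poly n (f i)) \<Longrightarrow> homog_poly n (\<lambda>z. \<Sum>i\<in>A. f i z)"
  by (induction A rule: infinite_finite_induct) (auto intro: homog_poly_zero homog_poly_add)

lemma homog_poly_compose:
  assumes "homog_poly n f" "\<And>x y. A (x + y) = A x + A y" "\<And>c x. A (c *s x) = c *s A x"
  shows "homog_poly n (\<lambda>z. f (A z))"
  using assms(1)
proof (induction rule: homog_poly.induct)
  case (homog_poly_linear l n f)
  have "clinear_form (\<lambda>z. l (A z))"
    using homog_poly_linear(1) by (simp add: clinear_form_def assms(2,3))
  from homog_poly.homog_poly_linear[OF this homog_poly_linear(3)] show ?case .
qed (auto intro: homog_poly.intros)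

lemma homog_poly_euler: "homog_poly n f \<Longrightarrow> dir_deriv z f z = of_nat n * f z"
proof (induction rule: homog_poly.induct)
  case (homog_poly_linear l n f)
  then show ?case
    using homog_poly_differentiable[OF homog_poly_linear(2)] clinear_form_bounded[OF homog_poly_linear(1)]
    by (simp add: dir_deriv_mult bounded_linear_differentiable dir_deriv_linear algebra_simps)
next
  case (homog_poly_add n f g)
  then show ?case
    by (simp add: dir_deriv_add homog_poly_differentiable[OF homog_poly_add(1)] homog_poly_differentiable[OF homog_poly_add(2)] distrib_left)
qed simp

lemma dir_deriv_linear_mult:
  assumes "clinear_form l" "f differentiable at z"
  shows "dir_deriv h (\<lambda>z. l z * f z) z = l z * dir_deriv h f z + l h * f z"
  using assms clinear_form_bounded[OF assms(1)]
  by (simp add: dir_deriv_mult bounded_linear_differentiable dir_deriv_linear)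

lemma homog_poly_0D: "homog_poly 0 f \<Longrightarrow> \<exists>c. f = (\<lambda>_. c)"
  by (induction "0::nat" f rule: homog_poly.induct) auto

lemma homog_poly_dir_deriv: "homog_poly n f \<Longrightarrow> homog_poly (n - 1) (dir_deriv h f)"
proof (induction rule: homog_poly.induct)
  case (homog_poly_const c)
  have "dir_deriv h (\<lambda>_. c) = (\<lambda>_. 0)" by auto
  then show ?case by (simp add: homog_poly_zero)
next
  case (homog_poly_linear l n f)
  have 1: "dir_deriv h (\<lambda>z. l z * f z) = (\<lambda>z. l z * dir_deriv h f z + l h * f z)"
    using dir_deriv_linear_mult[OF homog_poly_linear(1) homog_poly_differentiable[OF homog_poly_linear(2)]] by blast
  have "homog_poly n (\<lambda>z. l z * dir_deriv h f z)"
  proof (cases n)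
    case 0
    then have "\<exists>c. f = (\<lambda>_. c)" using homog_poly_linear(2) homog_poly_0D by blast
    then have "dir_deriv h f = (\<lambda>_. 0)" by auto
    then show ?thesis by (simp add: homog_poly_zero)
  next
    case (Suc m)
    then show ?thesis using homog_poly.homog_poly_linear[OF homog_poly_linear(1,3)] by simp
  qed
  from homog_poly.homog_poly_add[OF this homog_poly_cmult[OF homog_poly_linear(2)], of "l h"] show ?case unfolding 1 by simp
next
  case (homog_poly_add n f g)
  have "dir_deriv h (\<lambda>z. f z + g z) = (\<lambda>z. dir_deriv h f z + dir_deriv h g z)"
    using homog_poly_add(1,2)[THEN homog_poly_differentiable] by (auto simp: dir_deriv_add)
  then show ?case using homog_poly.homog_poly_add[OF homog_poly_add(3,4)] by simp
qed

text \<open>The difference quotient of a Dunkl operator with its continuous extension to the hyperplane.\<close>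

definition root_quotient :: "real^'n \<Rightarrow> (complex^'n \<Rightarrow> complex) \<Rightarrow> complex^'n \<Rightarrow> complex" where
  "root_quotient \<alpha> f z =
     (if cdot (cvec \<alpha>) z \<noteq> 0 then (f z - f (crefl_along \<alpha> z)) / cdot (cvec \<alpha>) z
      else 2 / cdot (cvec \<alpha>) (cvec \<alpha>) * dir_deriv (cvec \<alpha>) f z)"

lemma root_quotient_times: "cdot (cvec \<alpha>) z * root_quotient \<alpha> f z = f z - f (crefl_along \<alpha> z)"
  by (simp add: root_quotient_def crefl_along_fixed)

lemma root_quotient_const [simp]: "root_quotient \<alpha> (\<lambda>_. c) z = 0"
  by (auto simp: root_quotient_def)

lemma root_quotient_linear_mult:
  assumes l: "clinear_form l" and f: "f differentiable at z"
  shows "root_quotient \<alpha> (\<lambda>z. l z * f z) z =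
     l z * root_quotient \<alpha> f z + 2 / cdot (cvec \<alpha>) (cvec \<alpha>) * l (cvec \<alpha>) * f (crefl_along \<alpha> z)"
proof (cases "cdot (cvec \<alpha>) z = 0")
  case True
  then show ?thesis
    by (simp add: root_quotient_def dir_deriv_linear_mult[OF l f] crefl_along_fixed)
      (simp add: algebra_simps add_divide_distrib)
next
  case False
  define d where "d = 2 / cdot (cvec \<alpha>) (cvec \<alpha>) * l (cvec \<alpha>)"
  have lz: "l z = l (crefl_along \<alpha> z) + cdot (cvec \<alpha>) z * d"
    by (simp add: crefl_along_def clinear_form_diff[OF l] clinear_form_scale[OF l] d_def)
  with False show ?thesis
    unfolding d_def[symmetric] root_quotient_def by (simp add: lz divide_simps) (simp add: algebra_simps)
qed

lemma root_quotient_add: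
  assumes "f differentiable at z" "g differentiable at z"
  shows "root_quotient \<alpha> (\<lambda>z. f z + g z) z = root_quotient \<alpha> f z + root_quotient \<alpha> g z"
  using assms by (auto simp: root_quotient_def dir_deriv_add add_divide_distrib diff_divide_distrib distrib_left)

lemma root_quotient_cmult:
  assumes "f differentiable at z"
  shows "root_quotient \<alpha> (\<lambda>z. c * f z) z = c * root_quotient \<alpha> f z"
  using assms by (auto simp: root_quotient_def dir_deriv_cmult field_simps)

lemma crefl_along_minus: "crefl_along (- \<alpha>) = crefl_along \<alpha>"
  by (auto simp: crefl_along_def cvec_minus cdot_minus_left cdot_minus_right)

lemma root_quotient_minus:
  assumes "f differentiable at z"
  shows "root_quotient (- \<alpha>) f z = - root_quotient \<alpha> f z"
  using assms
  by (auto simp: root_quotient_def cvec_minus cdot_minus_left cdot_minus_right dir_deriv_minus_direction crefl_along_minus)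

lemma root_quotient_refl:
  assumes "\<alpha> \<noteq> 0" and f: "entire_several f"
  shows "root_quotient \<beta> (\<lambda>z. f (crefl_along \<alpha> z)) z = root_quotient (refl_along \<alpha> \<beta>) f (crefl_along \<alpha> z)"
  unfolding root_quotient_def
  by (simp add: dir_deriv_compose[OF bounded_linear_crefl_along[OF assms(1)] entire_several_differentiable[OF f]]
      crefl_along_cdot[OF assms(1)] crefl_along_conj[OF assms(1), of \<beta>] flip: crefl_along_cvec)

context dunkl_setup
begin

text \<open>The Dunkl operator in a form that involves no limits.\<close>

definition T :: "complex^'n \<Rightarrow> (complex^'n \<Rightarrow> complex) \<Rightarrow> complex^'n \<Rightarrow> complex" where
  "T \<xi> f z = dir_deriv \<xi> f z + (\<Sum>\<alpha>\<in>Rp. complex_of_real (k \<alpha>) * cdot (cvec \<alpha>) \<xi> * root_quotient \<alpha> f z)"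

lemma T_const [simp]: "T \<xi> (\<lambda>_. c) z = 0"
  by (simp add: T_def)

lemma T_add:
  assumes "entire_several f" "entire_several g"
  shows "T \<xi> (\<lambda>z. f z + g z) z = T \<xi> f z + T \<xi> g z"
  using assms[THEN entire_several_differentiable]
  by (simp add: T_def dir_deriv_add root_quotient_add distrib_left sum.distrib)

lemma T_cmult:
  assumes "entire_several f" shows "T \<xi> (\<lambda>z. c * f z) z = c * T \<xi> f z"
  using assms[THEN entire_several_differentiable]
  by (simp add: T_def dir_deriv_cmult root_quotient_cmult distrib_left sum_distrib_left algebra_simps)

lemma T_sum:
  assumes "\<And>i. i \<in> A \<Longrightarrow> entire_several (f i)"
  shows "T \<xi> (\<lambda>z. \<Sum>i\<in>A. f i z) z = (\<Sum>i\<in>A. T \<xi> (f i) z)"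
  using assms
  by (induction A rule: infinite_finite_induct) (auto simp: T_add entire_several_sum)

lemma T_add_direction:
  assumes "entire_several f" shows "T (\<xi> + \<eta>) f z = T \<xi> f z + T \<eta> f z"
  using assms[THEN entire_several_differentiable]
  by (simp add: T_def dir_deriv_add_direction cdot_linear distrib_left distrib_right sum.distrib)

lemma T_scale_direction:
  assumes "entire_several f" shows "T (c *s \<xi>) f z = c * T \<xi> f z"
  using assms by (simp add: T_def dir_deriv_scale cdot_linear distrib_left sum_distrib_left mult_ac)

lemma T_expand:
  assumes "entire_several f" shows "(\<Sum>i\<in>UNIV. \<xi> $ i * T (axis i 1) f z) = T \<xi> f z"
  using assms
  by (intro clinear_form_expansion[of "\<lambda>\<xi>. T \<xi> f z"]) (simp add: clinear_form_def T_add_direction T_scale_direction)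

lemma T_refl_direction:
  assumes "entire_several f"
  shows "T (crefl_along \<alpha> \<xi>) f z = T \<xi> f z - 2 * cdot (cvec \<alpha>) \<xi> / cdot (cvec \<alpha>) (cvec \<alpha>) * T (cvec \<alpha>) f z"
proof -
  have "crefl_along \<alpha> \<xi> = \<xi> + (- (2 * cdot (cvec \<alpha>) \<xi> / cdot (cvec \<alpha>) (cvec \<alpha>))) *s cvec \<alpha>"
    by (simp add: crefl_along_def)
  then show ?thesis using assms by (simp only: T_add_direction T_scale_direction) simp
qed

text \<open>In the direction \<open>\<xi> = z\<close> the denominators cancel.\<close>

lemma T_radial: "T z f z = dir_deriv z f z + (\<Sum>\<alpha>\<in>Rp. complex_of_real (k \<alpha>) * (f z - f (crefl_along \<alpha> z)))"
  unfolding T_def by (simp add: mult.assoc root_quotient_times)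

definition refl_coeff :: "(complex^'n \<Rightarrow> complex) \<Rightarrow> real^'n \<Rightarrow> complex" where
  "refl_coeff l \<alpha> = complex_of_real (k \<alpha>) * (2 / cdot (cvec \<alpha>) (cvec \<alpha>)) * l (cvec \<alpha>)"

text \<open>The commutator of a Dunkl operator with multiplication by a linear form involves only reflections.\<close>

lemma T_linear_mult:
  assumes l: "clinear_form l" and f: "entire_several f"
  shows "T \<xi> (\<lambda>z. l z * f z) z = l z * T \<xi> f z + l \<xi> * f z
    + (\<Sum>\<alpha>\<in>Rp. refl_coeff l \<alpha> * cdot (cvec \<alpha>) \<xi> * f (crefl_along \<alpha> z))"
  unfolding T_def dir_deriv_linear_mult[OF l entire_several_differentiable[OF f]]
    root_quotient_linear_mult[OF l entire_several_differentiable[OF f]]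
  by (simp add: refl_coeff_def algebra_simps sum.distrib sum_distrib_left)

text \<open>The reflection permutes the roots up to sign, and the summand of a root is even.\<close>

lemma T_equivariant:
  assumes \<alpha>: "\<alpha> \<in> R" and f: "entire_several f"
  shows "T \<xi> (\<lambda>z. f (crefl_along \<alpha> z)) z = T (crefl_along \<alpha> \<xi>) f (crefl_along \<alpha> z)"
proof -
  note n = R_nonzero[OF \<alpha>]
  define h where "h = (\<lambda>\<beta>. complex_of_real (k \<beta>) * cdot (cvec \<beta>) (crefl_along \<alpha> \<xi>) * root_quotient \<beta> f (crefl_along \<alpha> z))"
  have "(\<Sum>\<beta>\<in>Rp. complex_of_real (k \<beta>) * cdot (cvec \<beta>) \<xi> * root_quotient \<beta> (\<lambda>z. f (crefl_along \<alpha> z)) z)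
      = (\<Sum>\<beta>\<in>Rp. h (refl_along \<alpha> \<beta>))"
    by (intro sum.cong refl)
      (simp add: h_def root_quotient_refl[OF n f] k_refl[OF \<alpha>] Rp_R crefl_along_cdot[OF n] flip: crefl_along_cvec)
  also have "\<dots> = sum h Rp"
    by (rule sum_refl[OF \<alpha>])
      (simp add: h_def k_minus cvec_minus cdot_minus_left root_quotient_minus[OF entire_several_differentiable[OF f]])
  finally show ?thesis
    unfolding T_def h_def
    by (simp add: dir_deriv_compose[OF bounded_linear_crefl_along[OF n] entire_several_differentiable[OF f]])
qed

lemma homog_poly_refl: "homog_poly n f \<Longrightarrow> homog_poly n (\<lambda>z. f (crefl_along \<alpha> z))"
  by (rule homog_poly_compose) (auto simp: crefl_along_add crefl_along_scale)

lemma homog_poly_T: "homog_poly n f \<Longrightarrow> homog_poly (n - 1) (T \<xi> f)"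
proof (induction rule: homog_poly.induct)
  case (homog_poly_const c)
  have "T \<xi> (\<lambda>_. c) = (\<lambda>_. 0)" by auto
  then show ?case by (simp add: homog_poly_zero)
next
  case (homog_poly_linear l n f)
  have 1: "T \<xi> (\<lambda>z. l z * f z) = (\<lambda>z. l z * T \<xi> f z + l \<xi> * f z
    + (\<Sum>\<alpha>\<in>Rp. refl_coeff l \<alpha> * cdot (cvec \<alpha>) \<xi> * f (crefl_along \<alpha> z)))"
    using T_linear_mult[OF homog_poly_linear(1) homog_poly_entire[OF homog_poly_linear(2)]] by blast
  have "homog_poly n (\<lambda>z. l z * T \<xi> f z)"
  proof (cases n)
    case 0
    then obtain c where "f = (\<lambda>_. c)" using homog_poly_linear(2) homog_poly_0D by blast
    then have "T \<xi> f = (\<lambda>_. 0)" by auto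
    then show ?thesis by (simp add: homog_poly_zero)
  next
    case (Suc m)
    then show ?thesis using homog_poly.homog_poly_linear[OF homog_poly_linear(1,3)] by simp
  qed
  then show ?case unfolding 1
    by (auto intro!: homog_poly.homog_poly_add homog_poly_sum homog_poly_cmult homog_poly_refl homog_poly_linear(2))
next
  case (homog_poly_add n f g)
  have "T \<xi> (\<lambda>z. f z + g z) = (\<lambda>z. T \<xi> f z + T \<xi> g z)"
    using homog_poly_add(1,2)[THEN homog_poly_entire] by (auto simp: T_add)
  then show ?case using homog_poly.homog_poly_add[OF homog_poly_add(3,4)] by simp
qed

text \<open>Apart from the first summand the right-hand side is symmetric in \<open>\<xi>\<close> and \<open>\<eta>\<close>.\<close>

lemma T_T_linear_mult:
  assumes l: "clinear_form l" and f: "homog_poly n f"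
  shows "T \<xi> (T \<eta> (\<lambda>z. l z * f z)) z = l z * T \<xi> (T \<eta> f) z + l \<xi> * T \<eta> f z + l \<eta> * T \<xi> f z
    + (\<Sum>\<alpha>\<in>Rp. refl_coeff l \<alpha> * (cdot (cvec \<alpha>) \<xi> * T \<eta> f (crefl_along \<alpha> z)
        + cdot (cvec \<alpha>) \<eta> * T \<xi> f (crefl_along \<alpha> z)
        - 2 * cdot (cvec \<alpha>) \<xi> * cdot (cvec \<alpha>) \<eta> / cdot (cvec \<alpha>) (cvec \<alpha>) * T (cvec \<alpha>) f (crefl_along \<alpha> z)))"
proof -
  note fe = homog_poly_entire[OF f] and Te = homog_poly_entire[OF homog_poly_T[OF f]]
    and fr = homog_poly_entire[OF homog_poly_refl[OF f]]
  have 1: "T \<eta> (\<lambda>z. l z * f z) = (\<lambda>z. l z * T \<eta> f z + l \<eta> * f z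
    + (\<Sum>\<alpha>\<in>Rp. refl_coeff l \<alpha> * cdot (cvec \<alpha>) \<eta> * f (crefl_along \<alpha> z)))"
    using T_linear_mult[OF l fe] by blast
  have "T \<xi> (T \<eta> (\<lambda>z. l z * f z)) z =
     T \<xi> (\<lambda>z. l z * T \<eta> f z) z + l \<eta> * T \<xi> f z
      + (\<Sum>\<alpha>\<in>Rp. refl_coeff l \<alpha> * cdot (cvec \<alpha>) \<eta> * T \<xi> (\<lambda>z. f (crefl_along \<alpha> z)) z)"
    unfolding 1 using Te fe fr
    by (simp add: T_add T_sum T_cmult entire_several_add entire_several_mult entire_several_sum entire_several_const
        clinear_form_entire[OF l])
  also have "T \<xi> (\<lambda>z. l z * T \<eta> f z) z = l z * T \<xi> (T \<eta> f) z + l \<xi> * T \<eta> f z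
      + (\<Sum>\<alpha>\<in>Rp. refl_coeff l \<alpha> * cdot (cvec \<alpha>) \<xi> * T \<eta> f (crefl_along \<alpha> z))"
    by (rule T_linear_mult[OF l Te])
  also have "(\<Sum>\<alpha>\<in>Rp. refl_coeff l \<alpha> * cdot (cvec \<alpha>) \<eta> * T \<xi> (\<lambda>z. f (crefl_along \<alpha> z)) z)
     = (\<Sum>\<alpha>\<in>Rp. refl_coeff l \<alpha> * cdot (cvec \<alpha>) \<eta> * (T \<xi> f (crefl_along \<alpha> z)
         - 2 * cdot (cvec \<alpha>) \<xi> / cdot (cvec \<alpha>) (cvec \<alpha>) * T (cvec \<alpha>) f (crefl_along \<alpha> z)))"
    by (intro sum.cong refl) (simp add: T_equivariant[OF Rp_R fe] T_refl_direction[OF fe])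
  finally show ?thesis by (simp add: algebra_simps sum.distrib sum_subtractf)
qed

text \<open>Induction along linear factors: by the symmetry just noted, the commutator of two Dunkl operators
commutes with multiplication by linear forms, and it annihilates the constants.\<close>

lemma T_commute: "homog_poly n f \<Longrightarrow> T \<xi> (T \<eta> f) z = T \<eta> (T \<xi> f) z"
proof (induction arbitrary: z rule: homog_poly.induct)
  case (homog_poly_const c)
  have "T \<xi> (\<lambda>_. c) = (\<lambda>_. 0)" for \<xi> by auto
  then show ?case by simp
next
  case (homog_poly_linear l n f)
  show ?case
    unfolding T_T_linear_mult[OF homog_poly_linear(1,2)] homog_poly_linear.IH
    by (simp add: algebra_simps)
next
  case (homog_poly_add n f g)
  have "T \<xi> (\<lambda>z. f z + g z) = (\<lambda>z. T \<xi> f z + T \<xi> g z)" for \<xi>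
    using homog_poly_add(1,2)[THEN homog_poly_entire] by (auto simp: T_add)
  then show ?case
    using homog_poly_add(1,2)[THEN homog_poly_T, THEN homog_poly_entire] homog_poly_add.IH by (simp add: T_add)
qed

lemma homog_poly_kernel_poly: "homog_poly n (\<lambda>z. kernel_poly n z w)"
proof (induction n)
  case (Suc n)
  have "homog_poly (Suc n) (\<lambda>z. complex_of_real (resolvent (real (Suc n)) u) * (cdot (u z) w * kernel_poly n (u z) w))"
    if u: "u \<in> W" for u
  proof (intro homog_poly_cmult homog_poly_linear homog_poly_compose[OF Suc])
    show "clinear_form (\<lambda>z. cdot (u z) w)" by (simp add: clinear_form_def W_add[OF u] W_scale[OF u] cdot_linear)
  qed (simp_all add: W_add[OF u] W_scale[OF u])
  then show ?case by (simp only: kernel_poly.simps) (intro homog_poly_sum)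
qed (simp add: homog_poly_const)

text \<open>The equation bounds \<open>v\<close> on reflection-invariant sets by \<open>\<gamma> / (\<nu> + \<gamma>) < 1\<close> times its own bound.\<close>

lemma contraction_zero:
  fixes v :: "complex^'n \<Rightarrow> complex^'n \<Rightarrow> complex"
  assumes \<nu>: "\<nu> > 0"
    and eq: "\<And>\<xi> z. complex_of_real (\<nu> + \<gamma>) * v \<xi> z = (\<Sum>\<alpha>\<in>Rp. complex_of_real (k \<alpha>) * v (crefl_along \<alpha> \<xi>) (crefl_along \<alpha> z))"
    and bound: "\<And>r. \<exists>B. \<forall>\<xi> z. norm \<xi> \<le> r \<longrightarrow> norm z \<le> r \<longrightarrow> norm (v \<xi> z) \<le> B"
  shows "v \<xi> z = 0"
proof -
  define r where "r = max (norm \<xi>) (norm z)"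
  obtain B where B: "\<And>\<xi> z. norm \<xi> \<le> r \<Longrightarrow> norm z \<le> r \<Longrightarrow> norm (v \<xi> z) \<le> B" using bound by blast
  define q where "q = \<gamma> / (\<nu> + \<gamma>)"
  have p: "\<nu> + \<gamma> > 0" using \<nu> \<gamma>_nonneg by linarith
  have it: "norm (v \<xi> z) \<le> B * q ^ m" if "norm \<xi> \<le> r" "norm z \<le> r" for \<xi> z m
    using that
  proof (induction m arbitrary: \<xi> z)
    case (Suc m)
    have "(\<nu> + \<gamma>) * norm (v \<xi> z) = norm (\<Sum>\<alpha>\<in>Rp. complex_of_real (k \<alpha>) * v (crefl_along \<alpha> \<xi>) (crefl_along \<alpha> z))"
      using p arg_cong[OF eq[of \<xi> z], of norm] by (simp only: norm_mult norm_of_real)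
    also have "\<dots> \<le> (\<Sum>\<alpha>\<in>Rp. k \<alpha> * (B * q ^ m))"
      using Suc by (intro norm_sum[THEN order_trans] sum_mono)
        (auto simp: norm_mult k_nonneg' norm_crefl_along Rp_nonzero intro!: mult_left_mono)
    also have "\<dots> = \<gamma> * (B * q ^ m)" by (simp flip: sum_distrib_right)
    finally have "norm (v \<xi> z) \<le> \<gamma> * (B * q ^ m) / (\<nu> + \<gamma>)"
      using p by (simp add: pos_le_divide_eq mult.commute)
    then show ?case by (simp add: q_def mult_ac)
  qed (simp add: B)
  have "\<bar>q\<bar> < 1" using p \<nu> \<gamma>_nonneg by (simp add: q_def field_simps)
  then have "(\<lambda>m. B * q ^ m) \<longlonglongrightarrow> B * 0" by (intro tendsto_intros LIMSEQ_power_zero) simp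
  then have "norm (v \<xi> z) \<le> B * 0"
    by (rule LIMSEQ_le_const) (use it in \<open>auto simp: r_def\<close>)
  then show ?thesis by simp
qed

text \<open>Applying \<open>T \<xi>\<close> to the radial equation and commuting it to the right shows that the defect
\<open>v \<xi> z\<close> between the two sides satisfies a homogeneous equation of the kind treated in
\<open>contraction_zero\<close>. The term \<open>\<sigma>\<^sub>\<alpha> T\<^sub>\<alpha>\<close> produced by the commutator combines with \<open>T \<xi>\<close> to a Dunkl operator
in the reflected direction.\<close>

lemma T_kernel_poly:
  "T \<xi> (\<lambda>z. kernel_poly n z w) z = (if n = 0 then 0 else cdot \<xi> w * kernel_poly (n - 1) z w)"
proof (induction n arbitrary: \<xi> z)
  case (Suc n)
  define f where "f = (\<lambda>z. kernel_poly (Suc n) z w)"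
  define g where "g = (\<lambda>z. kernel_poly n z w)"
  define h where "h = (\<lambda>z. if n = 0 then 0 else kernel_poly (n - 1) z w)"
  have f: "homog_poly (Suc n) f" and g: "homog_poly n g" unfolding f_def g_def by (rule homog_poly_kernel_poly)+
  note fe = homog_poly_entire[OF f] and ge = homog_poly_entire[OF g]
  have Tf: "homog_poly n (T \<xi> f)" for \<xi> using homog_poly_T[OF f] by simp
  note Tfe = homog_poly_entire[OF Tf]
  have Tg: "T \<xi> g z = cdot \<xi> w * h z" for \<xi> z using Suc unfolding g_def h_def by simp
  define v where "v = (\<lambda>\<xi> z. T \<xi> f z - cdot \<xi> w * g z)"
  have rad: "T z f z = cdot z w * g z" for z
    using kernel_poly_radial[of n z w]
    unfolding T_radial homog_poly_euler[OF f] by (simp add: f_def g_def right_diff_distrib sum_subtractf sum_distrib_right distrib_right add_diff_eq)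
  define c where "c = (\<lambda>(\<alpha>::real^'n) (\<xi>::complex^'n). 2 * cdot (cvec \<alpha>) \<xi> / cdot (cvec \<alpha>) (cvec \<alpha>))"
  have eq: "complex_of_real (real (Suc n) + \<gamma>) * v \<xi> z = (\<Sum>\<alpha>\<in>Rp. complex_of_real (k \<alpha>) * v (crefl_along \<alpha> \<xi>) (crefl_along \<alpha> z))" for \<xi> z
  proof -
    have "(\<lambda>z. \<Sum>i\<in>UNIV. z $ i * T (axis i 1) f z) = (\<lambda>z. cdot z w * g z)"
      using T_expand[OF fe] rad by simp
    then have m1: "T \<xi> (\<lambda>z. \<Sum>i\<in>UNIV. z $ i * T (axis i 1) f z) z = T \<xi> (\<lambda>z. cdot z w * g z) z" by simp
    have "T \<xi> (\<lambda>z. \<Sum>i\<in>UNIV. z $ i * T (axis i 1) f z) z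
       = (\<Sum>i\<in>UNIV. z $ i * T (axis i 1) (T \<xi> f) z + \<xi> $ i * T (axis i 1) f z
           + (\<Sum>\<alpha>\<in>Rp. refl_coeff (\<lambda>z. z $ i) \<alpha> * cdot (cvec \<alpha>) \<xi> * T (axis i 1) f (crefl_along \<alpha> z)))"
      by (subst T_sum)
        (auto simp: T_linear_mult[OF clinear_form_nth Tfe] T_commute[OF f, of \<xi>]
          intro!: entire_several_mult[OF clinear_form_entire[OF clinear_form_nth] Tfe])
    also have "\<dots> = T z (T \<xi> f) z + T \<xi> f z
        + (\<Sum>\<alpha>\<in>Rp. complex_of_real (k \<alpha>) * c \<alpha> \<xi> * T (cvec \<alpha>) f (crefl_along \<alpha> z))"
    proof -
      have "(\<Sum>i\<in>UNIV. \<Sum>\<alpha>\<in>Rp. refl_coeff (\<lambda>z. z $ i) \<alpha> * cdot (cvec \<alpha>) \<xi> * T (axis i 1) f (crefl_along \<alpha> z))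
         = (\<Sum>\<alpha>\<in>Rp. \<Sum>i\<in>UNIV. complex_of_real (k \<alpha>) * c \<alpha> \<xi> * (cvec \<alpha> $ i * T (axis i 1) f (crefl_along \<alpha> z)))"
        by (subst sum.swap) (simp add: refl_coeff_def c_def mult_ac)
      also have "\<dots> = (\<Sum>\<alpha>\<in>Rp. complex_of_real (k \<alpha>) * c \<alpha> \<xi> * T (cvec \<alpha>) f (crefl_along \<alpha> z))"
        unfolding sum_distrib_left[symmetric] T_expand[OF fe] ..
      finally show ?thesis by (simp add: sum.distrib T_expand[OF fe] T_expand[OF Tfe])
    qed
    finally have m2: "T \<xi> (\<lambda>z. \<Sum>i\<in>UNIV. z $ i * T (axis i 1) f z) z = T z (T \<xi> f) z + T \<xi> f z
        + (\<Sum>\<alpha>\<in>Rp. complex_of_real (k \<alpha>) * c \<alpha> \<xi> * T (cvec \<alpha>) f (crefl_along \<alpha> z))" .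
    have m3: "T z (T \<xi> f) z = of_nat n * T \<xi> f z + complex_of_real \<gamma> * T \<xi> f z
        - (\<Sum>\<alpha>\<in>Rp. complex_of_real (k \<alpha>) * T \<xi> f (crefl_along \<alpha> z))"
      unfolding T_radial[of z "T \<xi> f"] homog_poly_euler[OF Tf] by (simp add: right_diff_distrib sum_subtractf sum_distrib_right)
    have m4: "T \<xi> (\<lambda>z. cdot z w * g z) z = cdot z w * T \<xi> g z + cdot \<xi> w * g z
        + (\<Sum>\<alpha>\<in>Rp. complex_of_real (k \<alpha>) * c \<alpha> \<xi> * (cdot (cvec \<alpha>) w * g (crefl_along \<alpha> z)))"
      unfolding T_linear_mult[OF clinear_form_cdot ge] by (simp add: refl_coeff_def c_def mult_ac)
    have m5: "cdot z w * T \<xi> g z = cdot \<xi> w * T z g z" by (simp add: Tg)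
    have m6: "T z g z = of_nat n * g z + complex_of_real \<gamma> * g z
        - (\<Sum>\<alpha>\<in>Rp. complex_of_real (k \<alpha>) * g (crefl_along \<alpha> z))"
      unfolding T_radial[of z g] homog_poly_euler[OF g] by (simp add: right_diff_distrib sum_subtractf sum_distrib_right)
    have vr: "v (crefl_along \<alpha> \<xi>) (crefl_along \<alpha> z) = T \<xi> f (crefl_along \<alpha> z) - c \<alpha> \<xi> * T (cvec \<alpha>) f (crefl_along \<alpha> z)
        - cdot \<xi> w * g (crefl_along \<alpha> z) + c \<alpha> \<xi> * (cdot (cvec \<alpha>) w * g (crefl_along \<alpha> z))" for \<alpha>
      unfolding v_def T_refl_direction[OF fe] by (simp add: crefl_along_def[of \<alpha> \<xi>] cdot_linear c_def algebra_simps)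
    have m7: "(\<Sum>\<alpha>\<in>Rp. complex_of_real (k \<alpha>) * v (crefl_along \<alpha> \<xi>) (crefl_along \<alpha> z))
       = (\<Sum>\<alpha>\<in>Rp. complex_of_real (k \<alpha>) * T \<xi> f (crefl_along \<alpha> z))
        - (\<Sum>\<alpha>\<in>Rp. complex_of_real (k \<alpha>) * c \<alpha> \<xi> * T (cvec \<alpha>) f (crefl_along \<alpha> z))
        - cdot \<xi> w * (\<Sum>\<alpha>\<in>Rp. complex_of_real (k \<alpha>) * g (crefl_along \<alpha> z))
        + (\<Sum>\<alpha>\<in>Rp. complex_of_real (k \<alpha>) * c \<alpha> \<xi> * (cdot (cvec \<alpha>) w * g (crefl_along \<alpha> z)))"
      unfolding vr by (simp add: algebra_simps sum.distrib sum_subtractf sum_distrib_left)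
    have "of_nat n * T \<xi> f z + complex_of_real \<gamma> * T \<xi> f z
        - (\<Sum>\<alpha>\<in>Rp. complex_of_real (k \<alpha>) * T \<xi> f (crefl_along \<alpha> z)) + T \<xi> f z
        + (\<Sum>\<alpha>\<in>Rp. complex_of_real (k \<alpha>) * c \<alpha> \<xi> * T (cvec \<alpha>) f (crefl_along \<alpha> z))
      = cdot \<xi> w * (of_nat n * g z + complex_of_real \<gamma> * g z
        - (\<Sum>\<alpha>\<in>Rp. complex_of_real (k \<alpha>) * g (crefl_along \<alpha> z))) + cdot \<xi> w * g z
        + (\<Sum>\<alpha>\<in>Rp. complex_of_real (k \<alpha>) * c \<alpha> \<xi> * (cdot (cvec \<alpha>) w * g (crefl_along \<alpha> z)))"
      using m1 unfolding m2 m3 m4 m5 m6 .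
    moreover have "complex_of_real (real (Suc n) + \<gamma>) = of_nat n + 1 + complex_of_real \<gamma>" by simp
    ultimately show ?thesis
      unfolding m7 unfolding v_def by algebra
  qed
  have "\<exists>B. \<forall>\<xi> z. norm \<xi> \<le> r \<longrightarrow> norm z \<le> r \<longrightarrow> norm (v \<xi> z) \<le> B" for r
  proof -
    have c: "continuous_on (cball 0 r) (\<lambda>z. v (axis i 1) z)" for i
      unfolding v_def using homog_poly_differentiable[OF Tf] homog_poly_differentiable[OF g]
      by (intro continuous_intros differentiable_imp_continuous_on) (auto simp: differentiable_on_def intro: differentiable_at_withinI)
    have "\<exists>B. \<forall>z\<in>cball 0 r. norm (v (axis i 1) z) \<le> B" for i
      using compact_imp_bounded[OF compact_continuous_image[OF c[of i] compact_cball]]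
      unfolding bounded_iff by auto
    then obtain B where B: "\<And>i z. norm z \<le> r \<Longrightarrow> norm (v (axis i 1) z) \<le> B i"
      by (metis mem_cball_0)
    have "norm (v \<xi> z) \<le> (\<Sum>i\<in>UNIV. r * B i)" if "norm \<xi> \<le> r" "norm z \<le> r" for \<xi> z
    proof -
      have "v \<xi> z = (\<Sum>i\<in>UNIV. \<xi> $ i * v (axis i 1) z)"
        unfolding v_def using T_expand[OF fe, of \<xi> z] clinear_form_expansion[OF clinear_form_cdot, of \<xi> w]
        by (simp add: right_diff_distrib sum_subtractf flip: mult.assoc sum_distrib_right)
      also have "norm \<dots> \<le> (\<Sum>i\<in>UNIV. r * B i)"
        using that B
        by (intro norm_sum[THEN order_trans] sum_mono)
          (auto simp: norm_mult intro!: mult_mono order_trans[OF Finite_Cartesian_Product.norm_nth_le] intro: order_trans[OF norm_ge_zero])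
      finally show ?thesis .
    qed
    then show ?thesis by blast
  qed
  from contraction_zero[of "real (Suc n)" v, OF _ eq this] show ?case
    by (simp add: v_def f_def g_def)
qed simp

end

context dunkl_setup
begin

section \<open>The Dunkl Laplacian\<close>

definition explicit_dunkl_laplacian :: "(complex^'n \<Rightarrow> complex) \<Rightarrow> complex^'n \<Rightarrow> complex" where
  "explicit_dunkl_laplacian f z =
     (\<Sum>i\<in>UNIV. dir_deriv (axis i 1) (dir_deriv (axis i 1) f) z)
     + 2 * (\<Sum>\<alpha>\<in>Rp. complex_of_real (k \<alpha>) * (dir_deriv (cvec \<alpha>) f z / cdot (cvec \<alpha>) z
         - cdot (cvec \<alpha>) (cvec \<alpha>) / 2 * ((f z - f (crefl_along \<alpha> z)) / (cdot (cvec \<alpha>) z)\<^sup>2)))"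

text \<open>The reflection terms cancel because \<open>T\<^sub>\<alpha>\<close> anticommutes with \<open>\<sigma>\<^sub>\<alpha>\<close>.\<close>

lemma laplacian_T_linear_mult:
  assumes l: "clinear_form l" and f: "homog_poly n f"
  shows "(\<Sum>i\<in>UNIV. T (axis i 1) (T (axis i 1) (\<lambda>z. l z * f z)) z)
    = l z * (\<Sum>i\<in>UNIV. T (axis i 1) (T (axis i 1) f) z) + 2 * (\<Sum>i\<in>UNIV. l (axis i 1) * T (axis i 1) f z)"
proof -
  note fe = homog_poly_entire[OF f]
  have "(\<Sum>i\<in>UNIV. cdot (cvec \<alpha>) (axis i 1) * T (axis i 1) f (crefl_along \<alpha> z)
        + cdot (cvec \<alpha>) (axis i 1) * T (axis i 1) f (crefl_along \<alpha> z)
        - 2 * cdot (cvec \<alpha>) (axis i 1) * cdot (cvec \<alpha>) (axis i 1) / cdot (cvec \<alpha>) (cvec \<alpha>) * T (cvec \<alpha>) f (crefl_along \<alpha> z)) = 0"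
    (is "?S = 0") if "\<alpha> \<in> Rp" for \<alpha>
  proof -
    have "?S = 2 * (\<Sum>i\<in>UNIV. cvec \<alpha> $ i * T (axis i 1) f (crefl_along \<alpha> z))
       - 2 * (\<Sum>i\<in>UNIV. cvec \<alpha> $ i * cvec \<alpha> $ i) / cdot (cvec \<alpha>) (cvec \<alpha>) * T (cvec \<alpha>) f (crefl_along \<alpha> z)"
      by (simp add: cdot_axis sum_subtractf sum_distrib_left sum_distrib_right sum_divide_distrib algebra_simps)
    also have "\<dots> = 0"
      unfolding T_expand[OF fe] cdot_expand using cdot_cvec_self_nonzero[OF Rp_nonzero[OF that]] by simp
    finally show ?thesis .
  qed
  then have "(\<Sum>i\<in>UNIV. \<Sum>\<alpha>\<in>Rp. refl_coeff l \<alpha> * (cdot (cvec \<alpha>) (axis i 1) * T (axis i 1) f (crefl_along \<alpha> z)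
        + cdot (cvec \<alpha>) (axis i 1) * T (axis i 1) f (crefl_along \<alpha> z)
        - 2 * cdot (cvec \<alpha>) (axis i 1) * cdot (cvec \<alpha>) (axis i 1) / cdot (cvec \<alpha>) (cvec \<alpha>) * T (cvec \<alpha>) f (crefl_along \<alpha> z))) = 0"
    by (subst sum.swap) (simp only: sum_distrib_left[symmetric] mult_zero_right sum.neutral_const cong: sum.cong)
  then show ?thesis
    unfolding T_T_linear_mult[OF l f] by (simp add: sum.distrib sum_distrib_left)
qed

text \<open>The explicit operator has the same commutator with a linear form as the sum of squares of Dunkl
operators; since both annihilate constants, they agree on polynomials at regular points.\<close>

lemma explicit_dunkl_laplacian_linear_mult:
  assumes l: "clinear_form l" and f: "homog_poly n f" and z: "\<And>\<alpha>. \<alpha> \<in> Rp \<Longrightarrow> cdot (cvec \<alpha>) z \<noteq> 0"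
  shows "explicit_dunkl_laplacian (\<lambda>z. l z * f z) z
    = l z * explicit_dunkl_laplacian f z + 2 * (\<Sum>i\<in>UNIV. l (axis i 1) * T (axis i 1) f z)"
proof -
  note fd = homog_poly_differentiable[OF f] and f'd = homog_poly_differentiable[OF homog_poly_dir_deriv[OF f]]
  have d1: "dir_deriv h (\<lambda>z. l z * f z) = (\<lambda>z. l z * dir_deriv h f z + l h * f z)" for h
    using dir_deriv_linear_mult[OF l fd] by blast
  have d2: "dir_deriv h (dir_deriv h (\<lambda>z. l z * f z)) z = l z * dir_deriv h (dir_deriv h f) z + 2 * (l h * dir_deriv h f z)" for h
    unfolding d1
      dir_deriv_add[OF entire_several_differentiable[OF entire_several_mult[OF clinear_form_entire[OF l] homog_poly_entire[OF homog_poly_dir_deriv[OF f]]]]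
        entire_several_differentiable[OF homog_poly_entire[OF homog_poly_cmult[OF f]]]]
    by (simp add: dir_deriv_linear_mult[OF l f'd] dir_deriv_cmult[OF fd])
  have r: "dir_deriv (cvec \<alpha>) (\<lambda>z. l z * f z) z / cdot (cvec \<alpha>) z
         - cdot (cvec \<alpha>) (cvec \<alpha>) / 2 * ((l z * f z - l (crefl_along \<alpha> z) * f (crefl_along \<alpha> z)) / (cdot (cvec \<alpha>) z)\<^sup>2)
      = l z * (dir_deriv (cvec \<alpha>) f z / cdot (cvec \<alpha>) z
         - cdot (cvec \<alpha>) (cvec \<alpha>) / 2 * ((f z - f (crefl_along \<alpha> z)) / (cdot (cvec \<alpha>) z)\<^sup>2))
       + l (cvec \<alpha>) * root_quotient \<alpha> f z" if "\<alpha> \<in> Rp" for \<alpha>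
  proof -
    note nz = cdot_cvec_self_nonzero[OF Rp_nonzero[OF that]]
    define a where "a = cdot (cvec \<alpha>) z"
    define q where "q = cdot (cvec \<alpha>) (cvec \<alpha>)"
    have "a \<noteq> 0" "q \<noteq> 0" using z[OF that] nz by (auto simp: a_def q_def)
    have ls: "l (crefl_along \<alpha> z) = l z - 2 * a / q * l (cvec \<alpha>)"
      by (simp add: crefl_along_def clinear_form_diff[OF l] clinear_form_scale[OF l] a_def q_def)
    show ?thesis
      unfolding root_quotient_def d1 ls a_def[symmetric] q_def[symmetric]
      using \<open>a \<noteq> 0\<close> \<open>q \<noteq> 0\<close> by (simp add: field_simps power2_eq_square)
  qed
  have e: "(\<Sum>i\<in>UNIV. l (axis i 1) * T (axis i 1) f z)
     = (\<Sum>i\<in>UNIV. l (axis i 1) * dir_deriv (axis i 1) f z) + (\<Sum>\<alpha>\<in>Rp. complex_of_real (k \<alpha>) * (l (cvec \<alpha>) * root_quotient \<alpha> f z))"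
  proof -
    have "(\<Sum>i\<in>UNIV. l (axis i 1) * (\<Sum>\<alpha>\<in>Rp. complex_of_real (k \<alpha>) * cdot (cvec \<alpha>) (axis i 1) * root_quotient \<alpha> f z))
       = (\<Sum>\<alpha>\<in>Rp. complex_of_real (k \<alpha>) * ((\<Sum>i\<in>UNIV. cvec \<alpha> $ i * l (axis i 1)) * root_quotient \<alpha> f z))"
      unfolding sum_distrib_left sum_distrib_right by (subst sum.swap) (simp add: cdot_axis mult_ac)
    then show ?thesis
      unfolding T_def by (simp add: distrib_left sum.distrib clinear_form_expansion[OF l])
  qed
  let ?r = "\<lambda>\<alpha>. dir_deriv (cvec \<alpha>) f z / cdot (cvec \<alpha>) z
         - cdot (cvec \<alpha>) (cvec \<alpha>) / 2 * ((f z - f (crefl_along \<alpha> z)) / (cdot (cvec \<alpha>) z)\<^sup>2)"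
  have "(\<Sum>\<alpha>\<in>Rp. complex_of_real (k \<alpha>) * (dir_deriv (cvec \<alpha>) (\<lambda>z. l z * f z) z / cdot (cvec \<alpha>) z
         - cdot (cvec \<alpha>) (cvec \<alpha>) / 2 * ((l z * f z - l (crefl_along \<alpha> z) * f (crefl_along \<alpha> z)) / (cdot (cvec \<alpha>) z)\<^sup>2)))
      = (\<Sum>\<alpha>\<in>Rp. complex_of_real (k \<alpha>) * (l z * ?r \<alpha> + l (cvec \<alpha>) * root_quotient \<alpha> f z))"
    by (intro sum.cong refl) (simp only: r)
  also have "\<dots> = l z * (\<Sum>\<alpha>\<in>Rp. complex_of_real (k \<alpha>) * ?r \<alpha>)
      + (\<Sum>\<alpha>\<in>Rp. complex_of_real (k \<alpha>) * (l (cvec \<alpha>) * root_quotient \<alpha> f z))"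
    by (simp only: distrib_left sum.distrib sum_distrib_left mult.left_commute)
  finally show ?thesis
    unfolding e unfolding explicit_dunkl_laplacian_def d2
    by (simp add: distrib_left sum.distrib sum_distrib_left mult.left_commute)
qed

lemma explicit_dunkl_laplacian_eq:
  assumes "homog_poly n f" and z: "\<And>\<alpha>. \<alpha> \<in> Rp \<Longrightarrow> cdot (cvec \<alpha>) z \<noteq> 0"
  shows "explicit_dunkl_laplacian f z = (\<Sum>i\<in>UNIV. T (axis i 1) (T (axis i 1) f) z)"
  using assms(1)
proof (induction rule: homog_poly.induct)
  case (homog_poly_const c)
  have "T \<xi> (\<lambda>_. c) = (\<lambda>_. 0)" "dir_deriv \<xi> (\<lambda>_. c) = (\<lambda>_. 0)" for \<xi> by auto
  then show ?case by (simp add: explicit_dunkl_laplacian_def)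
next
  case (homog_poly_linear l n f)
  show ?case
    using explicit_dunkl_laplacian_linear_mult[OF homog_poly_linear(1,2), of z, OF z]
    unfolding laplacian_T_linear_mult[OF homog_poly_linear(1,2)] homog_poly_linear.IH by simp
next
  case (homog_poly_add n f g)
  note h = homog_poly_add(1,2)
  have "T \<xi> (\<lambda>z. f z + g z) = (\<lambda>z. T \<xi> f z + T \<xi> g z)" for \<xi>
    using h[THEN homog_poly_entire] by (auto simp: T_add)
  moreover have 2: "dir_deriv h (\<lambda>z. f z + g z) = (\<lambda>z. dir_deriv h f z + dir_deriv h g z)" for h
    using h[THEN homog_poly_differentiable] by (auto simp: dir_deriv_add)
  moreover have "explicit_dunkl_laplacian (\<lambda>z. f z + g z) z = explicit_dunkl_laplacian f z + explicit_dunkl_laplacian g z"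
    unfolding explicit_dunkl_laplacian_def 2
      dir_deriv_add[OF h[THEN homog_poly_dir_deriv, THEN homog_poly_differentiable]]
    by (simp add: algebra_simps add_divide_distrib diff_divide_distrib sum.distrib sum_subtractf sum_distrib_left)
  ultimately show ?case
    using h[THEN homog_poly_T, THEN homog_poly_entire] homog_poly_add.IH by (simp add: T_add sum.distrib)
qed

lemma explicit_dunkl_laplacian_kernel_poly:
  assumes z: "\<And>\<alpha>. \<alpha> \<in> Rp \<Longrightarrow> cdot (cvec \<alpha>) z \<noteq> 0"
  shows "explicit_dunkl_laplacian (\<lambda>z. kernel_poly n z w) z = (if n < 2 then 0 else cdot w w * kernel_poly (n - 2) z w)"
proof -
  have 1: "T (axis i 1) (\<lambda>z. kernel_poly n z w) = (\<lambda>z. w $ i * (if n = 0 then 0 else kernel_poly (n - 1) z w))" for i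
    by (auto simp: T_kernel_poly cdot_axis)
  have "T (axis i 1) (T (axis i 1) (\<lambda>z. kernel_poly n z w)) z = w $ i * w $ i * (if n < 2 then 0 else kernel_poly (n - 2) z w)" for i
  proof (cases n)
    case 0
    have "T (axis i 1) (\<lambda>z. 1) = (\<lambda>_. 0)" by auto
    with 0 show ?thesis by simp
  next
    case (Suc m)
    then show ?thesis
      unfolding 1 by (auto simp: T_cmult homog_poly_entire[OF homog_poly_kernel_poly] T_kernel_poly cdot_axis numeral_2_eq_2 less_Suc_eq)
  qed
  moreover have "explicit_dunkl_laplacian (\<lambda>z. kernel_poly n z w) z
      = (\<Sum>i\<in>UNIV. T (axis i 1) (T (axis i 1) (\<lambda>z. kernel_poly n z w)) z)"
    by (rule explicit_dunkl_laplacian_eq[OF homog_poly_kernel_poly]) (rule z)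
  ultimately show ?thesis
    by (simp add: cdot_expand flip: sum_distrib_right)
qed

section \<open>Summation of the kernel series\<close>

lemma has_derivative_pair_left: "((\<lambda>z. (z, w)) has_derivative (\<lambda>h. (h, 0))) (at z)"
  by (auto intro!: derivative_eq_intros)

lemma dir_deriv_slice:
  assumes "F differentiable at (z, w)"
  shows "dir_deriv h (\<lambda>z. F (z, w)) z = dir_deriv (h, 0) F (z, w)"
  by (rule dir_deriv_eq[OF has_derivative_compose[OF has_derivative_pair_left has_derivative_dir_deriv[OF assms]]])

lemma slice_differentiable:
  fixes F :: "'a::real_normed_vector \<times> 'b::real_normed_vector \<Rightarrow> complex"
  assumes "F differentiable at (z, w)"
  shows "(\<lambda>z. F (z, w)) differentiable at z"
  using has_derivative_compose[OF has_derivative_pair_left has_derivative_dir_deriv[OF assms]]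
    differentiable_def by blast

lemma kernel_sums: "(\<lambda>n. kernel_poly n z w) sums kernel (z, w)"
  using kernel_series unfolding poly_series_def by auto

lemma poly_series_term_differentiable: "poly_series p F \<Longrightarrow> p n differentiable at v"
  unfolding poly_series_def using bounded_poly_differentiable by blast

lemma kernel_dir_deriv_sums: "(\<lambda>n. dir_deriv h (\<lambda>z. kernel_poly n z w) z) sums dir_deriv (h, 0) kernel (z, w)"
proof -
  have "dir_deriv h (\<lambda>z. kernel_poly n z w) z = dir_deriv (h, 0) (\<lambda>v. kernel_poly n (fst v) (snd v)) (z, w)" for n
    using dir_deriv_slice[OF poly_series_term_differentiable[OF kernel_series], of h n w z] by simp
  then show ?thesis using poly_series_derivative(2)[OF kernel_series, of "(h, 0)" "(z, w)"] by simp
qed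

lemma kernel_differentiable: "kernel differentiable at v"
  by (rule poly_series_differentiable[OF kernel_series])

lemma kernel_second_dir_deriv_sums:
  "(\<lambda>n. dir_deriv h (dir_deriv h (\<lambda>z. kernel_poly n z w)) z) sums dir_deriv (h, 0) (dir_deriv (h, 0) kernel) (z, w)"
proof -
  define p where "p = (\<lambda>n v. kernel_poly n (fst v) (snd v))"
  have ps: "poly_series p kernel" unfolding p_def by (rule kernel_series)
  have d1: "p n differentiable at v" for n v
    by (rule poly_series_term_differentiable[OF ps])
  have d2: "dir_deriv k (p n) differentiable at v" for n v k
    by (rule poly_series_term_differentiable[OF poly_series_dir_deriv[OF ps]])
  have "dir_deriv h (\<lambda>z. kernel_poly n z w) = (\<lambda>z. dir_deriv (h, 0) (p n) (z, w))" for n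
    using dir_deriv_slice[OF d1] by (force simp: p_def)
  then have "dir_deriv h (dir_deriv h (\<lambda>z. kernel_poly n z w)) z = dir_deriv (h, 0) (dir_deriv (h, 0) (p n)) (z, w)" for n
    using dir_deriv_slice[OF d2] by simp
  then show ?thesis
    using poly_series_derivative(2)[OF poly_series_dir_deriv[OF ps], of "(h, 0)" "(h, 0)" "(z, w)"] by simp
qed

lemma kernel_entire: "entire_several (\<lambda>z. kernel (z, w))"
proof -
  have "dir_deriv (c *s v) (\<lambda>z. kernel (z, w)) z = c * dir_deriv v (\<lambda>z. kernel (z, w)) z" for c v z
  proof -
    have "(\<lambda>n. c * dir_deriv v (\<lambda>z. kernel_poly n z w) z) sums (c * dir_deriv (v, 0) kernel (z, w))"
      by (intro sums_mult kernel_dir_deriv_sums)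
    then show ?thesis
      using kernel_dir_deriv_sums[of "c *s v" w z] sums_unique2
      unfolding dir_deriv_scale[OF homog_poly_entire[OF homog_poly_kernel_poly]] dir_deriv_slice[OF kernel_differentiable]
      by blast
  qed
  then show ?thesis
    unfolding entire_several_iff using slice_differentiable[OF kernel_differentiable] by blast
qed

lemma T_kernel: "T \<xi> (\<lambda>z. kernel (z, w)) z = cdot \<xi> w * kernel (z, w)"
proof -
  have q: "(\<lambda>n. root_quotient \<alpha> (\<lambda>z. kernel_poly n z w) z) sums root_quotient \<alpha> (\<lambda>z. kernel (z, w)) z" for \<alpha>
  proof (cases "cdot (cvec \<alpha>) z = 0")
    case True
    then show ?thesis
      unfolding root_quotient_def dir_deriv_slice[OF kernel_differentiable]
      by (simp only: if_False simp_thms) (intro sums_mult kernel_dir_deriv_sums)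
  next
    case False
    then show ?thesis
      unfolding root_quotient_def by (simp only: if_True simp_thms) (intro sums_divide sums_diff kernel_sums)
  qed
  have "(\<lambda>n. T \<xi> (\<lambda>z. kernel_poly n z w) z) sums T \<xi> (\<lambda>z. kernel (z, w)) z"
    unfolding T_def dir_deriv_slice[OF kernel_differentiable]
    by (intro sums_add sums_sum sums_mult kernel_dir_deriv_sums q)
  then have "(\<lambda>n. T \<xi> (\<lambda>z. kernel_poly (Suc n) z w) z) sums T \<xi> (\<lambda>z. kernel (z, w)) z"
    by (subst sums_Suc_iff) (simp add: T_kernel_poly)
  then have "(\<lambda>n. cdot \<xi> w * kernel_poly n z w) sums T \<xi> (\<lambda>z. kernel (z, w)) z"
    unfolding T_kernel_poly by simp
  then show ?thesis using sums_mult[OF kernel_sums] sums_unique2 by blast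
qed

lemma kernel_zero: "kernel (0, w) = 1"
proof -
  have "kernel_poly n 0 w = of_bool (n = 0)" for n
  proof (cases n)
    case (Suc m)
    have "complex_of_real (resolvent (real (Suc m)) u) * (cdot (u 0) w * kernel_poly m (u 0) w) = 0" if "u \<in> W" for u
    proof -
      have "u 0 = 0" using W_norm[OF that, of 0] by simp
      then show ?thesis by simp
    qed
    then have "kernel_poly (Suc m) 0 w = 0" unfolding kernel_poly.simps by (intro sum.neutral) blast
    with Suc show ?thesis by simp
  qed simp
  then have "(\<lambda>n. of_bool (n = (0::nat))) sums kernel (0, w)" using kernel_sums[of 0 w] by simp
  moreover have "(\<lambda>n. of_bool (n = (0::nat)) :: complex) sums 1"
    using sums_single[of 0 "\<lambda>_. 1::complex"] by (simp add: of_bool_def)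
  ultimately show ?thesis using sums_unique2 by blast
qed

lemma kernel_radial:
  "dir_deriv (z, 0) kernel (z, w) + (\<Sum>\<alpha>\<in>Rp. complex_of_real (k \<alpha>) * (kernel (z, w) - kernel (crefl_along \<alpha> z, w)))
     = cdot z w * kernel (z, w)"
  using T_kernel[of z w z] unfolding T_radial dir_deriv_slice[OF kernel_differentiable] by simp

lemma kernel_laplacian:
  assumes z: "\<And>\<alpha>. \<alpha> \<in> Rp \<Longrightarrow> cdot (cvec \<alpha>) z \<noteq> 0"
  shows "(\<Sum>i\<in>UNIV. dir_deriv (axis i 1, 0) (dir_deriv (axis i 1, 0) kernel) (z, w))
     + 2 * (\<Sum>\<alpha>\<in>Rp. complex_of_real (k \<alpha>) * (dir_deriv (cvec \<alpha>, 0) kernel (z, w) / cdot (cvec \<alpha>) z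
         - cdot (cvec \<alpha>) (cvec \<alpha>) / 2 * ((kernel (z, w) - kernel (crefl_along \<alpha> z, w)) / (cdot (cvec \<alpha>) z)\<^sup>2)))
     = cdot w w * kernel (z, w)" (is "?L = _")
proof -
  have "(\<lambda>n. explicit_dunkl_laplacian (\<lambda>z. kernel_poly n z w) z) sums ?L"
    unfolding explicit_dunkl_laplacian_def
    by (intro sums_add sums_sum sums_mult sums_diff sums_divide kernel_dir_deriv_sums kernel_second_dir_deriv_sums kernel_sums)
  moreover have "(\<lambda>n. explicit_dunkl_laplacian (\<lambda>z. kernel_poly n z w) z)
      = (\<lambda>n. if n < 2 then 0 else cdot w w * kernel_poly (n - 2) z w)"
    by (rule ext, rule explicit_dunkl_laplacian_kernel_poly) (rule z)
  ultimately have "(\<lambda>n. if n < 2 then 0 else cdot w w * kernel_poly (n - 2) z w) sums ?L" by (simp only:)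
  moreover have "(\<Sum>n<2. if n < 2 then 0 else cdot w w * kernel_poly (n - 2) z w) = 0" by simp
  ultimately have "(\<lambda>n. cdot w w * kernel_poly n z w) sums ?L"
    using sums_iff_shift[of "\<lambda>n. if n < 2 then 0 else cdot w w * kernel_poly (n - 2) z w" 2 ?L] by simp
  then show ?thesis using sums_mult[OF kernel_sums] sums_unique2 by blast
qed

end

section \<open>Identification with the Dunkl kernel\<close>

text \<open>The mean value inequality along the segment from \<open>y\<close> to its mirror image; the segment stays as close
to the point \<open>z\<close> of the hyperplane as \<open>y\<close> itself.\<close>

lemma refl_difference_bound:
  fixes f :: "complex^'n \<Rightarrow> complex"
  assumes f: "entire_several f" and \<alpha>: "\<alpha> \<noteq> 0"
    and B: "\<And>p. norm (p - z) \<le> norm (y - z) \<Longrightarrow> norm (dir_deriv (cvec \<alpha>) f p - D) \<le> B"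
    and z: "cdot (cvec \<alpha>) z = 0"
  defines "c \<equiv> 2 * cdot (cvec \<alpha>) y / cdot (cvec \<alpha>) (cvec \<alpha>)"
  shows "norm (f y - f (crefl_along \<alpha> y) - c * D) \<le> norm c * B"
proof -
  define g where "g = (\<lambda>s::real. f (y - complex_of_real s *s (c *s cvec \<alpha>)) + complex_of_real s * (c * D))"
  define g' where "g' = (\<lambda>s::real. c * (D - dir_deriv (cvec \<alpha>) f (y - complex_of_real s *s (c *s cvec \<alpha>))))"
  have line: "((\<lambda>s. y - complex_of_real s *s (c *s cvec \<alpha>)) has_derivative (\<lambda>h. - (complex_of_real h *s (c *s cvec \<alpha>)))) (at s)" for s
    unfolding scaleR_scaleC[symmetric] by (auto intro!: derivative_eq_intros)
  have d: "(g has_derivative (\<lambda>h. complex_of_real h * g' s)) (at s within {0..1})" for s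
  proof (rule has_derivative_at_withinI)
    have "((\<lambda>s. f (y - complex_of_real s *s (c *s cvec \<alpha>))) has_derivative
        (\<lambda>h. dir_deriv (- (complex_of_real h *s (c *s cvec \<alpha>))) f (y - complex_of_real s *s (c *s cvec \<alpha>)))) (at s)"
      by (rule has_derivative_compose[OF line has_derivative_dir_deriv[OF entire_several_differentiable[OF f]]])
    then have "(g has_derivative (\<lambda>h. dir_deriv (- (complex_of_real h *s (c *s cvec \<alpha>))) f (y - complex_of_real s *s (c *s cvec \<alpha>))
        + complex_of_real h * (c * D))) (at s)"
      unfolding g_def by (rule has_derivative_add) (auto intro!: derivative_eq_intros)
    then show "(g has_derivative (\<lambda>h. complex_of_real h * g' s)) (at s)"
      by (simp add: g'_def dir_deriv_minus_direction[OF entire_several_differentiable[OF f]] dir_deriv_scale[OF f] algebra_simps)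
  qed
  have seg: "norm (y - complex_of_real s *s (c *s cvec \<alpha>) - z) \<le> norm (y - z)" if "s \<in> {0..1}" for s
  proof -
    have r: "crefl_along \<alpha> y = y - c *s cvec \<alpha>" by (simp add: crefl_along_def c_def)
    have "norm (crefl_along \<alpha> y - z) = norm (crefl_along \<alpha> (y - z))"
      by (simp add: crefl_along_diff crefl_along_fixed[OF z])
    then have "norm (crefl_along \<alpha> y - z) = norm (y - z)" by (simp add: norm_crefl_along[OF \<alpha>])
    moreover have "y - complex_of_real s *s (c *s cvec \<alpha>) - z = (1 - s) *\<^sub>R (y - z) + s *\<^sub>R (crefl_along \<alpha> y - z)"
      unfolding r
      by (simp only: vec_eq_iff vector_minus_component vector_add_component vector_scaleR_component vector_smult_component)
        (simp add: scaleR_conv_of_real algebra_simps)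
    ultimately have "norm (y - complex_of_real s *s (c *s cvec \<alpha>) - z) \<le> (1 - s) * norm (y - z) + s * norm (y - z)"
      using norm_triangle_ineq[of "(1 - s) *\<^sub>R (y - z)" "s *\<^sub>R (crefl_along \<alpha> y - z)"] that
      by simp
    then show ?thesis by (simp flip: distrib_right)
  qed
  have "norm (g 1 - g 0) \<le> norm c * B * norm (1 - 0 :: real)"
  proof (rule differentiable_bound[OF _ d])
    show "onorm (\<lambda>h. complex_of_real h * g' s) \<le> norm c * B" if "s \<in> {0..1}" for s
    proof (rule onorm_le)
      have "norm (g' s) \<le> norm c * B"
        unfolding g'_def norm_mult using B[OF seg[OF that]] by (intro mult_left_mono) (auto simp: norm_minus_commute)
      then show "norm (complex_of_real h * g' s) \<le> norm c * B * norm h" for h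
        using mult_left_mono[of "norm (g' s)" "norm c * B" "\<bar>h\<bar>"] by (simp add: norm_mult mult_ac)
    qed
  qed auto
  moreover have "g 1 - g 0 = - (f y - f (crefl_along \<alpha> y) - c * D)"
    by (simp add: g_def crefl_along_def c_def)
  ultimately show ?thesis by (simp add: norm_minus_commute)
qed

lemma root_quotient_cont_ext:
  fixes f :: "complex^'n \<Rightarrow> complex"
  assumes f: "entire_several f" and \<alpha>: "\<alpha> \<noteq> 0" and c: "isCont (dir_deriv (cvec \<alpha>) f) z"
  shows "cont_ext {y. cdot (cvec \<alpha>) y \<noteq> 0} (\<lambda>y. (f y - f (crefl_along \<alpha> y)) / cdot (cvec \<alpha>) y) z = root_quotient \<alpha> f z"
proof (cases "cdot (cvec \<alpha>) z = 0")
  case False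
  then show ?thesis by (simp add: cont_ext_def root_quotient_def)
next
  case True
  define S where "S = {y. cdot (cvec \<alpha>) y \<noteq> 0}"
  define q where "q = cdot (cvec \<alpha>) (cvec \<alpha>)"
  have q: "q \<noteq> 0" using cdot_cvec_self_nonzero[OF \<alpha>] by (simp add: q_def)
  define D where "D = dir_deriv (cvec \<alpha>) f z"
  have "((\<lambda>y. (f y - f (crefl_along \<alpha> y)) / cdot (cvec \<alpha>) y) \<longlongrightarrow> 2 / q * D) (at z within S)"
    unfolding Lim_within
  proof (intro allI impI)
    fix e :: real assume e: "e > 0"
    define e' where "e' = e * norm q / 4"
    have "e' > 0" using e q by (simp add: e'_def)
    then obtain d where d: "d > 0" "\<And>p. dist p z < d \<Longrightarrow> dist (dir_deriv (cvec \<alpha>) f p) D < e'"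
      using c unfolding continuous_at_eps_delta D_def by blast
    show "\<exists>d>0. \<forall>y\<in>S. 0 < dist y z \<and> dist y z < d \<longrightarrow>
        dist ((f y - f (crefl_along \<alpha> y)) / cdot (cvec \<alpha>) y) (2 / q * D) < e"
    proof (intro exI[of _ d] conjI ballI impI d(1))
      fix y assume y: "y \<in> S" "0 < dist y z \<and> dist y z < d"
      define a where "a = cdot (cvec \<alpha>) y"
      have a: "a \<noteq> 0" using y(1) by (simp add: S_def a_def)
      have "norm (f y - f (crefl_along \<alpha> y) - 2 * a / q * D) \<le> norm (2 * a / q) * e'"
        unfolding a_def q_def
      proof (rule refl_difference_bound[OF f \<alpha> _ True])
        fix p assume "norm (p - z) \<le> norm (y - z)"
        then have "dist p z < d" using y(2) by (simp add: dist_norm)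
        then show "norm (dir_deriv (cvec \<alpha>) f p - D) \<le> e'" using d(2) by (simp add: dist_norm less_imp_le)
      qed
      then have "norm (f y - f (crefl_along \<alpha> y) - 2 * a / q * D) / norm a \<le> norm (2 * a / q) * e' / norm a"
        by (rule divide_right_mono) simp
      also have "\<dots> = e / 2" using a q by (simp add: e'_def norm_mult norm_divide)
      also have "norm (f y - f (crefl_along \<alpha> y) - 2 * a / q * D) / norm a
         = norm ((f y - f (crefl_along \<alpha> y)) / a - 2 / q * D)"
        unfolding norm_divide[symmetric] using a by (simp add: diff_divide_distrib)
      finally show "dist ((f y - f (crefl_along \<alpha> y)) / cdot (cvec \<alpha>) y) (2 / q * D) < e"
        using e by (simp add: dist_norm a_def)
    qed
  qed
  moreover have "at z within S \<noteq> bot"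
  proof -
    have "z islimpt S"
      unfolding islimpt_approachable
    proof (intro allI impI)
      fix e :: real assume e: "e > 0"
      define s where "s = e / (2 * norm \<alpha>)"
      have s: "s > 0" using e \<alpha> by (simp add: s_def)
      have "z + complex_of_real s *s cvec \<alpha> \<in> S"
        using s q True by (simp add: S_def cdot_linear q_def)
      moreover have "dist (z + complex_of_real s *s cvec \<alpha>) z = e / 2"
      proof -
        have "s * norm \<alpha> = e / 2" using \<alpha> by (simp add: s_def)
        then show ?thesis using s by (simp add: dist_norm scaleC_norm)
      qed
      moreover have "z \<notin> S" using True by (simp add: S_def)
      ultimately show "\<exists>x'\<in>S. x' \<noteq> z \<and> dist x' z < e"
        using e by (metis half_gt_zero_iff field_sum_of_halves less_add_same_cancel1)
    qed
    then show ?thesis by (simp add: trivial_limit_within)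
  qed
  ultimately have "Lim (at z within S) (\<lambda>y. (f y - f (crefl_along \<alpha> y)) / cdot (cvec \<alpha>) y) = 2 / q * D"
    by (rule tendsto_Lim[rotated])
  then show ?thesis
    using True by (simp add: cont_ext_def root_quotient_def S_def q_def D_def)
qed

definition entire_series :: "('v::real_normed_vector \<Rightarrow> complex) \<Rightarrow> bool" where
  "entire_series F \<longleftrightarrow> (\<exists>p. poly_series p F)"

lemma entire_series_differentiable: "entire_series F \<Longrightarrow> F differentiable at v"
  and entire_series_dir_deriv: "entire_series F \<Longrightarrow> entire_series (dir_deriv h F)"
  and entire_series_commute: "entire_series F \<Longrightarrow> dir_deriv h (dir_deriv h' F) = dir_deriv h' (dir_deriv h F)"
  unfolding entire_series_def
  using poly_series_differentiable poly_series_dir_deriv poly_series_dir_deriv_commute by blast+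

lemma entire_series_isCont: "entire_series F \<Longrightarrow> isCont F v"
  by (simp add: entire_series_differentiable differentiable_imp_continuous_within)

lemma has_derivative_pair_right: "((\<lambda>w. (z, w)) has_derivative (\<lambda>h. (0, h))) (at w)"
  by (auto intro!: derivative_eq_intros)

lemma dir_deriv_slice_right:
  assumes "F differentiable at (z, w)"
  shows "dir_deriv h (\<lambda>w. F (z, w)) w = dir_deriv (0, h) F (z, w)"
  by (rule dir_deriv_eq[OF has_derivative_compose[OF has_derivative_pair_right has_derivative_dir_deriv[OF assms]]])

lemma slice_right_differentiable:
  fixes F :: "'a::real_normed_vector \<times> 'b::real_normed_vector \<Rightarrow> complex"
  assumes "F differentiable at (z, w)"
  shows "(\<lambda>w. F (z, w)) differentiable at w"
  using has_derivative_compose[OF has_derivative_pair_right has_derivative_dir_deriv[OF assms]]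
    differentiable_def by blast

lemma dir_deriv_sum:
  "(\<And>i. i \<in> A \<Longrightarrow> f i differentiable at v) \<Longrightarrow>
    dir_deriv h (\<lambda>v. \<Sum>i\<in>A. f i v) v = (\<Sum>i\<in>A. dir_deriv h (f i) v)"
  by (rule dir_deriv_eq) (intro has_derivative_sum has_derivative_dir_deriv)

lemma dir_deriv_diff:
  assumes "f differentiable at v" "g differentiable at v"
  shows "dir_deriv h (\<lambda>v. f v - g v) v = dir_deriv h f v - dir_deriv h g v"
  by (rule dir_deriv_eq[OF has_derivative_diff[OF assms[THEN has_derivative_dir_deriv]]])

context dunkl_setup
begin

text \<open>At a maximum of \<open>\<bar>d z\<bar>\<^sup>2 exp (- 2 C \<bar>z\<bar>)\<close> over a ball the radial derivative is nonnegative. The reflection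
terms can only lower it, since \<open>\<bar>d\<bar>\<close> at the mirror image is not larger, and the remaining term is
dominated by the exponential weight as soon as \<open>C > \<bar>w\<bar>\<close>.\<close>

lemma radial_unique:
  fixes d :: "complex^'n \<Rightarrow> complex"
  assumes diff: "\<And>z. d differentiable at z" and d0: "d 0 = 0"
    and rad: "\<And>z. dir_deriv z d z + (\<Sum>\<alpha>\<in>Rp. complex_of_real (k \<alpha>) * (d z - d (crefl_along \<alpha> z))) = cdot z w * d z"
  shows "d z = 0"
proof (rule ccontr)
  assume nz: "d z \<noteq> 0"
  define C where "C = norm w + 1"
  define \<Phi> where "\<Phi> = (\<lambda>z. (norm (d z))\<^sup>2 * exp (- 2 * C * norm z))"
  have "continuous_on (cball 0 (norm z)) \<Phi>"
    unfolding \<Phi>_def using diff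
    by (intro continuous_intros differentiable_imp_continuous_on) (auto simp: differentiable_on_def intro: differentiable_at_withinI)
  then obtain z0 where z0: "z0 \<in> cball 0 (norm z)" and max: "\<And>y. y \<in> cball 0 (norm z) \<Longrightarrow> \<Phi> y \<le> \<Phi> z0"
    using continuous_attains_sup[OF compact_cball, of 0 "norm z" \<Phi>] by auto
  have "0 < \<Phi> z" using nz by (simp add: \<Phi>_def)
  with max[of z] have p: "0 < \<Phi> z0" by simp
  then have dz0: "d z0 \<noteq> 0" by (auto simp: \<Phi>_def)
  then have "z0 \<noteq> 0" using d0 by auto
  define D where "D = dir_deriv z0 d z0"
  have D: "D = cdot z0 w * d z0 - (\<Sum>\<alpha>\<in>Rp. complex_of_real (k \<alpha>) * (d z0 - d (crefl_along \<alpha> z0)))"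
    using rad[of z0] by (simp add: D_def algebra_simps)
  have 1: "d z0 \<bullet> (cdot z0 w * d z0) \<le> norm z0 * norm w * (norm (d z0))\<^sup>2"
  proof -
    have "d z0 \<bullet> (cdot z0 w * d z0) \<le> norm (d z0) * norm (cdot z0 w * d z0)" by (rule norm_cauchy_schwarz)
    also have "\<dots> = norm (cdot z0 w) * (norm (d z0))\<^sup>2" by (simp add: norm_mult power2_eq_square)
    also have "\<dots> \<le> norm z0 * norm w * (norm (d z0))\<^sup>2" by (intro mult_right_mono cdot_bound) simp
    finally show ?thesis .
  qed
  have 2: "0 \<le> d z0 \<bullet> (\<Sum>\<alpha>\<in>Rp. complex_of_real (k \<alpha>) * (d z0 - d (crefl_along \<alpha> z0)))"
    unfolding inner_sum_right
  proof (rule sum_nonneg)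
    fix \<alpha> assume \<alpha>: "\<alpha> \<in> Rp"
    have "\<Phi> (crefl_along \<alpha> z0) \<le> \<Phi> z0" using z0 by (intro max) (simp add: norm_crefl_along Rp_nonzero[OF \<alpha>])
    then have "norm (d (crefl_along \<alpha> z0)) \<le> norm (d z0)"
      by (simp add: \<Phi>_def norm_crefl_along Rp_nonzero[OF \<alpha>] power_mono_iff)
    then have "norm (d z0) * norm (d (crefl_along \<alpha> z0)) \<le> norm (d z0) * norm (d z0)" by (intro mult_left_mono) auto
    then have "d z0 \<bullet> d (crefl_along \<alpha> z0) \<le> d z0 \<bullet> d z0"
      using norm_cauchy_schwarz[of "d z0" "d (crefl_along \<alpha> z0)"] by (simp add: dot_square_norm power2_eq_square)
    then have "0 \<le> k \<alpha> * (d z0 \<bullet> (d z0 - d (crefl_along \<alpha> z0)))"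
      using k_nonneg'[OF \<alpha>] by (simp add: inner_diff_right)
    then show "0 \<le> d z0 \<bullet> (complex_of_real (k \<alpha>) * (d z0 - d (crefl_along \<alpha> z0)))"
      by (simp add: scaleR_conv_of_real[symmetric])
  qed
  have neg: "d z0 \<bullet> D - C * norm z0 * (norm (d z0))\<^sup>2 < 0"
  proof -
    have "d z0 \<bullet> D \<le> norm z0 * norm w * (norm (d z0))\<^sup>2" using 1 2 by (simp add: D inner_diff_right)
    moreover have "0 < norm z0 * (norm (d z0))\<^sup>2" using \<open>z0 \<noteq> 0\<close> dz0 by simp
    ultimately show ?thesis by (simp add: C_def algebra_simps)
  qed
  have "((\<lambda>t::real. d (t *\<^sub>R z0)) has_derivative (\<lambda>h. dir_deriv (h *\<^sub>R z0) d (1 *\<^sub>R z0))) (at 1)"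
    by (rule has_derivative_compose[OF _ has_derivative_dir_deriv[OF diff]]) (auto intro!: derivative_eq_intros)
  moreover have "dir_deriv (h *\<^sub>R z0) d (1 *\<^sub>R z0) = h *\<^sub>R D" for h
  proof -
    interpret bounded_linear "\<lambda>h. dir_deriv h d z0"
      using has_derivative_dir_deriv[OF diff] by (rule has_derivative_bounded_linear)
    show ?thesis by (simp add: D_def scaleR)
  qed
  ultimately have dd: "((\<lambda>t::real. d (t *\<^sub>R z0)) has_derivative (\<lambda>h. h *\<^sub>R D)) (at 1)" by simp
  have "((\<lambda>t. (d (t *\<^sub>R z0) \<bullet> d (t *\<^sub>R z0)) * exp (- 2 * C * (t * norm z0))) has_real_derivative
      2 * (d z0 \<bullet> D - C * norm z0 * (norm (d z0))\<^sup>2) * exp (- 2 * C * norm z0)) (at 1)"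
    unfolding has_field_derivative_def
    by (rule has_derivative_eq_rhs, rule has_derivative_mult, rule has_derivative_inner[OF dd dd], rule derivative_eq_intros)
      (auto intro!: derivative_eq_intros simp: fun_eq_iff algebra_simps inner_commute dot_square_norm)
  moreover have "2 * (d z0 \<bullet> D - C * norm z0 * (norm (d z0))\<^sup>2) * exp (- 2 * C * norm z0) < 0"
    using neg by (simp add: mult_less_0_iff)
  ultimately obtain \<delta> where \<delta>: "\<delta> > 0" "\<And>h. h > 0 \<Longrightarrow> h < \<delta> \<Longrightarrow>
      (d (1 *\<^sub>R z0) \<bullet> d (1 *\<^sub>R z0)) * exp (- 2 * C * (1 * norm z0)) < (d ((1 - h) *\<^sub>R z0) \<bullet> d ((1 - h) *\<^sub>R z0)) * exp (- 2 * C * ((1 - h) * norm z0))"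
    using DERIV_neg_dec_left by blast
  define h where "h = min (\<delta> / 2) (1 / 2)"
  have h: "h > 0" "h < \<delta>" "h < 1" using \<delta>(1) by (auto simp: h_def)
  have "\<Phi> z0 < \<Phi> ((1 - h) *\<^sub>R z0)"
    using \<delta>(2)[OF h(1,2)] h(3) by (simp add: \<Phi>_def dot_square_norm)
  moreover have "(1 - h) *\<^sub>R z0 \<in> cball 0 (norm z)"
    using z0 h mult_left_le_one_le[of "norm z0" "1 - h"] by auto
  ultimately show False using max leD by blast
qed

text \<open>On a reflecting hyperplane the limit is multiplied by \<open>\<langle>\<alpha>,z\<rangle> = 0\<close>, whatever it is. Hence every
holomorphic solution of the Dunkl equations satisfies the radial equation.\<close>

lemma dunkl_op_radial:
  "dunkl_op Rp k z f z = dir_deriv z f z + (\<Sum>\<alpha>\<in>Rp. complex_of_real (k \<alpha>) * (f z - f (crefl_along \<alpha> z)))"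
  unfolding dunkl_op_def dir_deriv_def
  by (intro arg_cong2[of _ _ _ _ "(+)"] refl sum.cong) (auto simp: cont_ext_def crefl_along_fixed)

lemma kernel_entire_series: "entire_series kernel"
  unfolding entire_series_def using kernel_series by blast

lemma dunkl_op_kernel: "dunkl_op Rp k \<xi> (\<lambda>z. kernel (z, w)) z = cdot \<xi> w * kernel (z, w)"
proof -
  have "cont_ext {y. cdot (cvec \<alpha>) y \<noteq> 0} (\<lambda>y. (kernel (y, w) - kernel (crefl_along \<alpha> y, w)) / cdot (cvec \<alpha>) y) z
      = root_quotient \<alpha> (\<lambda>z. kernel (z, w)) z" if "\<alpha> \<in> Rp" for \<alpha>
  proof (rule root_quotient_cont_ext[OF kernel_entire Rp_nonzero[OF that]])
    have "dir_deriv (cvec \<alpha>) (\<lambda>z. kernel (z, w)) = (\<lambda>z. dir_deriv (cvec \<alpha>, 0) kernel (z, w))"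
      using dir_deriv_slice[OF kernel_differentiable] by blast
    then show "isCont (dir_deriv (cvec \<alpha>) (\<lambda>z. kernel (z, w))) z"
      using continuous_within_compose3[OF entire_series_isCont[OF entire_series_dir_deriv[OF kernel_entire_series]],
          of z UNIV "\<lambda>z. (z, w)" "(cvec \<alpha>, 0)"]
      by (simp add: continuous_Pair)
  qed
  then have "dunkl_op Rp k \<xi> (\<lambda>z. kernel (z, w)) z = T \<xi> (\<lambda>z. kernel (z, w)) z"
    unfolding dunkl_op_def T_def dir_deriv_def by (simp cong: sum.cong)
  then show ?thesis by (simp add: T_kernel)
qed

lemma dunkl_kernel_complex_eq: "dunkl_kernel_complex Rp k z w = kernel (z, w)"
proof -
  have "(THE f. entire_several f \<and> (\<forall>\<xi> y. dunkl_op Rp k \<xi> f y = cdot \<xi> w * f y) \<and> f 0 = 1) = (\<lambda>z. kernel (z, w))"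
  proof (rule the_equality)
    show "entire_several (\<lambda>z. kernel (z, w)) \<and>
        (\<forall>\<xi> y. dunkl_op Rp k \<xi> (\<lambda>z. kernel (z, w)) y = cdot \<xi> w * kernel (y, w)) \<and> kernel (0, w) = 1"
      using kernel_entire dunkl_op_kernel kernel_zero by blast
    fix f assume f: "entire_several f \<and> (\<forall>\<xi> y. dunkl_op Rp k \<xi> f y = cdot \<xi> w * f y) \<and> f 0 = 1"
    show "f = (\<lambda>z. kernel (z, w))"
    proof
      fix z
      have fd: "f differentiable at y" for y using f entire_several_differentiable by blast
      have kd: "(\<lambda>z. kernel (z, w)) differentiable at y" for y by (rule slice_differentiable[OF kernel_differentiable])
      have "f z - kernel (z, w) = 0"
      proof (rule radial_unique[where w = w and d = "\<lambda>z. f z - kernel (z, w)"])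
        show "(\<lambda>z. f z - kernel (z, w)) differentiable at y" for y using fd kd by (rule differentiable_diff)
        show "f 0 - kernel (0, w) = 0" using f kernel_zero by simp
        fix y
        have "dunkl_op Rp k y f y = cdot y w * f y" using f by blast
        moreover have "dunkl_op Rp k y (\<lambda>z. kernel (z, w)) y = cdot y w * kernel (y, w)" by (rule dunkl_op_kernel)
        ultimately show "dir_deriv y (\<lambda>z. f z - kernel (z, w)) y +
            (\<Sum>\<alpha>\<in>Rp. complex_of_real (k \<alpha>) * (f y - kernel (y, w) - (f (crefl_along \<alpha> y) - kernel (crefl_along \<alpha> y, w)))) =
            cdot y w * (f y - kernel (y, w))"
          unfolding dunkl_op_radial dir_deriv_diff[OF fd kd]
          by (simp add: algebra_simps sum.distrib sum_subtractf) algebra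
      qed
      then show "f z = kernel (z, w)" by simp
    qed
  qed
  then show ?thesis unfolding dunkl_kernel_complex_def by simp
qed

section \<open>Derivatives in the spectral variable\<close>

text \<open>The radial equation with an inhomogeneity \<open>S\<close>, which collects the terms created by derivatives in
the second variable.\<close>

definition radial_eq :: "((complex^'n) \<times> (complex^'n) \<Rightarrow> complex) \<Rightarrow> ((complex^'n) \<times> (complex^'n) \<Rightarrow> complex) \<Rightarrow> bool" where
  "radial_eq F S \<longleftrightarrow> (\<forall>z w. dir_deriv (z, 0) F (z, w)
      + (\<Sum>\<alpha>\<in>Rp. complex_of_real (k \<alpha>) * (F (z, w) - F (crefl_along \<alpha> z, w))) = cdot z w * F (z, w) + S (z, w))"

lemma radial_eq_dir_deriv:
  assumes eq: "radial_eq F S" and F: "entire_series F" and S: "\<And>v. S differentiable at v"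
  shows "radial_eq (dir_deriv (0, b) F) (\<lambda>v. cdot (fst v) b * F v + dir_deriv (0, b) S v)"
  unfolding radial_eq_def
proof (intro allI)
  fix z w
  note d = entire_series_differentiable[OF F] entire_series_differentiable[OF entire_series_dir_deriv[OF F]] S
  note r = d[THEN slice_right_differentiable]
  note cd = bounded_linear_differentiable[OF bounded_linear_cdot_right]
  have eq': "(\<lambda>w. dir_deriv (z, 0) F (z, w)
      + (\<Sum>\<alpha>\<in>Rp. complex_of_real (k \<alpha>) * (F (z, w) - F (crefl_along \<alpha> z, w)))) = (\<lambda>w. cdot z w * F (z, w) + S (z, w))"
    using eq unfolding radial_eq_def by blast
  have A: "dir_deriv b (\<lambda>w. dir_deriv (z, 0) F (z, w)
      + (\<Sum>\<alpha>\<in>Rp. complex_of_real (k \<alpha>) * (F (z, w) - F (crefl_along \<alpha> z, w)))) w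
    = dir_deriv (0, b) (dir_deriv (z, 0) F) (z, w)
      + (\<Sum>\<alpha>\<in>Rp. complex_of_real (k \<alpha>) * (dir_deriv (0, b) F (z, w) - dir_deriv (0, b) F (crefl_along \<alpha> z, w)))"
    by (simp add: dir_deriv_add dir_deriv_sum dir_deriv_cmult dir_deriv_diff r dir_deriv_slice_right d)
  have B: "dir_deriv b (\<lambda>w. cdot z w * F (z, w) + S (z, w)) w
    = cdot z w * dir_deriv (0, b) F (z, w) + cdot z b * F (z, w) + dir_deriv (0, b) S (z, w)"
    by (simp add: dir_deriv_add dir_deriv_mult r cd dir_deriv_linear[OF bounded_linear_cdot_right] dir_deriv_slice_right d)
  show "dir_deriv (z, 0) (dir_deriv (0, b) F) (z, w)
      + (\<Sum>\<alpha>\<in>Rp. complex_of_real (k \<alpha>) * (dir_deriv (0, b) F (z, w) - dir_deriv (0, b) F (crefl_along \<alpha> z, w)))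
    = cdot z w * dir_deriv (0, b) F (z, w) + (cdot (fst (z, w)) b * F (z, w) + dir_deriv (0, b) S (z, w))"
    using trans[OF A[unfolded eq', symmetric] B]
    by (simp add: entire_series_commute[OF F, of "(z, 0)"] add.assoc)
qed

definition laplace_eq :: "((complex^'n) \<times> (complex^'n) \<Rightarrow> complex) \<Rightarrow> ((complex^'n) \<times> (complex^'n) \<Rightarrow> complex) \<Rightarrow> bool" where
  "laplace_eq F S \<longleftrightarrow> (\<forall>z w. (\<forall>\<alpha>\<in>Rp. cdot (cvec \<alpha>) z \<noteq> 0) \<longrightarrow>
     (\<Sum>i\<in>UNIV. dir_deriv (axis i 1, 0) (dir_deriv (axis i 1, 0) F) (z, w))
     + 2 * (\<Sum>\<alpha>\<in>Rp. complex_of_real (k \<alpha>) * (dir_deriv (cvec \<alpha>, 0) F (z, w) / cdot (cvec \<alpha>) z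
         - cdot (cvec \<alpha>) (cvec \<alpha>) / 2 * ((F (z, w) - F (crefl_along \<alpha> z, w)) / (cdot (cvec \<alpha>) z)\<^sup>2)))
     = cdot w w * F (z, w) + S (z, w))"

lemma laplace_eq_dir_deriv:
  assumes eq: "laplace_eq F S" and F: "entire_series F" and S: "\<And>v. S differentiable at v"
  shows "laplace_eq (dir_deriv (0, b) F) (\<lambda>v. 2 * cdot (snd v) b * F v + dir_deriv (0, b) S v)"
  unfolding laplace_eq_def
proof (intro allI impI)
  fix z w assume z: "\<forall>\<alpha>\<in>Rp. cdot (cvec \<alpha>) z \<noteq> 0"
  note d = entire_series_differentiable[OF F] entire_series_differentiable[OF entire_series_dir_deriv[OF F]]
    entire_series_differentiable[OF entire_series_dir_deriv[OF entire_series_dir_deriv[OF F]]] S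
  note r = d[THEN slice_right_differentiable]
  let ?L = "\<lambda>w. (\<Sum>i\<in>UNIV. dir_deriv (axis i 1, 0) (dir_deriv (axis i 1, 0) F) (z, w))
     + 2 * (\<Sum>\<alpha>\<in>Rp. complex_of_real (k \<alpha>) * (dir_deriv (cvec \<alpha>, 0) F (z, w) / cdot (cvec \<alpha>) z
         - cdot (cvec \<alpha>) (cvec \<alpha>) / 2 * ((F (z, w) - F (crefl_along \<alpha> z, w)) / (cdot (cvec \<alpha>) z)\<^sup>2)))"
  have eq': "?L = (\<lambda>w. cdot w w * F (z, w) + S (z, w))"
    using eq z unfolding laplace_eq_def by blast
  have sl: "((\<lambda>w. G (z, w)) has_derivative (\<lambda>b. dir_deriv (0, b) G (z, w))) (at w)"
    if "\<And>v. G differentiable at v" for G :: "(complex^'n) \<times> (complex^'n) \<Rightarrow> complex" and z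
    by (rule has_derivative_compose[OF has_derivative_pair_right has_derivative_dir_deriv[OF that]])
  have "(?L has_derivative (\<lambda>b. (\<Sum>i\<in>UNIV. dir_deriv (0, b) (dir_deriv (axis i 1, 0) (dir_deriv (axis i 1, 0) F)) (z, w))
     + 2 * (\<Sum>\<alpha>\<in>Rp. complex_of_real (k \<alpha>) * (dir_deriv (0, b) (dir_deriv (cvec \<alpha>, 0) F) (z, w) / cdot (cvec \<alpha>) z
         - cdot (cvec \<alpha>) (cvec \<alpha>) / 2 * ((dir_deriv (0, b) F (z, w) - dir_deriv (0, b) F (crefl_along \<alpha> z, w)) / (cdot (cvec \<alpha>) z)\<^sup>2))))) (at w)"
    by (intro has_derivative_add has_derivative_sum has_derivative_mult_right has_derivative_diff
        bounded_linear.has_derivative[OF bounded_linear_divide] sl d)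
  note L = dir_deriv_eq[OF this, of b]
  have B: "dir_deriv b (\<lambda>w. cdot w w * F (z, w) + S (z, w)) w
    = cdot w w * dir_deriv (0, b) F (z, w) + 2 * cdot w b * F (z, w) + dir_deriv (0, b) S (z, w)"
  proof -
    have c: "((\<lambda>w. cdot w w) has_derivative (\<lambda>h. 2 * cdot w h)) (at w)"
    proof (rule has_derivative_eq_rhs)
      show "((\<lambda>w. cdot w w) has_derivative (\<lambda>h. \<Sum>i\<in>UNIV. w $ i * h $ i + h $ i * w $ i)) (at w)"
        unfolding cdot_def
        by (intro has_derivative_sum has_derivative_mult bounded_linear.has_derivative[OF bounded_linear_vec_nth has_derivative_ident])
    qed (simp add: fun_eq_iff cdot_def sum_distrib_left mult.commute)
    then have "(\<lambda>w. cdot w w) differentiable at w" unfolding differentiable_def by blast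
    then show ?thesis by (simp add: dir_deriv_add dir_deriv_mult r dir_deriv_eq[OF c] dir_deriv_slice_right d)
  qed
  have C: "dir_deriv (0, b) (dir_deriv (h, 0) (dir_deriv (h, 0) F)) = dir_deriv (h, 0) (dir_deriv (h, 0) (dir_deriv (0, b) F))" for h
    unfolding entire_series_commute[OF entire_series_dir_deriv[OF F], of "(0, b)"] entire_series_commute[OF F, of "(0, b)"] ..
  show "(\<Sum>i\<in>UNIV. dir_deriv (axis i 1, 0) (dir_deriv (axis i 1, 0) (dir_deriv (0, b) F)) (z, w))
     + 2 * (\<Sum>\<alpha>\<in>Rp. complex_of_real (k \<alpha>) * (dir_deriv (cvec \<alpha>, 0) (dir_deriv (0, b) F) (z, w) / cdot (cvec \<alpha>) z
         - cdot (cvec \<alpha>) (cvec \<alpha>) / 2 * ((dir_deriv (0, b) F (z, w) - dir_deriv (0, b) F (crefl_along \<alpha> z, w)) / (cdot (cvec \<alpha>) z)\<^sup>2)))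
     = cdot w w * dir_deriv (0, b) F (z, w) + (2 * cdot (snd (z, w)) b * F (z, w) + dir_deriv (0, b) S (z, w))"
    using trans[OF L[unfolded eq', symmetric] B] unfolding C entire_series_commute[OF F, of "(0, b)"]
    by (simp only: snd_conv add.assoc)
qed

definition kernel1 :: "complex^'n \<Rightarrow> (complex^'n) \<times> (complex^'n) \<Rightarrow> complex" where
  "kernel1 b = dir_deriv (0, b) kernel"

definition kernel2 :: "complex^'n \<Rightarrow> complex^'n \<Rightarrow> (complex^'n) \<times> (complex^'n) \<Rightarrow> complex" where
  "kernel2 b c = dir_deriv (0, b) (dir_deriv (0, c) kernel)"

lemma kernel1_entire_series: "entire_series (kernel1 b)"
  and kernel2_entire_series: "entire_series (kernel2 b c)"
  by (simp_all add: kernel1_def kernel2_def entire_series_dir_deriv kernel_entire_series)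

lemma kernel_radial_eq: "radial_eq kernel (\<lambda>_. 0)"
  by (simp add: radial_eq_def kernel_radial)

lemma kernel1_radial_eq: "radial_eq (kernel1 b) (\<lambda>v. cdot (fst v) b * kernel v)"
  using radial_eq_dir_deriv[OF kernel_radial_eq kernel_entire_series, of b] by (simp add: kernel1_def)

lemma cdot_fst_differentiable: "(\<lambda>v. cdot (fst v) b) differentiable at v"
  and cdot_snd_differentiable: "(\<lambda>v. cdot (snd v) b) differentiable at v"
  and dir_deriv_cdot_fst: "dir_deriv h (\<lambda>v. cdot (fst v) b) v = cdot (fst h) b"
  and dir_deriv_cdot_snd: "dir_deriv h (\<lambda>v. cdot (snd v) b) v = cdot (snd h) b"
proof -
  have 1: "bounded_linear (\<lambda>v. cdot (fst v) b)" "bounded_linear (\<lambda>v. cdot (snd v) b)"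
    by (intro bounded_linear_compose[OF bounded_linear_cdot_left] bounded_linear_fst bounded_linear_snd)+
  show "(\<lambda>v. cdot (fst v) b) differentiable at v" "(\<lambda>v. cdot (snd v) b) differentiable at v"
    "dir_deriv h (\<lambda>v. cdot (fst v) b) v = cdot (fst h) b" "dir_deriv h (\<lambda>v. cdot (snd v) b) v = cdot (snd h) b"
    by (simp_all add: 1 bounded_linear_differentiable dir_deriv_linear)
qed

lemma kernel2_radial_eq: "radial_eq (kernel2 b c) (\<lambda>v. cdot (fst v) b * kernel1 c v + cdot (fst v) c * kernel1 b v)"
  using radial_eq_dir_deriv[OF kernel1_radial_eq kernel1_entire_series, of c b]
  by (simp add: kernel1_def kernel2_def kernel_differentiable cdot_fst_differentiable dir_deriv_mult dir_deriv_cdot_fst)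

lemma kernel_laplace_eq: "laplace_eq kernel (\<lambda>_. 0)"
  unfolding laplace_eq_def using kernel_laplacian by simp

lemma kernel1_laplace_eq: "laplace_eq (kernel1 b) (\<lambda>v. 2 * cdot (snd v) b * kernel v)"
  using laplace_eq_dir_deriv[OF kernel_laplace_eq kernel_entire_series, of b] by (simp add: kernel1_def)

lemma kernel2_laplace_eq: "laplace_eq (kernel2 b c)
   (\<lambda>v. 2 * cdot (snd v) b * kernel1 c v + 2 * cdot (snd v) c * kernel1 b v + 2 * cdot b c * kernel v)"
proof -
  have d: "dir_deriv (0, b) (\<lambda>v. 2 * cdot (snd v) c * kernel v) v = 2 * cdot (snd v) c * kernel1 b v + 2 * cdot b c * kernel v" for v
    by (simp add: dir_deriv_mult dir_deriv_cmult kernel_differentiable cdot_snd_differentiable kernel1_def dir_deriv_cdot_snd)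
  have "laplace_eq (kernel2 b c) (\<lambda>v. 2 * cdot (snd v) b * kernel1 c v + dir_deriv (0, b) (\<lambda>v. 2 * cdot (snd v) c * kernel v) v)"
    using laplace_eq_dir_deriv[OF kernel1_laplace_eq kernel1_entire_series, of c b]
    by (simp add: kernel1_def kernel2_def kernel_differentiable cdot_snd_differentiable)
  then show ?thesis unfolding d by (simp add: add.assoc)
qed

end

section \<open>Positivity and growth on real space\<close>

lemma cvec_axis: "cvec (axis i 1) = axis i 1"
  by (simp add: cvec_def axis_def vec_eq_iff)

text \<open>All equations below are linear with real coefficients, so they pass to real parts.\<close>

definition rpart :: "((complex^'n) \<times> (complex^'n) \<Rightarrow> complex) \<Rightarrow> real^'n \<Rightarrow> real^'n \<Rightarrow> real" where
  "rpart F x m = Re (F (cvec x, cvec m))"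

lemma rpart_line:
  assumes "\<And>v. F differentiable at v"
  shows "((\<lambda>s. rpart F (x + s *\<^sub>R a) (m + s *\<^sub>R b)) has_real_derivative
     rpart (dir_deriv (cvec a, cvec b) F) (x + s *\<^sub>R a) (m + s *\<^sub>R b)) (at s)"
proof -
  let ?v = "(cvec (x + s *\<^sub>R a), cvec (m + s *\<^sub>R b))"
  have "((\<lambda>s. (cvec (x + s *\<^sub>R a), cvec (m + s *\<^sub>R b))) has_derivative (\<lambda>h. (cvec (h *\<^sub>R a), cvec (h *\<^sub>R b)))) (at s)"
    by (intro has_derivative_Pair bounded_linear.has_derivative[OF bounded_linear_cvec]) (auto intro!: derivative_eq_intros)
  from has_derivative_compose[OF this has_derivative_dir_deriv[OF assms]]
  have "((\<lambda>s. F (cvec (x + s *\<^sub>R a), cvec (m + s *\<^sub>R b))) has_derivative (\<lambda>h. dir_deriv (h *\<^sub>R (cvec a, cvec b)) F ?v)) (at s)"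
    by (simp add: cvec_scaleR scaleR_scaleC)
  moreover have "dir_deriv (h *\<^sub>R (cvec a, cvec b)) F ?v = h *\<^sub>R dir_deriv (cvec a, cvec b) F ?v" for h
  proof -
    interpret bounded_linear "\<lambda>h. dir_deriv h F ?v"
      using has_derivative_dir_deriv[OF assms] by (rule has_derivative_bounded_linear)
    show ?thesis by (rule scaleR)
  qed
  ultimately have "((\<lambda>s. F (cvec (x + s *\<^sub>R a), cvec (m + s *\<^sub>R b))) has_derivative (\<lambda>h. h *\<^sub>R dir_deriv (cvec a, cvec b) F ?v)) (at s)"
    by simp
  from bounded_linear.has_derivative[OF bounded_linear_Re this]
  show ?thesis unfolding has_field_derivative_def rpart_def by (simp add: mult_commute_abs)
qed

lemma rpart_x_line:
  assumes "\<And>v. F differentiable at v"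
  shows "((\<lambda>s. rpart F (x + s *\<^sub>R a) m) has_real_derivative rpart (dir_deriv (cvec a, 0) F) (x + s *\<^sub>R a) m) (at s)"
  using rpart_line[OF assms, of x a m 0 s] by simp

lemma rpart_m_line:
  assumes "\<And>v. F differentiable at v"
  shows "((\<lambda>s. rpart F x (m + s *\<^sub>R b)) has_real_derivative rpart (dir_deriv (0, cvec b) F) x (m + s *\<^sub>R b)) (at s)"
  using rpart_line[OF assms, of x 0 m b s] by simp

lemma partial_deriv_x:
  assumes "\<And>v. F differentiable at v"
  shows "partial_deriv i (\<lambda>x. rpart F x m) x = rpart (dir_deriv (axis i 1, 0) F) x m"
  unfolding partial_deriv_def using DERIV_imp_deriv[OF rpart_x_line[OF assms, of x "axis i 1" m 0]]
  by (simp add: cvec_axis)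

lemma partial_deriv_m:
  assumes "\<And>v. F differentiable at v"
  shows "partial_deriv i (\<lambda>m. rpart F x m) m = rpart (dir_deriv (0, axis i 1) F) x m"
  unfolding partial_deriv_def using DERIV_imp_deriv[OF rpart_m_line[OF assms, of x m "axis i 1" 0]]
  by (simp add: cvec_axis)

lemma isCont_rpart:
  assumes "entire_series F"
  shows "isCont (\<lambda>v. rpart F (fst v) (snd v)) v"
proof -
  have "bounded_linear (\<lambda>v. (cvec (fst v), cvec (snd v)))"
    by (intro bounded_linear_Pair bounded_linear_compose[OF bounded_linear_cvec] bounded_linear_fst bounded_linear_snd)
  then have "isCont (\<lambda>v. (cvec (fst v), cvec (snd v))) v" by (rule linear_continuous_at)
  from isCont_o2[OF this entire_series_isCont[OF assms]] show ?thesis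
    unfolding rpart_def by (rule isCont_o2[OF _ linear_continuous_at[OF bounded_linear_Re]])
qed

lemma continuous_on_rpart [continuous_intros]:
  assumes "entire_series F" "continuous_on S f" "continuous_on S g"
  shows "continuous_on S (\<lambda>y. rpart F (f y) (g y))"
  using continuous_on_compose2[OF continuous_at_imp_continuous_on[of UNIV "\<lambda>v. rpart F (fst v) (snd v)"]
      continuous_on_Pair[OF assms(2,3)]] isCont_rpart[OF assms(1)] by simp

lemma radial_norm_derivative:
  assumes "x \<noteq> (0::real^'n)"
  shows "((\<lambda>t. norm (t *\<^sub>R x)) has_real_derivative norm x) (at 1)"
proof (rule has_field_derivative_transform_within_open[of "\<lambda>t. t * norm x" _ _ "{0<..}"])
  show "((\<lambda>t. t * norm x) has_real_derivative norm x) (at 1)" by (auto intro!: derivative_eq_intros)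
qed auto

context dunkl_setup
begin

text \<open>At a negative minimum of \<open>g x exp (- C \<bar>x\<bar>)\<close> over a ball the reflection terms are nonpositive, since the
mirror image lies in the ball as well. With \<open>C > \<bar>m\<bar>\<close> the weighted function then strictly increases
in the radial direction, so it is smaller slightly inside.\<close>

lemma comparison_principle:
  fixes g g' :: "real^'n \<Rightarrow> real"
  assumes cont: "continuous_on UNIV g" and zero: "0 \<le> g 0"
    and der: "\<And>x. x \<noteq> 0 \<Longrightarrow> ((\<lambda>t. g (t *\<^sub>R x)) has_real_derivative g' x) (at 1)"
    and super: "\<And>x. x \<noteq> 0 \<Longrightarrow> (x \<bullet> m) * g x \<le> g' x + (\<Sum>\<alpha>\<in>Rp. k \<alpha> * (g x - g (refl_along \<alpha> x)))"
  shows "0 \<le> g x"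
proof (rule ccontr)
  assume neg: "\<not> 0 \<le> g x"
  define C where "C = norm m + 1"
  define \<Phi> where "\<Phi> = (\<lambda>x. g x * exp (- C * norm x))"
  have "continuous_on (cball 0 (norm x)) \<Phi>"
    unfolding \<Phi>_def by (intro continuous_intros continuous_on_subset[OF cont]) auto
  then obtain z where z: "z \<in> cball 0 (norm x)" and min: "\<And>y. y \<in> cball 0 (norm x) \<Longrightarrow> \<Phi> z \<le> \<Phi> y"
    using continuous_attains_inf[OF compact_cball, of 0 "norm x" \<Phi>] by auto
  have "\<Phi> x < 0" using neg by (simp add: \<Phi>_def mult_less_0_iff)
  with min[of x] have "\<Phi> z < 0" by simp
  then have gz: "g z < 0" by (simp add: \<Phi>_def mult_less_0_iff)
  then have z0: "z \<noteq> 0" using zero by auto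
  have "k \<alpha> * (g z - g (refl_along \<alpha> z)) \<le> 0" if "\<alpha> \<in> Rp" for \<alpha>
  proof -
    have "\<Phi> z \<le> \<Phi> (refl_along \<alpha> z)" using z by (intro min) (simp add: norm_refl_along Rp_nonzero[OF that])
    then show ?thesis
      using k_nonneg'[OF that] by (simp add: \<Phi>_def norm_refl_along Rp_nonzero[OF that] mult_nonneg_nonpos)
  qed
  then have "(\<Sum>\<alpha>\<in>Rp. k \<alpha> * (g z - g (refl_along \<alpha> z))) \<le> 0" by (rule sum_nonpos)
  with super[OF z0] have "(z \<bullet> m) * g z \<le> g' z" by linarith
  moreover have "0 < (z \<bullet> m - C * norm z) * g z"
  proof -
    have "norm z * norm m < C * norm z" using z0 by (simp add: C_def algebra_simps)
    then have "z \<bullet> m - C * norm z < 0" using norm_cauchy_schwarz[of z m] by linarith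
    then show ?thesis using gz by (rule mult_neg_neg)
  qed
  ultimately have pos: "0 < g' z - C * norm z * g z" by (simp add: algebra_simps)
  have "((\<lambda>t. \<Phi> (t *\<^sub>R z)) has_real_derivative (g' z - C * norm z * g z) * exp (- C * norm z)) (at 1)"
    unfolding \<Phi>_def
    by (rule derivative_eq_intros der[OF z0] radial_norm_derivative[OF z0] refl)+ (simp add: algebra_simps)
  moreover have "0 < (g' z - C * norm z * g z) * exp (- C * norm z)" using pos by simp
  ultimately obtain \<delta> where \<delta>: "\<delta> > 0" "\<And>h. h > 0 \<Longrightarrow> h < \<delta> \<Longrightarrow> \<Phi> ((1 - h) *\<^sub>R z) < \<Phi> (1 *\<^sub>R z)"
    using DERIV_pos_inc_left by blast
  define h where "h = min (\<delta> / 2) (1 / 2)"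
  have h: "h > 0" "h < \<delta>" "h < 1" using \<delta>(1) by (auto simp: h_def)
  have "(1 - h) *\<^sub>R z \<in> cball 0 (norm x)"
    using z h mult_left_le_one_le[of "norm z" "1 - h"] by auto
  then have "\<Phi> z \<le> \<Phi> ((1 - h) *\<^sub>R z)" by (rule min)
  with \<delta>(2)[OF h(1,2)] show False by simp
qed

abbreviation K where "K \<equiv> rpart kernel"
abbreviation K1 where "K1 b \<equiv> rpart (kernel1 (cvec b))"
abbreviation K2 where "K2 b c \<equiv> rpart (kernel2 (cvec b) (cvec c))"

lemma dunkl_kernel_eq: "dunkl_kernel Rp k = K"
  by (auto simp: fun_eq_iff dunkl_kernel_def dunkl_kernel_complex_eq rpart_def)

lemmas kernels_differentiable =
  kernel_differentiable entire_series_differentiable[OF kernel1_entire_series] entire_series_differentiable[OF kernel2_entire_series]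

lemma moment1_eq: "moment1 Rp k m j x = K1 (axis j 1) x m / K x m"
  unfolding moment1_def dunkl_kernel_eq partial_deriv_m[OF kernel_differentiable] kernel1_def cvec_axis ..

lemma moment2_eq: "moment2 Rp k m j l x = K2 (axis j 1) (axis l 1) x m / K x m"
proof -
  have "partial_deriv l (K x) = rpart (kernel1 (axis l 1)) x"
    by (rule ext) (use partial_deriv_m[OF kernel_differentiable, of l x] in \<open>simp add: kernel1_def\<close>)
  moreover have "partial_deriv j (rpart (kernel1 (axis l 1)) x) m = rpart (kernel2 (axis j 1) (axis l 1)) x m"
    using partial_deriv_m[OF kernels_differentiable(2), of j "axis l 1" x m] by (simp add: kernel1_def kernel2_def)
  ultimately show ?thesis unfolding moment2_def dunkl_kernel_eq by (simp add: cvec_axis)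
qed

lemma radial_eq_real:
  assumes "radial_eq F S"
  shows "rpart (dir_deriv (cvec x, 0) F) x m = (x \<bullet> m) * rpart F x m + rpart S x m
    - (\<Sum>\<alpha>\<in>Rp. k \<alpha> * (rpart F x m - rpart F (refl_along \<alpha> x) m))"
proof -
  have "dir_deriv (cvec x, 0) F (cvec x, cvec m)
      + (\<Sum>\<alpha>\<in>Rp. complex_of_real (k \<alpha>) * (F (cvec x, cvec m) - F (cvec (refl_along \<alpha> x), cvec m)))
     = complex_of_real (x \<bullet> m) * F (cvec x, cvec m) + S (cvec x, cvec m)"
    using assms unfolding radial_eq_def by (simp flip: crefl_along_cvec cdot_cvec)
  from arg_cong[OF this, of Re] show ?thesis by (simp add: rpart_def)
qed

lemma rpart_radial_derivative:
  assumes "\<And>v. F differentiable at v"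
  shows "((\<lambda>t. rpart F (t *\<^sub>R x) m) has_real_derivative rpart (dir_deriv (cvec x, 0) F) x m) (at 1)"
  using rpart_x_line[OF assms, of 0 x m 1] by simp

lemma DK: "rpart (dir_deriv (cvec x, 0) kernel) x m = (x \<bullet> m) * K x m
    - (\<Sum>\<alpha>\<in>Rp. k \<alpha> * (K x m - K (refl_along \<alpha> x) m))"
  using radial_eq_real[OF kernel_radial_eq, where x = x and m = m] by (simp add: rpart_def)

lemma DK1: "rpart (dir_deriv (cvec x, 0) (kernel1 (cvec b))) x m = (x \<bullet> m) * K1 b x m + (x \<bullet> b) * K x m
    - (\<Sum>\<alpha>\<in>Rp. k \<alpha> * (K1 b x m - K1 b (refl_along \<alpha> x) m))"
  using radial_eq_real[OF kernel1_radial_eq, where x = x and m = m] by (simp add: rpart_def cdot_cvec)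

lemma DK2: "rpart (dir_deriv (cvec x, 0) (kernel2 (cvec b) (cvec c))) x m
    = (x \<bullet> m) * K2 b c x m + ((x \<bullet> b) * K1 c x m + (x \<bullet> c) * K1 b x m)
    - (\<Sum>\<alpha>\<in>Rp. k \<alpha> * (K2 b c x m - K2 b c (refl_along \<alpha> x) m))"
  using radial_eq_real[OF kernel2_radial_eq, where x = x and m = m] by (simp add: rpart_def cdot_cvec)

lemma K_zero: "K 0 m = 1" by (simp add: rpart_def kernel_zero)

lemma kernel1_zero: "kernel1 b (0, w) = 0"
  unfolding kernel1_def using dir_deriv_slice_right[OF kernel_differentiable, of b 0 w] by (simp add: kernel_zero)

lemma kernel2_zero: "kernel2 b c (0, w) = 0"
  using dir_deriv_slice_right[OF kernels_differentiable(2), of b c 0 w]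
  by (simp add: kernel1_zero) (simp add: kernel1_def kernel2_def)

lemma K1_zero: "K1 b 0 m = 0" and K2_zero: "K2 b c 0 m = 0"
  by (simp_all add: rpart_def kernel1_zero kernel2_zero)

lemma continuous_on_K: "continuous_on A (\<lambda>x. K x m)" "continuous_on A (\<lambda>x. K1 b x m)" "continuous_on A (\<lambda>x. K2 b c x m)"
  by (intro continuous_intros kernel_entire_series kernel1_entire_series kernel2_entire_series)+

text \<open>The radial function \<open>exp (- \<bar>x\<bar> \<bar>m\<bar>)\<close> is a subsolution, because \<open>- \<bar>x\<bar> \<bar>m\<bar> \<le> x \<bullet> m\<close>; reflections do not see it.\<close>

lemma K_lower: "exp (- (norm x * norm m)) \<le> K x m"
proof -
  have "0 \<le> K x m - exp (- (norm x * norm m))"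
  proof (rule comparison_principle[where m = m and g = "\<lambda>x. K x m - exp (- (norm x * norm m))" and
        g' = "\<lambda>x. rpart (dir_deriv (cvec x, 0) kernel) x m + norm x * norm m * exp (- (norm x * norm m))"])
    show "continuous_on UNIV (\<lambda>x. K x m - exp (- (norm x * norm m)))"
      by (intro continuous_intros continuous_on_K)
    show "((\<lambda>t. K (t *\<^sub>R x) m - exp (- (norm (t *\<^sub>R x) * norm m))) has_real_derivative
       rpart (dir_deriv (cvec x, 0) kernel) x m + norm x * norm m * exp (- (norm x * norm m))) (at 1)" if "x \<noteq> 0" for x
      by (rule derivative_eq_intros rpart_radial_derivative kernel_differentiable radial_norm_derivative that refl)+ simp
    fix x :: "real^'n"
    have "0 \<le> (norm x * norm m + x \<bullet> m) * exp (- (norm x * norm m))"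
      using Cauchy_Schwarz_ineq2[of x m] by (intro mult_nonneg_nonneg) auto
    then show "(x \<bullet> m) * (K x m - exp (- (norm x * norm m))) \<le>
       rpart (dir_deriv (cvec x, 0) kernel) x m + norm x * norm m * exp (- (norm x * norm m)) +
       (\<Sum>\<alpha>\<in>Rp. k \<alpha> * (K x m - exp (- (norm x * norm m)) - (K (refl_along \<alpha> x) m - exp (- (norm (refl_along \<alpha> x) * norm m)))))"
      unfolding DK by (simp add: norm_refl_along Rp_nonzero algebra_simps cong: sum.cong)
  qed (simp add: K_zero)
  then show ?thesis by simp
qed

lemma K_pos: "0 < K x m"
  using K_lower[of x m] exp_gt_zero[of "- (norm x * norm m)"] by linarith

lemma K_nonzero: "K x m \<noteq> 0"
  using K_pos[of x m] by simp

lemma K_upper: "K x m \<le> exp (norm x * norm m)"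
proof -
  have "0 \<le> exp (norm x * norm m) - K x m"
  proof (rule comparison_principle[where m = m and g = "\<lambda>x. exp (norm x * norm m) - K x m" and
        g' = "\<lambda>x. norm x * norm m * exp (norm x * norm m) - rpart (dir_deriv (cvec x, 0) kernel) x m"])
    show "continuous_on UNIV (\<lambda>x. exp (norm x * norm m) - K x m)"
      by (intro continuous_intros continuous_on_K)
    show "((\<lambda>t. exp (norm (t *\<^sub>R x) * norm m) - K (t *\<^sub>R x) m) has_real_derivative
       norm x * norm m * exp (norm x * norm m) - rpart (dir_deriv (cvec x, 0) kernel) x m) (at 1)" if "x \<noteq> 0" for x
      by (rule derivative_eq_intros rpart_radial_derivative kernel_differentiable radial_norm_derivative that refl)+ simp
    fix x :: "real^'n"
    have "0 \<le> (norm x * norm m - x \<bullet> m) * exp (norm x * norm m)"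
      using Cauchy_Schwarz_ineq2[of x m] by (intro mult_nonneg_nonneg) auto
    then show "(x \<bullet> m) * (exp (norm x * norm m) - K x m) \<le>
       norm x * norm m * exp (norm x * norm m) - rpart (dir_deriv (cvec x, 0) kernel) x m +
       (\<Sum>\<alpha>\<in>Rp. k \<alpha> * (exp (norm x * norm m) - K x m - (exp (norm (refl_along \<alpha> x) * norm m) - K (refl_along \<alpha> x) m)))"
      unfolding DK by (simp add: norm_refl_along Rp_nonzero algebra_simps sum.distrib sum_subtractf cong: sum.cong)
  qed (simp add: K_zero)
  then show ?thesis by simp
qed

lemma K1_minus: "K1 (- b) x m = - K1 b x m" and K2_minus: "K2 (- b) c x m = - K2 b c x m"
  using dir_deriv_minus_direction[OF kernel_differentiable, of "(0, cvec b)"]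
    dir_deriv_minus_direction[OF kernels_differentiable(2), of "(0, cvec b)"]
  by (simp_all add: rpart_def kernel1_def kernel2_def cvec_minus)

text \<open>Comparison with \<open>\<bar>b\<bar> \<bar>x\<bar> K\<close>: its radial derivative produces the source \<open>\<bar>b\<bar> \<bar>x\<bar> K\<close>, which dominates the
source \<open>(x \<bullet> b) K\<close> of \<open>K1 b\<close>.\<close>

lemma K1_bound: "\<bar>K1 b x m\<bar> \<le> norm b * norm x * K x m"
proof -
  have "K1 b x m \<le> norm b * norm x * K x m" for b
  proof -
    have "0 \<le> norm b * norm x * K x m - K1 b x m"
    proof (rule comparison_principle[where m = m and g = "\<lambda>x. norm b * norm x * K x m - K1 b x m" and
          g' = "\<lambda>x. norm b * norm x * rpart (dir_deriv (cvec x, 0) kernel) x m + norm b * norm x * K x m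
              - rpart (dir_deriv (cvec x, 0) (kernel1 (cvec b))) x m"])
      show "continuous_on UNIV (\<lambda>x. norm b * norm x * K x m - K1 b x m)"
        by (intro continuous_intros continuous_on_K)
      show "((\<lambda>t. norm b * norm (t *\<^sub>R x) * K (t *\<^sub>R x) m - K1 b (t *\<^sub>R x) m) has_real_derivative
          norm b * norm x * rpart (dir_deriv (cvec x, 0) kernel) x m + norm b * norm x * K x m
              - rpart (dir_deriv (cvec x, 0) (kernel1 (cvec b))) x m) (at 1)" if "x \<noteq> 0" for x
        by (rule derivative_eq_intros rpart_radial_derivative kernels_differentiable radial_norm_derivative that refl)+ simp
      fix x :: "real^'n"
      have "0 \<le> (norm b * norm x - x \<bullet> b) * K x m"
        using Cauchy_Schwarz_ineq2[of x b] K_pos[of x m] by (intro mult_nonneg_nonneg) (auto simp: mult.commute)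
      then show "(x \<bullet> m) * (norm b * norm x * K x m - K1 b x m) \<le>
         norm b * norm x * rpart (dir_deriv (cvec x, 0) kernel) x m + norm b * norm x * K x m
              - rpart (dir_deriv (cvec x, 0) (kernel1 (cvec b))) x m +
         (\<Sum>\<alpha>\<in>Rp. k \<alpha> * (norm b * norm x * K x m - K1 b x m - (norm b * norm (refl_along \<alpha> x) * K (refl_along \<alpha> x) m - K1 b (refl_along \<alpha> x) m)))"
        unfolding DK DK1
        by (simp add: norm_refl_along Rp_nonzero algebra_simps sum.distrib sum_subtractf sum_distrib_left cong: sum.cong)
    qed (simp add: K1_zero)
    then show ?thesis by simp
  qed
  from this[of b] this[of "- b"] show ?thesis by (simp add: K1_minus)
qed

text \<open>Likewise with \<open>\<bar>b\<bar> \<bar>c\<bar> \<bar>x\<bar>\<^sup>2 K\<close>, using the bound on first derivatives for the source.\<close>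

lemma K2_bound: "\<bar>K2 b c x m\<bar> \<le> norm b * norm c * (norm x)\<^sup>2 * K x m"
proof -
  have "K2 b c x m \<le> norm b * norm c * (norm x)\<^sup>2 * K x m" for b
  proof -
    define B where "B = norm b * norm c"
    have "0 \<le> B * (norm x)\<^sup>2 * K x m - K2 b c x m"
    proof (rule comparison_principle[where m = m and g = "\<lambda>x. B * (norm x)\<^sup>2 * K x m - K2 b c x m" and
          g' = "\<lambda>x. B * (norm x)\<^sup>2 * rpart (dir_deriv (cvec x, 0) kernel) x m + 2 * B * (norm x)\<^sup>2 * K x m
              - rpart (dir_deriv (cvec x, 0) (kernel2 (cvec b) (cvec c))) x m"])
      show "continuous_on UNIV (\<lambda>x. B * (norm x)\<^sup>2 * K x m - K2 b c x m)"
        by (intro continuous_intros continuous_on_K)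
      show "((\<lambda>t. B * (norm (t *\<^sub>R x))\<^sup>2 * K (t *\<^sub>R x) m - K2 b c (t *\<^sub>R x) m) has_real_derivative
          B * (norm x)\<^sup>2 * rpart (dir_deriv (cvec x, 0) kernel) x m + 2 * B * (norm x)\<^sup>2 * K x m
              - rpart (dir_deriv (cvec x, 0) (kernel2 (cvec b) (cvec c))) x m) (at 1)" if "x \<noteq> 0" for x
        by (rule derivative_eq_intros rpart_radial_derivative kernels_differentiable radial_norm_derivative that refl)+
          (simp add: power2_eq_square)
      fix x :: "real^'n"
      have "(x \<bullet> b) * K1 c x m \<le> (norm x * norm b) * (norm c * norm x * K x m)"
        using mult_mono[OF Cauchy_Schwarz_ineq2[of x b] K1_bound[of c x m]] abs_ge_self[of "(x \<bullet> b) * K1 c x m"]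
        by (simp add: abs_mult)
      moreover have "(x \<bullet> c) * K1 b x m \<le> (norm x * norm c) * (norm b * norm x * K x m)"
        using mult_mono[OF Cauchy_Schwarz_ineq2[of x c] K1_bound[of b x m]] abs_ge_self[of "(x \<bullet> c) * K1 b x m"]
        by (simp add: abs_mult)
      ultimately have "0 \<le> 2 * B * (norm x)\<^sup>2 * K x m - ((x \<bullet> b) * K1 c x m + (x \<bullet> c) * K1 b x m)"
        by (simp add: B_def power2_eq_square algebra_simps)
      then show "(x \<bullet> m) * (B * (norm x)\<^sup>2 * K x m - K2 b c x m) \<le>
         B * (norm x)\<^sup>2 * rpart (dir_deriv (cvec x, 0) kernel) x m + 2 * B * (norm x)\<^sup>2 * K x m
              - rpart (dir_deriv (cvec x, 0) (kernel2 (cvec b) (cvec c))) x m +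
         (\<Sum>\<alpha>\<in>Rp. k \<alpha> * (B * (norm x)\<^sup>2 * K x m - K2 b c x m - (B * (norm (refl_along \<alpha> x))\<^sup>2 * K (refl_along \<alpha> x) m - K2 b c (refl_along \<alpha> x) m)))"
        unfolding DK DK2
        by (simp add: norm_refl_along Rp_nonzero algebra_simps sum.distrib sum_subtractf sum_distrib_left cong: sum.cong)
    qed (simp add: K2_zero)
    then show ?thesis by (simp add: B_def)
  qed
  from this[of b] this[of "- b"] show ?thesis by (simp add: K2_minus)
qed

text \<open>Log-convexity of the kernel in the spectral variable. The sources of both sides cancel, and each
reflection term contributes a square to the difference.\<close>

lemma K2_log_convex: "(K1 b x m)\<^sup>2 / K x m \<le> K2 b b x m"
proof -
  have "0 \<le> K2 b b x m - (K1 b x m)\<^sup>2 / K x m"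
  proof (rule comparison_principle[where m = m and g = "\<lambda>x. K2 b b x m - (K1 b x m)\<^sup>2 / K x m" and
        g' = "\<lambda>x. rpart (dir_deriv (cvec x, 0) (kernel2 (cvec b) (cvec b))) x m
            - 2 * (K1 b x m / K x m) * rpart (dir_deriv (cvec x, 0) (kernel1 (cvec b))) x m
            + (K1 b x m / K x m)\<^sup>2 * rpart (dir_deriv (cvec x, 0) kernel) x m"])
    show "continuous_on UNIV (\<lambda>x. K2 b b x m - (K1 b x m)\<^sup>2 / K x m)"
      by (intro continuous_intros continuous_on_K) (simp add: K_nonzero)
    show "((\<lambda>t. K2 b b (t *\<^sub>R x) m - (K1 b (t *\<^sub>R x) m)\<^sup>2 / K (t *\<^sub>R x) m) has_real_derivative
        rpart (dir_deriv (cvec x, 0) (kernel2 (cvec b) (cvec b))) x m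
            - 2 * (K1 b x m / K x m) * rpart (dir_deriv (cvec x, 0) (kernel1 (cvec b))) x m
            + (K1 b x m / K x m)\<^sup>2 * rpart (dir_deriv (cvec x, 0) kernel) x m) (at 1)" if "x \<noteq> 0" for x
      using K_pos[of x m]
      by (auto intro!: derivative_eq_intros rpart_radial_derivative kernels_differentiable simp: field_simps power2_eq_square)
    fix x :: "real^'n"
    define r where "r = K1 b x m / K x m"
    have r: "K1 b x m = r * K x m" using K_pos[of x m] by (simp add: r_def)
    \<comment> \<open>with \<open>p\<close> and \<open>q\<close> the values of the kernel and its derivative at the mirror image, the contribution is \<open>k \<alpha> * (r * p - q)\<^sup>2 / p\<close>\<close>
    have pt: "0 \<le> k \<alpha> * (K2 b b x m - (K1 b x m)\<^sup>2 / K x m - (K2 b b (refl_along \<alpha> x) m - (K1 b (refl_along \<alpha> x) m)\<^sup>2 / K (refl_along \<alpha> x) m))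
       - (k \<alpha> * (K2 b b x m - K2 b b (refl_along \<alpha> x) m) - 2 * r * (k \<alpha> * (K1 b x m - K1 b (refl_along \<alpha> x) m))
          + r\<^sup>2 * (k \<alpha> * (K x m - K (refl_along \<alpha> x) m)))" if "\<alpha> \<in> Rp" for \<alpha>
    proof -
      define p where "p = K (refl_along \<alpha> x) m"
      define q where "q = K1 b (refl_along \<alpha> x) m"
      have "p > 0" unfolding p_def by (rule K_pos)
      have "0 \<le> k \<alpha> * ((r * p - q)\<^sup>2 / p)" using k_nonneg'[OF that] \<open>p > 0\<close> by simp
      also have "(r * p - q)\<^sup>2 / p = r\<^sup>2 * p - 2 * r * q + q\<^sup>2 / p"
        using \<open>p > 0\<close> by (simp add: power2_eq_square field_simps)
      finally show ?thesis
        unfolding p_def[symmetric] q_def[symmetric] r using K_pos[of x m]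
        by (simp add: power2_eq_square algebra_simps)
    qed
    have "0 \<le> (\<Sum>\<alpha>\<in>Rp. k \<alpha> * (K2 b b x m - (K1 b x m)\<^sup>2 / K x m - (K2 b b (refl_along \<alpha> x) m - (K1 b (refl_along \<alpha> x) m)\<^sup>2 / K (refl_along \<alpha> x) m)))
       - ((\<Sum>\<alpha>\<in>Rp. k \<alpha> * (K2 b b x m - K2 b b (refl_along \<alpha> x) m))
          - 2 * r * (\<Sum>\<alpha>\<in>Rp. k \<alpha> * (K1 b x m - K1 b (refl_along \<alpha> x) m))
          + r\<^sup>2 * (\<Sum>\<alpha>\<in>Rp. k \<alpha> * (K x m - K (refl_along \<alpha> x) m)))"
      using sum_nonneg[OF pt, of Rp "\<lambda>x. x"]
      by (simp only: sum_subtractf sum.distrib sum_distrib_left)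
    moreover have "(K1 b x m)\<^sup>2 / K x m = r\<^sup>2 * K x m" using K_pos[of x m] by (simp add: r power2_eq_square)
    ultimately show "(x \<bullet> m) * (K2 b b x m - (K1 b x m)\<^sup>2 / K x m)
      \<le> rpart (dir_deriv (cvec x, 0) (kernel2 (cvec b) (cvec b))) x m
            - 2 * (K1 b x m / K x m) * rpart (dir_deriv (cvec x, 0) (kernel1 (cvec b))) x m
            + (K1 b x m / K x m)\<^sup>2 * rpart (dir_deriv (cvec x, 0) kernel) x m
        + (\<Sum>\<alpha>\<in>Rp. k \<alpha> * (K2 b b x m - (K1 b x m)\<^sup>2 / K x m - (K2 b b (refl_along \<alpha> x) m - (K1 b (refl_along \<alpha> x) m)\<^sup>2 / K (refl_along \<alpha> x) m)))"
      unfolding DK DK1 DK2 r_def[symmetric] by (simp add: r algebra_simps power2_eq_square)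
  qed (simp add: K1_zero K2_zero)
  then show ?thesis by simp
qed

lemma K2_nonneg: "0 \<le> K2 b b x m"
  using K2_log_convex[of b x m] K_pos[of x m] by (meson divide_nonneg_pos order_trans zero_le_power2)

end

section \<open>The generator with drift\<close>

text \<open>Cauchy's mean value theorem for \<open>2 r f'(r) - f(r) + f(-r)\<close> against \<open>2 r\<^sup>2\<close>, followed by the ordinary mean
value theorem for \<open>f'\<close>.\<close>

lemma symmetric_difference_mvt_pos:
  fixes f f1 f2 :: "real \<Rightarrow> real"
  assumes d1: "\<And>r. (f has_real_derivative f1 r) (at r)" and d2: "\<And>r. (f1 has_real_derivative f2 r) (at r)"
    and s: "s > 0"
  shows "\<exists>c d. \<bar>c\<bar> \<le> s \<and> \<bar>d\<bar> \<le> s \<and> f1 s / s - (f s - f (- s)) / (2 * s\<^sup>2) = (f2 c + f2 d) / 2"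
proof -
  define N where "N = (\<lambda>r. 2 * r * f1 r - f r + f (- r))"
  have dm: "((\<lambda>r. f (- r)) has_real_derivative - f1 (- r)) (at r)" for r
    by (rule DERIV_mirror[THEN iffD1, OF d1])
  have dN: "(N has_real_derivative f1 r - f1 (- r) + 2 * r * f2 r) (at r)" for r
    unfolding N_def by (rule derivative_eq_intros dm d1 d2 refl)+ (simp add: algebra_simps)
  have dq: "((\<lambda>r. 2 * r\<^sup>2) has_real_derivative 4 * r) (at r)" for r :: real
    by (auto intro!: derivative_eq_intros)
  have "\<exists>c>0. c < s \<and> (N s - N 0) * (4 * c) = (2 * s\<^sup>2 - 2 * 0\<^sup>2) * (f1 c - f1 (- c) + 2 * c * f2 c)"
    by (rule GMVT'[OF s, of N "\<lambda>r. 2 * r\<^sup>2" "\<lambda>r. 4 * r" "\<lambda>r. f1 r - f1 (- r) + 2 * r * f2 r"])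
      (use dN dq DERIV_isCont in blast)+
  then obtain c where c: "0 < c" "c < s" "N s * (4 * c) = 2 * s\<^sup>2 * (f1 c - f1 (- c) + 2 * c * f2 c)"
    by (auto simp: N_def)
  obtain d where d: "- c < d" "d < c" "f1 c - f1 (- c) = (c - (- c)) * f2 d"
    using MVT2[of "- c" c f1 f2] c(1) d2 by auto
  have "N s * (4 * c) = 2 * s\<^sup>2 * (2 * c * f2 d + 2 * c * f2 c)" using c(3) d(3) by simp
  then have "c * (N s) = c * (s\<^sup>2 * (f2 c + f2 d))" by (simp add: algebra_simps)
  then have "N s = s\<^sup>2 * (f2 c + f2 d)" using c(1) by simp
  moreover have "f1 s / s - (f s - f (- s)) / (2 * s\<^sup>2) = N s / (2 * s\<^sup>2)"
    using s by (simp add: N_def field_simps power2_eq_square)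
  ultimately have "f1 s / s - (f s - f (- s)) / (2 * s\<^sup>2) = (f2 c + f2 d) / 2" using s by simp
  then show ?thesis using c d by (intro exI[of _ c] exI[of _ d]) auto
qed

lemma symmetric_difference_mvt:
  fixes f f1 f2 :: "real \<Rightarrow> real"
  assumes d1: "\<And>r. (f has_real_derivative f1 r) (at r)" and d2: "\<And>r. (f1 has_real_derivative f2 r) (at r)"
    and s: "s \<noteq> 0"
  shows "\<exists>c d. \<bar>c\<bar> \<le> \<bar>s\<bar> \<and> \<bar>d\<bar> \<le> \<bar>s\<bar> \<and> f1 s / s - (f s - f (- s)) / (2 * s\<^sup>2) = (f2 c + f2 d) / 2"
proof (cases "s > 0")
  case True
  then show ?thesis using symmetric_difference_mvt_pos[OF d1 d2 True] by simp
next
  case False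
  then have s': "- s > 0" using s by simp
  have d1': "((\<lambda>r. f (- r)) has_real_derivative - f1 (- r)) (at r)" for r
    by (rule DERIV_mirror[THEN iffD1, OF d1])
  have d2': "((\<lambda>r. - f1 (- r)) has_real_derivative f2 (- r)) (at r)" for r
    using DERIV_minus[OF DERIV_mirror[THEN iffD1, OF d2[of "- r"]]] by simp
  obtain c d where cd: "\<bar>c\<bar> \<le> - s" "\<bar>d\<bar> \<le> - s"
    "- f1 (- (- s)) / (- s) - (f (- (- s)) - f (- s)) * 1 / (2 * (- s)\<^sup>2) = (f2 (- c) + f2 (- d)) / 2 \<or>
     - f1 (- (- s)) / (- s) - (f (- (- s)) - f (- (- (- s)))) / (2 * (- s)\<^sup>2) = (f2 (- c) + f2 (- d)) / 2"
    using symmetric_difference_mvt_pos[OF d1' d2' s'] by auto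
  then show ?thesis using s' by (intro exI[of _ "- c"] exI[of _ "- d"]) auto
qed

text \<open>The contribution of one root to the Dunkl Laplacian. The two singular quotients cancel to leading
order, and on the hyperplane the limit is a second derivative.\<close>

definition root_delta :: "real^'n \<Rightarrow> ((complex^'n) \<times> (complex^'n) \<Rightarrow> complex) \<Rightarrow> real^'n \<Rightarrow> real^'n \<Rightarrow> real" where
  "root_delta \<alpha> F m y = (if \<alpha> \<bullet> y \<noteq> 0
     then rpart (dir_deriv (cvec \<alpha>, 0) F) y m / (\<alpha> \<bullet> y)
        - (norm \<alpha>)\<^sup>2 / 2 * ((rpart F y m - rpart F (refl_along \<alpha> y) m) / (\<alpha> \<bullet> y)\<^sup>2)
     else rpart (dir_deriv (cvec \<alpha>, 0) (dir_deriv (cvec \<alpha>, 0) F)) y m / (norm \<alpha>)\<^sup>2)"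

lemma isCont_rpart_x: "entire_series F \<Longrightarrow> isCont (\<lambda>x. rpart F x m) x"
  using continuous_on_rpart[of F UNIV "\<lambda>x. x" "\<lambda>_. m"] by (simp add: continuous_on_eq_continuous_at)

text \<open>The symmetric difference formula on the line through \<open>y\<close> in the direction of the root. By Pythagoras
the points of the segment between \<open>y\<close> and its mirror image are not farther from \<open>x\<close> than \<open>y\<close>.\<close>

lemma root_delta_mean:
  assumes F: "entire_series F" and \<alpha>: "\<alpha> \<noteq> 0" and y: "\<alpha> \<bullet> y \<noteq> 0" and x: "\<alpha> \<bullet> x = 0"
  shows "\<exists>p q. norm (p - x) \<le> norm (y - x) \<and> norm (q - x) \<le> norm (y - x) \<and>
    root_delta \<alpha> F m y = (rpart (dir_deriv (cvec \<alpha>, 0) (dir_deriv (cvec \<alpha>, 0) F)) p m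
      + rpart (dir_deriv (cvec \<alpha>, 0) (dir_deriv (cvec \<alpha>, 0) F)) q m) / (2 * (norm \<alpha>)\<^sup>2)"
proof -
  define s where "s = (\<alpha> \<bullet> y) / (\<alpha> \<bullet> \<alpha>)"
  define y0 where "y0 = y - s *\<^sub>R \<alpha>"
  have aa: "\<alpha> \<bullet> \<alpha> > 0" using \<alpha> by simp
  have s: "s \<noteq> 0" using y \<alpha> by (simp add: s_def)
  have ys: "y = y0 + s *\<^sub>R \<alpha>" "refl_along \<alpha> y = y0 + (- s) *\<^sub>R \<alpha>"
    by (simp_all add: y0_def s_def refl_along_def algebra_simps scaleR_2 flip: scaleR_add_left)
  have ay: "\<alpha> \<bullet> y = s * (norm \<alpha>)\<^sup>2" using aa by (simp add: s_def power2_norm_eq_inner)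
  have y0: "\<alpha> \<bullet> y0 = 0" using aa by (simp add: y0_def s_def inner_diff_right)
  let ?F1 = "dir_deriv (cvec \<alpha>, 0) F" and ?F2 = "dir_deriv (cvec \<alpha>, 0) (dir_deriv (cvec \<alpha>, 0) F)"
  obtain c d where cd: "\<bar>c\<bar> \<le> \<bar>s\<bar>" "\<bar>d\<bar> \<le> \<bar>s\<bar>"
    "rpart ?F1 (y0 + s *\<^sub>R \<alpha>) m / s - (rpart F (y0 + s *\<^sub>R \<alpha>) m - rpart F (y0 + (- s) *\<^sub>R \<alpha>) m) / (2 * s\<^sup>2)
      = (rpart ?F2 (y0 + c *\<^sub>R \<alpha>) m + rpart ?F2 (y0 + d *\<^sub>R \<alpha>) m) / 2"
    using symmetric_difference_mvt[OF rpart_x_line[OF entire_series_differentiable[OF F]]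
        rpart_x_line[OF entire_series_differentiable[OF entire_series_dir_deriv[OF F]]] s] by blast
  have near: "norm (y0 + c *\<^sub>R \<alpha> - x) \<le> norm (y - x)" if "\<bar>c\<bar> \<le> \<bar>s\<bar>" for c
  proof -
    have "\<alpha> \<bullet> (y0 - x) = 0" by (simp only: inner_diff_right y0 x)
    then have o: "(y0 - x) \<bullet> \<alpha> = 0" by (simp only: inner_commute)
    have n: "(norm (y0 + c *\<^sub>R \<alpha> - x))\<^sup>2 = (norm (y0 - x))\<^sup>2 + c\<^sup>2 * (norm \<alpha>)\<^sup>2" for c
    proof -
      have e: "y0 + c *\<^sub>R \<alpha> - x = (y0 - x) + c *\<^sub>R \<alpha>" by simp
      have "orthogonal (y0 - x) (c *\<^sub>R \<alpha>)" using o by (simp add: orthogonal_def)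
      from norm_add_Pythagorean[OF this] show ?thesis unfolding e by (simp add: power_mult_distrib)
    qed
    have "c\<^sup>2 \<le> s\<^sup>2" using that by (simp add: abs_le_square_iff)
    then have "(norm (y0 + c *\<^sub>R \<alpha> - x))\<^sup>2 \<le> (norm (y - x))\<^sup>2"
      unfolding n ys(1) by (simp add: mult_right_mono)
    then show ?thesis by (rule power2_le_imp_le) simp
  qed
  have "root_delta \<alpha> F m y = (rpart ?F1 (y0 + s *\<^sub>R \<alpha>) m / s
      - (rpart F (y0 + s *\<^sub>R \<alpha>) m - rpart F (y0 + (- s) *\<^sub>R \<alpha>) m) / (2 * s\<^sup>2)) / (norm \<alpha>)\<^sup>2"
  proof -
    define n where "n = (norm \<alpha>)\<^sup>2"
    have n: "n \<noteq> 0" using \<alpha> by (simp add: n_def)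
    have "root_delta \<alpha> F m y = rpart ?F1 y m / (s * n) - n / 2 * ((rpart F y m - rpart F (refl_along \<alpha> y) m) / (s * n)\<^sup>2)"
      using y unfolding root_delta_def ay n_def[symmetric] by simp
    also have "\<dots> = (rpart ?F1 y m / s - (rpart F y m - rpart F (refl_along \<alpha> y) m) / (2 * s\<^sup>2)) / n"
      using n s by (simp add: field_simps power2_eq_square)
    finally show ?thesis unfolding ys(2) n_def using ys(1) by simp
  qed
  then have "root_delta \<alpha> F m y = (rpart ?F2 (y0 + c *\<^sub>R \<alpha>) m + rpart ?F2 (y0 + d *\<^sub>R \<alpha>) m) / (2 * (norm \<alpha>)\<^sup>2)"
    unfolding cd(3) by simp
  with near[OF cd(1)] near[OF cd(2)] show ?thesis by blast
qed

lemma root_delta_isCont: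
  assumes F: "entire_series F" and \<alpha>: "\<alpha> \<noteq> 0"
  shows "(root_delta \<alpha> F m \<longlongrightarrow> root_delta \<alpha> F m x) (at x within {y. \<alpha> \<bullet> y \<noteq> 0})"
proof (cases "\<alpha> \<bullet> x = 0")
  case True
  let ?G = "\<lambda>x. rpart (dir_deriv (cvec \<alpha>, 0) (dir_deriv (cvec \<alpha>, 0) F)) x m"
  show ?thesis
    unfolding Lim_within
  proof (intro allI impI)
    fix e :: real assume e: "e > 0"
    define e' where "e' = e * (norm \<alpha>)\<^sup>2"
    have "e' > 0" using e \<alpha> by (simp add: e'_def)
    then obtain \<delta> where \<delta>: "\<delta> > 0" "\<And>p. dist p x < \<delta> \<Longrightarrow> dist (?G p) (?G x) < e'"
      using isCont_rpart_x[OF entire_series_dir_deriv[OF entire_series_dir_deriv[OF F]]]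
      unfolding continuous_at_eps_delta by blast
    show "\<exists>d>0. \<forall>y\<in>{y. \<alpha> \<bullet> y \<noteq> 0}. 0 < dist y x \<and> dist y x < d \<longrightarrow> dist (root_delta \<alpha> F m y) (root_delta \<alpha> F m x) < e"
    proof (intro exI[of _ \<delta>] conjI ballI impI \<delta>(1))
      fix y assume y: "y \<in> {y. \<alpha> \<bullet> y \<noteq> 0}" "0 < dist y x \<and> dist y x < \<delta>"
      obtain p q where pq: "norm (p - x) \<le> norm (y - x)" "norm (q - x) \<le> norm (y - x)"
        "root_delta \<alpha> F m y = (?G p + ?G q) / (2 * (norm \<alpha>)\<^sup>2)"
        using root_delta_mean[OF F \<alpha> _ True, of y] y(1) by blast
      have "\<bar>?G p - ?G x\<bar> < e'" "\<bar>?G q - ?G x\<bar> < e'"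
        using \<delta>(2)[of p] \<delta>(2)[of q] pq(1,2) y(2) by (simp_all add: dist_norm)
      then have "\<bar>(?G p + ?G q) - 2 * ?G x\<bar> < 2 * e'" by linarith
      moreover have "root_delta \<alpha> F m y - root_delta \<alpha> F m x = ((?G p + ?G q) - 2 * ?G x) / (2 * (norm \<alpha>)\<^sup>2)"
        unfolding pq(3) using True \<alpha> by (simp add: root_delta_def field_simps)
      ultimately show "dist (root_delta \<alpha> F m y) (root_delta \<alpha> F m x) < e"
        using \<alpha> by (simp add: dist_norm e'_def abs_divide pos_divide_less_eq mult_ac)
    qed
  qed
next
  case False
  let ?h = "\<lambda>y. rpart (dir_deriv (cvec \<alpha>, 0) F) y m / (\<alpha> \<bullet> y)
        - (norm \<alpha>)\<^sup>2 / 2 * ((rpart F y m - rpart F (refl_along \<alpha> y) m) / (\<alpha> \<bullet> y)\<^sup>2)"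
  have "isCont (\<lambda>y. refl_along \<alpha> y) x"
    unfolding refl_along_def using \<alpha> by (intro continuous_intros) simp
  from isCont_o2[OF this isCont_rpart_x[OF F]]
  have "isCont ?h x"
    using False by (intro continuous_intros isCont_rpart_x F entire_series_dir_deriv) auto
  then have "(?h \<longlongrightarrow> root_delta \<alpha> F m x) (at x within {y. \<alpha> \<bullet> y \<noteq> 0})"
    using False by (auto simp: root_delta_def isCont_def intro: tendsto_within_subset)
  then show ?thesis
    by (rule Lim_transform_eventually) (auto simp: root_delta_def eventually_at_filter)
qed

context dunkl_setup
begin

text \<open>Both sides are continuous along \<open>x + t b\<close> as \<open>t\<close> tends to \<open>0\<close>, and for a vector \<open>b\<close> orthogonal to no root these
points are regular for small \<open>t > 0\<close>.\<close>

lemma laplace_eq_real: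
  assumes eq: "laplace_eq F S" and F: "entire_series F" and S: "\<And>x. isCont (\<lambda>x. rpart S x m) x"
  shows "(\<Sum>i\<in>UNIV. rpart (dir_deriv (axis i 1, 0) (dir_deriv (axis i 1, 0) F)) x m) + 2 * (\<Sum>\<alpha>\<in>Rp. k \<alpha> * root_delta \<alpha> F m x)
    = (m \<bullet> m) * rpart F x m + rpart S x m" (is "?L x = ?R x")
proof -
  have regular: "?L y = ?R y" if y: "\<forall>\<alpha>\<in>Rp. \<alpha> \<bullet> y \<noteq> 0" for y
  proof -
    have rd: "Re (complex_of_real a * (A / complex_of_real b - complex_of_real c / 2 * (B / (complex_of_real b)\<^sup>2)))
        = a * (Re A / b - c / 2 * (Re B / b\<^sup>2))" for a b c A B
    proof -
      have "complex_of_real a * (A / complex_of_real b - complex_of_real c / 2 * (B / (complex_of_real b)\<^sup>2))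
        = complex_of_real a * (A / complex_of_real b - complex_of_real (c / 2) * (B / complex_of_real (b\<^sup>2)))" by simp
      then show ?thesis by (simp only: Re_divide_of_real minus_complex.sel times_complex.sel Re_complex_of_real Im_complex_of_real) simp
    qed
    have "cdot (cvec \<alpha>) (cvec y) \<noteq> 0" if "\<alpha> \<in> Rp" for \<alpha> using y that by (simp add: cdot_cvec)
    then have "(\<Sum>i\<in>UNIV. dir_deriv (axis i 1, 0) (dir_deriv (axis i 1, 0) F) (cvec y, cvec m))
     + 2 * (\<Sum>\<alpha>\<in>Rp. complex_of_real (k \<alpha>) * (dir_deriv (cvec \<alpha>, 0) F (cvec y, cvec m) / cdot (cvec \<alpha>) (cvec y)
         - cdot (cvec \<alpha>) (cvec \<alpha>) / 2 * ((F (cvec y, cvec m) - F (crefl_along \<alpha> (cvec y), cvec m)) / (cdot (cvec \<alpha>) (cvec y))\<^sup>2)))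
     = cdot (cvec m) (cvec m) * F (cvec y, cvec m) + S (cvec y, cvec m)"
      using eq unfolding laplace_eq_def by blast
    from arg_cong[OF this[unfolded cdot_cvec crefl_along_cvec], of Re]
    have "(\<Sum>i\<in>UNIV. Re (dir_deriv (axis i 1, 0) (dir_deriv (axis i 1, 0) F) (cvec y, cvec m)))
     + 2 * (\<Sum>\<alpha>\<in>Rp. k \<alpha> * (Re (dir_deriv (cvec \<alpha>, 0) F (cvec y, cvec m)) / (\<alpha> \<bullet> y)
         - (\<alpha> \<bullet> \<alpha>) / 2 * (Re (F (cvec y, cvec m) - F (cvec (refl_along \<alpha> y), cvec m)) / (\<alpha> \<bullet> y)\<^sup>2)))
     = (m \<bullet> m) * Re (F (cvec y, cvec m)) + Re (S (cvec y, cvec m))"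
      by (simp only: plus_complex.sel Re_sum rd times_complex.sel Re_complex_of_real Im_complex_of_real complex_Re_numeral complex_Im_numeral) simp
    moreover have "(\<Sum>\<alpha>\<in>Rp. k \<alpha> * root_delta \<alpha> F m y) = (\<Sum>\<alpha>\<in>Rp. k \<alpha> * (Re (dir_deriv (cvec \<alpha>, 0) F (cvec y, cvec m)) / (\<alpha> \<bullet> y)
         - (\<alpha> \<bullet> \<alpha>) / 2 * (Re (F (cvec y, cvec m) - F (cvec (refl_along \<alpha> y), cvec m)) / (\<alpha> \<bullet> y)\<^sup>2)))"
      using y by (intro sum.cong refl) (simp add: root_delta_def rpart_def power2_norm_eq_inner)
    ultimately show ?thesis by (simp add: rpart_def)
  qed
  obtain b where b: "\<And>\<alpha>. \<alpha> \<in> Rp \<Longrightarrow> \<alpha> \<bullet> b \<noteq> 0" using regular_direction by blast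
  define p where "p = (\<lambda>t::real. x + t *\<^sub>R b)"
  have reg: "\<forall>\<^sub>F t in at_right 0. \<alpha> \<bullet> p t \<noteq> 0" if "\<alpha> \<in> Rp" for \<alpha>
  proof (cases "\<alpha> \<bullet> x = 0")
    case True
    then show ?thesis using b[OF that] by (auto simp: p_def inner_add_right eventually_at_filter)
  next
    case False
    have "((\<lambda>t. \<alpha> \<bullet> p t) \<longlongrightarrow> \<alpha> \<bullet> p 0) (at_right 0)" unfolding p_def by (intro tendsto_intros)
    then show ?thesis using False by (intro tendsto_imp_eventually_ne) (auto simp: p_def)
  qed
  have pc: "(p \<longlongrightarrow> x) (at_right 0)"
    unfolding p_def by (rule tendsto_eq_intros refl | simp)+
  have pc': "filterlim p (at x within {y. \<alpha> \<bullet> y \<noteq> 0}) (at_right 0)" if "\<alpha> \<in> Rp" for \<alpha>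
  proof -
    have "b \<noteq> 0" using b[OF that] by auto
    then have "\<forall>\<^sub>F t in at_right 0. p t \<noteq> x" by (simp add: p_def eventually_at_filter)
    then show ?thesis unfolding filterlim_at using pc eventually_conj[OF reg[OF that]] by simp
  qed
  have L: "((\<lambda>t. ?L (p t)) \<longlongrightarrow> ?L x) (at_right 0)"
    by (intro tendsto_intros isCont_tendsto_compose[OF isCont_rpart_x pc] entire_series_dir_deriv F
        filterlim_compose[OF root_delta_isCont[OF F] pc'] Rp_nonzero)
  have R: "((\<lambda>t. ?R (p t)) \<longlongrightarrow> ?R x) (at_right 0)"
    by (intro tendsto_intros isCont_tendsto_compose[OF isCont_rpart_x pc] isCont_tendsto_compose[OF S pc] F)
  have "\<forall>\<^sub>F t in at_right 0. ?L (p t) = ?R (p t)"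
  proof -
    have "\<forall>\<^sub>F t in at_right 0. \<forall>\<alpha>\<in>Rp. \<alpha> \<bullet> p t \<noteq> 0" using reg by (simp add: eventually_ball_finite)
    then show ?thesis by (rule eventually_mono) (rule regular)
  qed
  from Lim_transform_eventually[OF L this] R show ?thesis
    by (rule tendsto_unique[OF trivial_limit_at_right_real])
qed

lemma rpart_x_derivative_axis:
  "entire_series F \<Longrightarrow> partial_deriv i (\<lambda>x. rpart F x m) x = rpart (dir_deriv (axis i 1, 0) F) x m"
  by (rule partial_deriv_x[OF entire_series_differentiable])

lemma partial_deriv_quotient:
  assumes F: "entire_series F"
  shows "partial_deriv i (\<lambda>x. rpart F x m / K x m) x =
    (rpart (dir_deriv (axis i 1, 0) F) x m * K x m - rpart F x m * rpart (dir_deriv (axis i 1, 0) kernel) x m) / (K x m)\<^sup>2"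
proof -
  have "((\<lambda>s. rpart F (x + s *\<^sub>R axis i 1) m / K (x + s *\<^sub>R axis i 1) m) has_real_derivative
    (rpart (dir_deriv (axis i 1, 0) F) x m * K x m - rpart F x m * rpart (dir_deriv (axis i 1, 0) kernel) x m) / (K x m)\<^sup>2) (at 0)"
    using DERIV_divide[OF rpart_x_line[OF entire_series_differentiable[OF F], of x "axis i 1" m 0] rpart_x_line[OF kernel_differentiable, of x "axis i 1" m 0]]
    by (simp add: cvec_axis K_nonzero power2_eq_square)
  then show ?thesis unfolding partial_deriv_def by (rule DERIV_imp_deriv)
qed

text \<open>The terms with first derivatives cancel against the drift.\<close>

lemma second_partial_deriv_quotient:
  assumes F: "entire_series F"
  shows "partial_deriv i (partial_deriv i (\<lambda>x. rpart F x m / K x m)) x / 2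
      + partial_deriv i (\<lambda>x. K x m) x * partial_deriv i (\<lambda>x. rpart F x m / K x m) x / K x m
    = (rpart (dir_deriv (axis i 1, 0) (dir_deriv (axis i 1, 0) F)) x m
       - rpart F x m / K x m * rpart (dir_deriv (axis i 1, 0) (dir_deriv (axis i 1, 0) kernel)) x m) / (2 * K x m)"
proof -
  let ?F1 = "dir_deriv (axis i 1, 0) F" and ?K1 = "dir_deriv (axis i 1, 0) kernel"
  let ?F2 = "dir_deriv (axis i 1, 0) ?F1" and ?K2 = "dir_deriv (axis i 1, 0) ?K1"
  note dF = rpart_x_line[OF entire_series_differentiable[OF F], of x "axis i 1" m 0, unfolded cvec_axis]
  note dK = rpart_x_line[OF kernel_differentiable, of x "axis i 1" m 0, unfolded cvec_axis]
  note dF1 = rpart_x_line[OF entire_series_differentiable[OF entire_series_dir_deriv[OF F, of "(axis i 1, 0)"]], where x = x and a = "axis i 1" and m = m and s = 0, unfolded cvec_axis]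
  note dK1 = rpart_x_line[OF entire_series_differentiable[OF entire_series_dir_deriv[OF kernel_entire_series, of "(axis i 1, 0)"]], where x = x and a = "axis i 1" and m = m and s = 0, unfolded cvec_axis]
  have p: "partial_deriv i (\<lambda>x. rpart F x m / K x m) =
    (\<lambda>x. (rpart ?F1 x m * K x m - rpart F x m * rpart ?K1 x m) / (K x m)\<^sup>2)"
    using partial_deriv_quotient[OF F] by blast
  define f f1 f2 g g1 g2 where fg: "f = rpart F x m" "f1 = rpart ?F1 x m" "f2 = rpart ?F2 x m"
    "g = K x m" "g1 = rpart ?K1 x m" "g2 = rpart ?K2 x m"
  have g: "g \<noteq> 0" unfolding fg by (rule K_nonzero)
  let ?p = "\<lambda>s::real. x + s *\<^sub>R axis i 1"
  have "((\<lambda>s. (rpart ?F1 (?p s) m * K (?p s) m - rpart F (?p s) m * rpart ?K1 (?p s) m) / (K (?p s) m)\<^sup>2) has_real_derivative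
      ((f2 * g - f * g2) * g\<^sup>2 - (f1 * g - f * g1) * (2 * g * g1)) / (g\<^sup>2 * g\<^sup>2)) (at 0)"
    by (rule derivative_eq_intros dF dK dF1 dK1 refl)+ (use K_nonzero in \<open>auto simp: fg algebra_simps power2_eq_square\<close>)
  then have 2: "partial_deriv i (partial_deriv i (\<lambda>x. rpart F x m / K x m)) x
     = ((f2 * g - f * g2) * g\<^sup>2 - (f1 * g - f * g1) * (2 * g * g1)) / (g\<^sup>2 * g\<^sup>2)"
    unfolding p unfolding partial_deriv_def by (rule DERIV_imp_deriv)
  show ?thesis
    unfolding 2 unfolding p rpart_x_derivative_axis[OF kernel_entire_series] fg[symmetric]
    using g by (simp add: field_simps power2_eq_square)
qed

lemma rpart_direction_sum:
  fixes F :: "(complex^'n) \<times> (complex^'n) \<Rightarrow> complex"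
  assumes "entire_series F"
  shows "(\<Sum>i\<in>UNIV. a $ i * rpart (dir_deriv (axis i 1, 0) F) x m) = rpart (dir_deriv (cvec a, 0) F) x m"
proof -
  interpret bounded_linear "\<lambda>h. dir_deriv h F (cvec x, cvec m)"
    using has_derivative_dir_deriv[OF entire_series_differentiable[OF assms]] by (rule has_derivative_bounded_linear)
  have "(cvec a, 0) = (\<Sum>i\<in>UNIV. a $ i *\<^sub>R (axis i 1 :: complex^'n, 0 :: complex^'n))"
    by (simp add: prod_eq_iff sum_prod[symmetric] fst_sum snd_sum scaleR_scaleC)
      (simp add: cvec_def vec_eq_iff axis_def if_distrib[of "\<lambda>x. _ * x"] cong: if_cong)
  then have "dir_deriv (cvec a, 0) F (cvec x, cvec m) = (\<Sum>i\<in>UNIV. a $ i *\<^sub>R dir_deriv (axis i 1, 0) F (cvec x, cvec m))"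
    by (simp only: sum scaleR)
  then show ?thesis by (simp add: rpart_def)
qed

text \<open>The Doob transform. The reflection term of the generator at \<open>F / K\<close> combines with its gradient term to
\<open>(\<delta>F - (F / K) \<delta>K) / K\<close> for the operator \<open>\<delta>\<close> of \<open>root_delta\<close>; in particular each root term has a limit on
its hyperplane.\<close>

lemma generator_quotient:
  assumes F: "entire_series F" and S: "\<And>x. isCont (\<lambda>x. rpart S x m) x" and eq: "laplace_eq F S"
  shows "dunkl_drift_generator Rp k m (\<lambda>x. rpart F x m / K x m) x = rpart S x m / (2 * K x m)"
proof -
  let ?f = "\<lambda>x. rpart F x m / K x m"
  have grad: "gradient ?f y \<bullet> \<alpha> = (rpart (dir_deriv (cvec \<alpha>, 0) F) y m * K y m - rpart F y m * rpart (dir_deriv (cvec \<alpha>, 0) kernel) y m) / (K y m)\<^sup>2" for y \<alpha>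
  proof -
    have "gradient ?f y \<bullet> \<alpha> = (\<Sum>i\<in>UNIV. \<alpha> $ i * rpart (dir_deriv (axis i 1, 0) F) y m) * K y m / (K y m)\<^sup>2
        - rpart F y m * (\<Sum>i\<in>UNIV. \<alpha> $ i * rpart (dir_deriv (axis i 1, 0) kernel) y m) / (K y m)\<^sup>2"
      by (simp add: inner_vec_def gradient_def partial_deriv_quotient[OF F] sum_divide_distrib sum_distrib_left sum_distrib_right
          sum_subtractf[symmetric] diff_divide_distrib[symmetric] algebra_simps)
    then show ?thesis
      by (simp add: rpart_direction_sum F kernel_entire_series diff_divide_distrib)
  qed
  have root: "cont_ext {y. \<alpha> \<bullet> y \<noteq> 0}
        (\<lambda>y. k \<alpha> * ((gradient ?f y \<bullet> \<alpha>) / (\<alpha> \<bullet> y))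
           - k \<alpha> * (norm \<alpha>)\<^sup>2 / 2 * (K (refl_along \<alpha> y) m / K y m)
             * ((?f y - ?f (refl_along \<alpha> y)) / (\<alpha> \<bullet> y)\<^sup>2)) x
      = k \<alpha> * (root_delta \<alpha> F m x - ?f x * root_delta \<alpha> kernel m x) / K x m" (is "cont_ext ?S ?g x = ?h x") if \<alpha>: "\<alpha> \<in> Rp" for \<alpha>
  proof -
    have on: "?g y = ?h y" if "y \<in> ?S" for y
    proof -
      define a where "a = \<alpha> \<bullet> y"
      have "a \<noteq> 0" using that by (simp add: a_def)
      define P P' Fy F' where PF: "P = K y m" "P' = K (refl_along \<alpha> y) m" "Fy = rpart F y m" "F' = rpart F (refl_along \<alpha> y) m"
      have "P \<noteq> 0" "P' \<noteq> 0" by (simp_all add: PF K_nonzero)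
      define dF dP where dd: "dF = rpart (dir_deriv (cvec \<alpha>, 0) F) y m" "dP = rpart (dir_deriv (cvec \<alpha>, 0) kernel) y m"
      have "k \<alpha> * (((dF * P - Fy * dP) / P\<^sup>2) / a) - k \<alpha> * (norm \<alpha>)\<^sup>2 / 2 * (P' / P) * ((Fy / P - F' / P') / a\<^sup>2)
        = k \<alpha> * ((dF / a - (norm \<alpha>)\<^sup>2 / 2 * ((Fy - F') / a\<^sup>2)) - Fy / P * (dP / a - (norm \<alpha>)\<^sup>2 / 2 * ((P - P') / a\<^sup>2))) / P"
        using \<open>a \<noteq> 0\<close> \<open>P \<noteq> 0\<close> \<open>P' \<noteq> 0\<close> by (simp add: divide_simps power2_eq_square) algebra
      then show ?thesis
        using \<open>a \<noteq> 0\<close> unfolding grad root_delta_def PF dd a_def by simp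
    qed
    have lim: "(?h \<longlongrightarrow> ?h x) (at x within ?S)"
      by (intro tendsto_intros root_delta_isCont F kernel_entire_series Rp_nonzero[OF \<alpha>] K_nonzero
          tendsto_within_subset[OF isCont_rpart_x[unfolded isCont_def]] subset_UNIV)
    have lim': "(?g \<longlongrightarrow> ?h x) (at x within ?S)"
    proof (rule Lim_transform_eventually[OF lim])
      show "\<forall>\<^sub>F y in at x within ?S. ?h y = ?g y"
        unfolding eventually_at_filter by (intro always_eventually allI impI on[symmetric])
    qed
    have nb: "at x within ?S \<noteq> bot" if "x \<notin> ?S"
    proof -
      have "((\<lambda>t::real. x + t *\<^sub>R \<alpha>) \<longlongrightarrow> x) (at_right 0)" by (rule tendsto_eq_intros refl | simp)+
      then have "filterlim (\<lambda>t. x + t *\<^sub>R \<alpha>) (at x within ?S) (at_right 0)"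
        unfolding filterlim_at using that Rp_nonzero[OF \<alpha>] by (auto simp: inner_add_right eventually_at_filter)
      then show ?thesis
        using trivial_limit_at_right_real[of "0::real"] by (auto simp: filterlim_def bot_unique filtermap_bot_iff)
    qed
    show ?thesis
    proof (cases "x \<in> ?S")
      case True
      then show ?thesis using on[OF True] by (simp add: cont_ext_def)
    next
      case False
      then have "cont_ext ?S ?g x = Lim (at x within ?S) ?g" unfolding cont_ext_def by (rule if_not_P)
      also have "\<dots> = ?h x" by (rule tendsto_Lim[OF nb[OF False] lim'])
      finally show ?thesis .
    qed
  qed
  have lap: "laplacian ?f x / 2 + (gradient (\<lambda>y. K y m) x \<bullet> gradient ?f x) / K x m
     = (\<Sum>i\<in>UNIV. (rpart (dir_deriv (axis i 1, 0) (dir_deriv (axis i 1, 0) F)) x m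
       - ?f x * rpart (dir_deriv (axis i 1, 0) (dir_deriv (axis i 1, 0) kernel)) x m) / (2 * K x m))"
    unfolding second_partial_deriv_quotient[OF F, symmetric]
    by (simp add: laplacian_def gradient_def inner_vec_def sum.distrib sum_divide_distrib)
  have "dunkl_drift_generator Rp k m ?f x = (\<Sum>i\<in>UNIV. (rpart (dir_deriv (axis i 1, 0) (dir_deriv (axis i 1, 0) F)) x m
       - ?f x * rpart (dir_deriv (axis i 1, 0) (dir_deriv (axis i 1, 0) kernel)) x m) / (2 * K x m))
     + (\<Sum>\<alpha>\<in>Rp. k \<alpha> * (root_delta \<alpha> F m x - ?f x * root_delta \<alpha> kernel m x) / K x m)"
    unfolding dunkl_drift_generator_def dunkl_kernel_eq lap
    by (intro arg_cong2[of _ _ _ _ "(+)"] refl sum.cong root)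
  also have "\<dots> = (((\<Sum>i\<in>UNIV. rpart (dir_deriv (axis i 1, 0) (dir_deriv (axis i 1, 0) F)) x m) + 2 * (\<Sum>\<alpha>\<in>Rp. k \<alpha> * root_delta \<alpha> F m x))
     - ?f x * ((\<Sum>i\<in>UNIV. rpart (dir_deriv (axis i 1, 0) (dir_deriv (axis i 1, 0) kernel)) x m) + 2 * (\<Sum>\<alpha>\<in>Rp. k \<alpha> * root_delta \<alpha> kernel m x))) / (2 * K x m)"
    (is "?A + ?B = (?C + 2 * ?D - ?f x * (?E + 2 * ?G)) / _")
  proof -
    have "?A = (?C - ?f x * ?E) / (2 * K x m)"
      by (simp only: sum_divide_distrib[symmetric] sum_subtractf sum_distrib_left)
    moreover have "?B = (?D - ?f x * ?G) / K x m"
      by (simp only: sum_divide_distrib[symmetric] right_diff_distrib sum_subtractf sum_distrib_left mult.left_commute)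
    ultimately show ?thesis using K_nonzero[of x m] by (simp add: field_simps)
  qed
  also have "\<dots> = ((m \<bullet> m) * rpart F x m + rpart S x m - ?f x * ((m \<bullet> m) * K x m)) / (2 * K x m)"
    unfolding laplace_eq_real[OF eq F S]
    using laplace_eq_real[OF kernel_laplace_eq kernel_entire_series, of m x]
    by (simp add: rpart_def)
  also have "\<dots> = rpart S x m / (2 * K x m)" using K_nonzero[of x m] by simp
  finally show ?thesis .
qed

lemma generator_moment2:
  "dunkl_drift_generator Rp k m (moment2 Rp k m j l) x =
     (if j = l then 1 else 0) + m $ j * moment1 Rp k m l x + m $ l * moment1 Rp k m j x"
proof -
  let ?S = "\<lambda>v. 2 * cdot (snd v) (cvec (axis j 1)) * kernel1 (cvec (axis l 1)) v
     + 2 * cdot (snd v) (cvec (axis l 1)) * kernel1 (cvec (axis j 1)) v + 2 * cdot (cvec (axis j 1)) (cvec (axis l 1)) * kernel v"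
  have S: "rpart ?S x m = 2 * (m $ j) * K1 (axis l 1) x m + 2 * (m $ l) * K1 (axis j 1) x m + 2 * (if j = l then 1 else 0) * K x m" for x
    by (simp add: rpart_def cdot_cvec inner_axis inner_axis_axis) (simp add: axis_def)
  have "dunkl_drift_generator Rp k m (\<lambda>x. K2 (axis j 1) (axis l 1) x m / K x m) x = rpart ?S x m / (2 * K x m)"
  proof (rule generator_quotient[OF kernel2_entire_series _ kernel2_laplace_eq])
    show "isCont (\<lambda>x. rpart ?S x m) x" for x
      unfolding S by (intro continuous_intros isCont_rpart_x kernel1_entire_series kernel_entire_series)
  qed
  then have "dunkl_drift_generator Rp k m (moment2 Rp k m j l) x = rpart ?S x m / (2 * K x m)"
    by (simp add: moment2_eq[abs_def])
  then show ?thesis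
    unfolding S moment1_eq using K_nonzero[of x m] by (simp add: field_simps)
qed

end

section \<open>Eigenfunctions of the transition kernels\<close>

lemma has_derivative_under_integral:
  fixes f f' :: "real \<Rightarrow> 'y \<Rightarrow> real" and p g :: "'y \<Rightarrow> real"
  assumes d: "\<And>s y. ((\<lambda>s. f s y) has_real_derivative f' s y) (at s)"
    and int: "\<And>s. integrable M (\<lambda>y. p y * f s y)"
    and bound: "\<And>s y. \<bar>s\<bar> < 1 \<Longrightarrow> \<bar>p y * f' s y\<bar> \<le> g y" and g: "integrable M g"
  shows "((\<lambda>s. LINT y|M. p y * f s y) has_real_derivative (LINT y|M. p y * f' 0 y)) (at 0)"
  unfolding has_field_derivative_iff tendsto_at_iff_sequentially
proof (intro allI impI)
  fix X :: "nat \<Rightarrow> real" assume X: "\<forall>i. X i \<in> UNIV - {0}" "X \<longlonglongrightarrow> 0"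
  have q: "(\<lambda>n. (p y * f (X n) y - p y * f 0 y) / X n) \<longlonglongrightarrow> p y * f' 0 y" for y
  proof -
    have "(\<lambda>n. (f (X n) y - f 0 y) / (X n - 0)) \<longlonglongrightarrow> f' 0 y"
      using d[where s = 0 and y = y] X
      unfolding has_field_derivative_iff tendsto_at_iff_sequentially o_def by blast
    from tendsto_mult_left[OF this, of "p y"] show ?thesis by (simp add: right_diff_distrib)
  qed
  obtain N where N: "\<And>n. n \<ge> N \<Longrightarrow> \<bar>X n\<bar> < 1"
    using X(2) unfolding lim_sequentially by (metis dist_0_norm real_norm_def zero_less_one dist_commute)
  have "(\<lambda>n. LINT y|M. (p y * f (X (n + N)) y - p y * f 0 y) / X (n + N)) \<longlonglongrightarrow> (LINT y|M. p y * f' 0 y)"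
  proof (rule integral_dominated_convergence[where w = g])
    show "(\<lambda>y. (p y * f (X (n + N)) y - p y * f 0 y) / X (n + N)) \<in> borel_measurable M" for n
      using int[THEN borel_measurable_integrable] by (intro borel_measurable_divide borel_measurable_diff) auto
    show "(\<lambda>y. p y * f' 0 y) \<in> borel_measurable M"
      by (rule borel_measurable_LIMSEQ_real[OF q])
        (use int[THEN borel_measurable_integrable] in \<open>intro borel_measurable_divide borel_measurable_diff, auto\<close>)
    show "AE y in M. (\<lambda>n. (p y * f (X (n + N)) y - p y * f 0 y) / X (n + N)) \<longlonglongrightarrow> p y * f' 0 y"
      using LIMSEQ_ignore_initial_segment[OF q] by simp
    show "AE y in M. norm ((p y * f (X (n + N)) y - p y * f 0 y) / X (n + N)) \<le> g y" for n
    proof (rule AE_I2)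
      fix y
      define h where "h = X (n + N)"
      have h: "h \<noteq> 0" "\<bar>h\<bar> < 1" using X(1) N[of "n + N"] by (auto simp: h_def)
      obtain z where z: "\<bar>z\<bar> < 1" "f h y - f 0 y = h * f' z y"
      proof (cases "h > 0")
        case True
        then obtain z where "0 < z" "z < h" "f h y - f 0 y = (h - 0) * f' z y" using MVT2[OF True d] by blast
        then show ?thesis using h that[of z] by auto
      next
        case False
        then have "h < 0" using h by simp
        then obtain z where "h < z" "z < 0" "f 0 y - f h y = (0 - h) * f' z y" using MVT2[OF _ d] by blast
        then show ?thesis using h that[of z] by auto
      qed
      have "(p y * f h y - p y * f 0 y) / h = p y * f' z y"
        using z(2) h(1) by (simp add: field_simps)
      then show "norm ((p y * f (X (n + N)) y - p y * f 0 y) / X (n + N)) \<le> g y"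
        using bound[OF z(1), of y] by (simp add: h_def)
    qed
  qed (use g in auto)
  then have lim: "(\<lambda>n. LINT y|M. (p y * f (X n) y - p y * f 0 y) / X n) \<longlonglongrightarrow> (LINT y|M. p y * f' 0 y)"
    by (rule LIMSEQ_offset)
  have eq: "(LINT y|M. (p y * f (X n) y - p y * f 0 y) / X n) = ((LINT y|M. p y * f (X n) y) - (LINT y|M. p y * f 0 y)) / X n" for n
    using int by simp
  show "((\<lambda>s. ((LINT y|M. p y * f s y) - (LINT y|M. p y * f 0 y)) / (s - 0)) \<circ> X) \<longlonglongrightarrow> (LINT y|M. p y * f' 0 y)"
    using lim unfolding eq by (simp add: o_def)
qed

text \<open>A nonempty open set is not negligible.\<close>

lemma AE_lborel_continuous_eq:
  fixes f g :: "'v::euclidean_space \<Rightarrow> real"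
  assumes ae: "AE z in lborel. f z = g z" and f: "continuous_on UNIV f" and g: "continuous_on UNIV g"
  shows "f z = g z"
proof (rule ccontr)
  assume "f z \<noteq> g z"
  define U where "U = {z. f z \<noteq> g z}"
  have o: "open U" unfolding U_def by (rule open_Collect_neq[OF f g])
  have "AE z in lborel. z \<notin> U" using ae by (simp add: U_def)
  then have "U \<in> null_sets lborel" using o by (subst AE_iff_null_sets) auto
  then have "negligible U" by (simp add: negligible_iff_null_sets null_sets_completionI)
  moreover have "U \<noteq> {}" using \<open>f z \<noteq> g z\<close> by (auto simp: U_def)
  ultimately show False using open_not_negligible o by blast
qed

lemma dunkl_weight_nonneg: "0 \<le> dunkl_weight Rp k x"
  unfolding dunkl_weight_def by (intro prod_nonneg) auto

lemma borel_measurable_dunkl_weight [measurable]: "dunkl_weight Rp k \<in> borel_measurable borel"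
proof -
  have "(\<lambda>x. if k \<alpha> = 0 then 1 else \<bar>\<alpha> \<bullet> x\<bar> powr (2 * k \<alpha>)) \<in> borel_measurable borel" for \<alpha>
    by (cases "k \<alpha> = 0") simp_all
  then show ?thesis unfolding dunkl_weight_def[abs_def] by (rule borel_measurable_prod)
qed

context dunkl_setup
begin

lemma AE_dunkl_weight_pos: "AE x in lborel. 0 < dunkl_weight Rp k x"
proof -
  have "AE x in lborel. \<alpha> \<bullet> x \<noteq> 0" if "\<alpha> \<in> Rp" for \<alpha>
  proof -
    have "{x. \<alpha> \<bullet> x = 0} \<in> null_sets lborel"
      using negligible_hyperplane[of \<alpha> 0] Rp_nonzero[OF that] negligible_iff_null_sets[of "{x. \<alpha> \<bullet> x = 0}"]
        null_sets_completion_iff[of "{x. \<alpha> \<bullet> x = 0}" lborel] closed_hyperplane[of \<alpha> 0] by auto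
    then show ?thesis using AE_iff_null_sets[of "{x. \<alpha> \<bullet> x = 0}" lborel] by auto
  qed
  then have "AE x in lborel. \<forall>\<alpha>\<in>Rp. \<alpha> \<bullet> x \<noteq> 0" by (simp add: AE_ball_countable countable_finite)
  then show ?thesis
    by eventually_elim (auto simp: dunkl_weight_def intro!: prod_pos)
qed

lemma W_scaleR: "u \<in> W \<Longrightarrow> u (s *\<^sub>R z) = s *\<^sub>R u z"
  by (simp add: scaleR_scaleC W_scale)

lemma kernel_poly_scale: "kernel_poly n (s *\<^sub>R z) w = kernel_poly n z (s *\<^sub>R w)"
proof (induction n arbitrary: z)
  case (Suc n)
  have "cdot (u (s *\<^sub>R z)) w * kernel_poly n (u (s *\<^sub>R z)) w = cdot (u z) (s *\<^sub>R w) * kernel_poly n (u z) (s *\<^sub>R w)"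
    if "u \<in> W" for u
    unfolding W_scaleR[OF that] Suc by (simp add: scaleR_scaleC cdot_linear)
  then show ?case by (simp cong: sum.cong)
qed simp

lemma K_scale: "K (s *\<^sub>R x) m = K x (s *\<^sub>R m)"
  by (simp add: rpart_def kernel_def cvec_scaleR kernel_poly_scale flip: scaleR_scaleC)

lemma borel_measurable_K [measurable]:
  "(\<lambda>y. K y m) \<in> borel_measurable borel" "(\<lambda>y. K x y) \<in> borel_measurable borel"
  "(\<lambda>y. K1 b y m) \<in> borel_measurable borel" "(\<lambda>y. K2 b c y m) \<in> borel_measurable borel"
  by (intro borel_measurable_continuous_onI continuous_intros kernel_entire_series kernel1_entire_series kernel2_entire_series)+

lemma borel_measurable_K_pair [measurable]:
  assumes "f \<in> M \<rightarrow>\<^sub>M borel" "g \<in> M \<rightarrow>\<^sub>M borel"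
  shows "(\<lambda>v. K (f v) (g v)) \<in> borel_measurable M"
proof -
  have "(\<lambda>v. K (fst v) (snd v)) \<in> borel_measurable (borel \<Otimes>\<^sub>M borel)"
    unfolding borel_prod by (intro borel_measurable_continuous_onI continuous_intros kernel_entire_series)
  from measurable_compose[OF measurable_Pair[OF assms] this] show ?thesis by simp
qed

end

text \<open>The semigroup hypothesis supplies normalization and the Chapman-Kolmogorov equation.\<close>

locale dunkl_drift = dunkl_setup R Rp k for R Rp :: "(real^'n) set" and k :: "real^'n \<Rightarrow> real" +
  fixes lam :: "real^'n"
  assumes feller: "feller_semigroup (dunkl_drift_kernel Rp k lam)"
begin

text \<open>The part of the transition density that does not depend on the drift; the factors depending on the
starting point alone are split off as \<open>normalizer\<close>.\<close>

definition free_density :: "real \<Rightarrow> real^'n \<Rightarrow> real^'n \<Rightarrow> real" where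
  "free_density t x y = exp (- (norm y)\<^sup>2 / (2 * t)) * K x (y /\<^sub>R t) * dunkl_weight Rp k y"

definition normalizer :: "real \<Rightarrow> real^'n \<Rightarrow> real" where
  "normalizer t x = dunkl_const Rp k * exp (- (norm lam)\<^sup>2 * t / 2) / t powr (dunkl_gamma Rp k + real CARD('n) / 2)
     * exp (- (norm x)\<^sup>2 / (2 * t)) / K x lam"

lemma free_density_nonneg: "0 \<le> free_density t x y"
  unfolding free_density_def using K_pos[of x "y /\<^sub>R t"]
  by (intro mult_nonneg_nonneg dunkl_weight_nonneg) auto

lemma borel_measurable_free_density [measurable]:
  assumes [measurable]: "f \<in> M \<rightarrow>\<^sub>M borel" "g \<in> M \<rightarrow>\<^sub>M borel"
  shows "(\<lambda>v. free_density t (f v) (g v)) \<in> borel_measurable M"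
proof -
  have [measurable]: "(\<lambda>v. K (f v) (g v /\<^sub>R t)) \<in> borel_measurable M"
    by (rule borel_measurable_K_pair) measurable
  have [measurable]: "(\<lambda>v. dunkl_weight Rp k (g v)) \<in> borel_measurable M"
    by (rule measurable_compose[OF assms(2) borel_measurable_dunkl_weight])
  have [measurable]: "(\<lambda>v. exp (- (norm (g v))\<^sup>2 / (2 * t))) \<in> borel_measurable M"
    by (rule measurable_compose[OF assms(2)])
      (unfold divide_inverse, intro borel_measurable_continuous_onI continuous_intros)
  show ?thesis unfolding free_density_def by measurable
qed

lemma borel_measurable_normalizer [measurable]: "normalizer t \<in> borel_measurable borel"
  unfolding normalizer_def[abs_def] by measurable

abbreviation Kt where "Kt \<equiv> dunkl_drift_kernel Rp k lam"

lemma Kt_eq: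
  assumes t: "t > 0"
  shows "Kt t x = density lborel (\<lambda>y. ennreal (normalizer t x * free_density t x y * K y lam))"
proof -
  have s: "inverse (sqrt t) *\<^sub>R inverse (sqrt t) *\<^sub>R y = y /\<^sub>R t" for y :: "real^'n"
    using t by (simp add: real_sqrt_mult_self flip: inverse_mult_distrib)
  have "K (x /\<^sub>R sqrt t) (y /\<^sub>R sqrt t) = K x (y /\<^sub>R t)" for y
    unfolding K_scale s ..
  moreover have "exp (- ((norm x)\<^sup>2 + (norm y)\<^sup>2) / (2 * t)) = exp (- (norm x)\<^sup>2 / (2 * t)) * exp (- (norm y)\<^sup>2 / (2 * t))" for y :: "real^'n"
    by (simp add: exp_add[symmetric] add_divide_distrib diff_divide_distrib)
  ultimately show ?thesis
    unfolding dunkl_drift_kernel_def dunkl_kernel_eq normalizer_def free_density_def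
    by (simp only: divide_inverse mult_ac)
qed

lemma Kt_prob_algebra: "t > 0 \<Longrightarrow> Kt t \<in> borel \<rightarrow>\<^sub>M prob_algebra borel"
  using feller unfolding feller_semigroup_def by blast

lemma prob_space_Kt: "t > 0 \<Longrightarrow> prob_space (Kt t x)" and sets_Kt: "t > 0 \<Longrightarrow> sets (Kt t x) = sets borel"
  using measurable_space[OF Kt_prob_algebra, of t x] by (auto simp: space_prob_algebra)

lemma Chapman_Kolmogorov: "s > 0 \<Longrightarrow> t > 0 \<Longrightarrow> Kt (s + t) x = Kt s x \<bind> Kt t"
  using feller unfolding feller_semigroup_def by blast

lemma normalizer_pos:
  assumes t: "t > 0" shows "0 < normalizer t x"
proof -
  have "0 \<le> dunkl_const Rp k"
    unfolding dunkl_const_def by (intro divide_nonneg_nonneg Bochner_Integration.integral_nonneg mult_nonneg_nonneg dunkl_weight_nonneg) auto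
  then have "0 \<le> normalizer t x" using K_pos[of x lam] by (auto simp: normalizer_def intro!: mult_nonneg_nonneg divide_nonneg_nonneg)
  moreover have "normalizer t x \<noteq> 0"
  proof
    assume "normalizer t x = 0"
    then have "Kt t x = density lborel (\<lambda>_. 0)" unfolding Kt_eq[OF t] by simp
    then have "emeasure (Kt t x) (space (Kt t x)) = 0" by (simp add: emeasure_density)
    then show False using prob_space.emeasure_space_1[OF prob_space_Kt[OF t, of x]] by simp
  qed
  ultimately show ?thesis by linarith
qed

lemma Kt_density_integrable:
  assumes t: "t > 0"
  shows "integrable lborel (\<lambda>y. normalizer t x * free_density t x y * K y lam)"
    and "(LINT y|lborel. normalizer t x * free_density t x y * K y lam) = 1"
proof -
  let ?q = "\<lambda>y. normalizer t x * free_density t x y * K y lam"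
  have nn: "0 \<le> ?q y" for y
    using normalizer_pos[OF t, of x] free_density_nonneg[of t x y] K_pos[of y lam] by simp
  have "emeasure (Kt t x) (space (Kt t x)) = 1" by (rule prob_space.emeasure_space_1[OF prob_space_Kt[OF t]])
  then have one: "(\<integral>\<^sup>+y. ennreal (?q y) \<partial>lborel) = 1"
    unfolding Kt_eq[OF t] by (simp add: emeasure_density)
  then show i: "integrable lborel ?q"
    by (intro integrableI_nonneg AE_I2 nn) auto
  have "ennreal (LINT y|lborel. ?q y) = 1"
    using one nn_integral_eq_integral[OF i AE_I2[OF nn]] by simp
  then show "(LINT y|lborel. ?q y) = 1"
    by (simp only: ennreal_eq_1)
qed

text \<open>Completing the square with half of the Gaussian.\<close>

lemma gaussian_exponent: "t > 0 \<Longrightarrow> b * r - r\<^sup>2 / (2 * t) \<le> t * b\<^sup>2 - r\<^sup>2 / (4 * t)" for b r t :: real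
proof -
  assume t: "t > 0"
  have "0 \<le> (r - 2 * t * b)\<^sup>2 / (4 * t)" using t by simp
  also have "\<dots> = r\<^sup>2 / (4 * t) - b * r + t * b\<^sup>2" using t by (simp add: power2_eq_square field_simps)
  finally have "0 \<le> r\<^sup>2 / (4 * t) - b * r + t * b\<^sup>2" .
  moreover have "r\<^sup>2 / (2 * t) = r\<^sup>2 / (4 * t) + r\<^sup>2 / (4 * t)" using t by (simp add: field_simps)
  ultimately show "b * r - r\<^sup>2 / (2 * t) \<le> t * b\<^sup>2 - r\<^sup>2 / (4 * t)" by linarith
qed

text \<open>Exponential moments at time \<open>t\<close> are dominated by a multiple of the density at time \<open>2 t\<close> started from the
origin, which is integrable because the transition kernels are normalized.\<close>

lemma free_density_exp_integrable:
  assumes t: "t > 0"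
  shows "integrable lborel (\<lambda>y. exp (a * norm y) * free_density t x y)"
proof -
  \<comment> \<open>the growth rates of the integrand, of \<open>K x (y / t)\<close>, and of the lower bound for \<open>K y lam\<close>\<close>
  define b where "b = a + norm x / t + norm lam"
  define M where "M = exp (t * b\<^sup>2) / normalizer (2 * t) 0"
  have t2: "2 * t > 0" using t by simp
  have "integrable lborel (\<lambda>y. M * (normalizer (2 * t) 0 * free_density (2 * t) 0 y * K y lam))"
    by (intro integrable_mult_right Kt_density_integrable[OF t2])
  then show ?thesis
  proof (rule Bochner_Integration.integrable_bound)
    show "AE y in lborel. norm (exp (a * norm y) * free_density t x y) \<le> norm (M * (normalizer (2 * t) 0 * free_density (2 * t) 0 y * K y lam))"
    proof (rule AE_I2)
      fix y :: "real^'n"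
      have K0: "K 0 m = 1" for m by (rule K_zero)
      have "exp (a * norm y) * free_density t x y
        = (exp (a * norm y - (norm y)\<^sup>2 / (2 * t)) * K x (y /\<^sub>R t)) * dunkl_weight Rp k y"
        by (simp add: free_density_def exp_diff exp_minus field_simps)
      also have "\<dots> \<le> (exp (a * norm y - (norm y)\<^sup>2 / (2 * t)) * exp (norm x * norm y / t)) * dunkl_weight Rp k y"
        using K_upper[of x "y /\<^sub>R t"] t
        by (intro mult_right_mono mult_left_mono dunkl_weight_nonneg) (auto simp: field_simps)
      also have "exp (a * norm y - (norm y)\<^sup>2 / (2 * t)) * exp (norm x * norm y / t)
         = exp (b * norm y - (norm y)\<^sup>2 / (2 * t)) * exp (- (norm y * norm lam))"
        unfolding b_def exp_add[symmetric] by (simp add: algebra_simps)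
      also have "\<dots> \<le> exp (t * b\<^sup>2 - (norm y)\<^sup>2 / (4 * t)) * K y lam"
        using K_lower[of y lam] gaussian_exponent[OF t, of b "norm y"] by (intro mult_mono) auto
      finally have "exp (a * norm y) * free_density t x y \<le> exp (t * b\<^sup>2 - (norm y)\<^sup>2 / (4 * t)) * K y lam * dunkl_weight Rp k y"
        using dunkl_weight_nonneg[of Rp k y] by (meson mult_right_mono order_trans)
      also have "\<dots> = M * (normalizer (2 * t) 0 * free_density (2 * t) 0 y * K y lam)"
        using normalizer_pos[OF t2, of 0] by (simp add: M_def free_density_def K0 exp_diff exp_minus field_simps)
      finally show "norm (exp (a * norm y) * free_density t x y) \<le> norm (M * (normalizer (2 * t) 0 * free_density (2 * t) 0 y * K y lam))"
        using free_density_nonneg[of t x y] by simp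
    qed
  qed measurable
qed

lemma free_density_dominated:
  assumes t: "t > 0" and [measurable]: "h \<in> borel_measurable borel" and b: "\<And>y. \<bar>h y\<bar> \<le> C * exp (a * norm y)"
  shows "integrable lborel (\<lambda>y. free_density t x y * h y)"
proof (rule Bochner_Integration.integrable_bound[OF integrable_mult_right[OF free_density_exp_integrable[OF t, of a x], of C]])
  show "AE y in lborel. norm (free_density t x y * h y) \<le> norm (C * (exp (a * norm y) * free_density t x y))"
  proof (rule AE_I2)
    fix y
    have "norm (free_density t x y * h y) \<le> free_density t x y * (C * exp (a * norm y))"
      using free_density_nonneg[of t x y] b[of y] by (simp add: abs_mult mult_left_mono)
    also have "\<dots> \<le> norm (C * (exp (a * norm y) * free_density t x y))"
      using abs_ge_self[of "C * (exp (a * norm y) * free_density t x y)"] by (simp add: mult_ac)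
    finally show "norm (free_density t x y * h y) \<le> norm (C * (exp (a * norm y) * free_density t x y))" .
  qed
qed measurable

lemma exp_bounds:
  "norm y \<le> exp (norm (y::real^'n))" "(norm y)\<^sup>2 \<le> exp (2 * norm (y::real^'n))"
proof -
  show 1: "norm y \<le> exp (norm y)" using exp_ge_add_one_self[of "norm y"] by linarith
  have "(norm y)\<^sup>2 \<le> (exp (norm y))\<^sup>2" by (rule power_mono[OF 1]) simp
  then show "(norm y)\<^sup>2 \<le> exp (2 * norm y)" by (simp add: exp_double)
qed

lemma K_exp_bound:
  assumes "norm m \<le> r"
  shows "\<bar>K y m\<bar> \<le> exp (r * norm y)" "\<bar>K1 b y m\<bar> \<le> norm b * exp ((r + 1) * norm y)"
    "\<bar>K2 b c y m\<bar> \<le> norm b * norm c * exp ((r + 2) * norm y)"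
proof -
  have K: "K y m \<le> exp (r * norm y)"
  proof -
    have "norm y * norm m \<le> r * norm y" using mult_right_mono[OF assms norm_ge_zero[of y]] by (simp add: mult.commute)
    then have "exp (norm y * norm m) \<le> exp (r * norm y)" by simp
    with K_upper[of y m] show ?thesis by (rule order_trans)
  qed
  then show "\<bar>K y m\<bar> \<le> exp (r * norm y)" using K_pos[of y m] by simp
  have "norm y * K y m \<le> exp (norm y) * exp (r * norm y)"
    using K K_pos[of y m] by (intro mult_mono exp_bounds) auto
  then have "norm b * (norm y * K y m) \<le> norm b * exp ((r + 1) * norm y)"
    by (intro mult_left_mono) (auto simp: algebra_simps simp flip: exp_add)
  then show "\<bar>K1 b y m\<bar> \<le> norm b * exp ((r + 1) * norm y)" using K1_bound[of b y m] by (simp add: mult.assoc)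
  have "(norm y)\<^sup>2 * K y m \<le> exp (2 * norm y) * exp (r * norm y)"
    using K K_pos[of y m] by (intro mult_mono exp_bounds) auto
  then have "norm b * norm c * ((norm y)\<^sup>2 * K y m) \<le> norm b * norm c * exp ((r + 2) * norm y)"
    by (intro mult_left_mono) (auto simp: algebra_simps simp flip: exp_add)
  then show "\<bar>K2 b c y m\<bar> \<le> norm b * norm c * exp ((r + 2) * norm y)" using K2_bound[of b c y m] by (simp add: mult.assoc)
qed

lemma free_density_K_integrable:
  assumes t: "t > 0"
  shows "integrable lborel (\<lambda>y. free_density t x y * K y m)"
    "integrable lborel (\<lambda>y. free_density t x y * K1 b y m)"
    "integrable lborel (\<lambda>y. free_density t x y * K2 b c y m)"
  using K_exp_bound[OF order_refl, where m = m]
  by (intro free_density_dominated[OF t, where C = 1 and a = "norm m"], simp, simp,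
      intro free_density_dominated[OF t, where C = "norm b" and a = "norm m + 1"], simp, simp,
      intro free_density_dominated[OF t, where C = "norm b * norm c" and a = "norm m + 2"], simp, simp)

lemma free_density_integral_continuous:
  assumes t: "t > 0"
  shows "continuous_on UNIV (\<lambda>m. LINT y|lborel. free_density t x y * K y m)"
  unfolding continuous_on_sequentially
proof (intro ballI allI impI)
  fix X :: "nat \<Rightarrow> real^'n" and m assume X: "(\<forall>n. X n \<in> UNIV) \<and> X \<longlonglongrightarrow> m"
  then obtain r where r: "\<And>n. norm (X n) \<le> r"
    using convergent_imp_Bseq[of X] unfolding convergent_def Bseq_def by blast
  show "((\<lambda>m. LINT y|lborel. free_density t x y * K y m) \<circ> X) \<longlonglongrightarrow> (LINT y|lborel. free_density t x y * K y m)"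
    unfolding o_def
  proof (rule integral_dominated_convergence[where w = "\<lambda>y. exp (r * norm y) * free_density t x y"])
    show "integrable lborel (\<lambda>y. exp (r * norm y) * free_density t x y)" by (rule free_density_exp_integrable[OF t])
    show "AE y in lborel. (\<lambda>n. free_density t x y * K y (X n)) \<longlonglongrightarrow> free_density t x y * K y m"
    proof (rule AE_I2, rule tendsto_mult_left)
      fix y
      have "isCont (\<lambda>m. K y m) m"
        using continuous_on_rpart[OF kernel_entire_series, of UNIV "\<lambda>_. y" "\<lambda>m. m"] by (simp add: continuous_on_eq_continuous_at)
      then show "(\<lambda>n. K y (X n)) \<longlonglongrightarrow> K y m" using X isCont_tendsto_compose by blast
    qed
    show "AE y in lborel. norm (free_density t x y * K y (X n)) \<le> exp (r * norm y) * free_density t x y" for n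
      using K_exp_bound(1)[OF r[of n]] free_density_nonneg[of t x]
      by (intro AE_I2) (simp add: abs_mult mult.commute[of "free_density t x _"] mult_right_mono)
  qed measurable
qed

end

context dunkl_drift
begin

definition normalizer0 :: "real \<Rightarrow> real" where
  "normalizer0 t = dunkl_const Rp k * exp (- (norm lam)\<^sup>2 * t / 2) / t powr (dunkl_gamma Rp k + real CARD('n) / 2)"

lemma normalizer_eq: "normalizer t x = normalizer0 t * exp (- (norm x)\<^sup>2 / (2 * t)) / K x lam"
  by (simp add: normalizer_def normalizer0_def)

text \<open>Tonelli's theorem turns the composition of kernels into a density.\<close>

lemma Chapman_Kolmogorov_density:
  assumes s: "s > 0" and t: "t > 0"
  shows "AE z in lborel. ennreal (normalizer (s + t) x * free_density (s + t) x z * K z lam) =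
    (\<integral>\<^sup>+y. ennreal (normalizer s x * free_density s x y * K y lam) * ennreal (normalizer t y * free_density t y z * K z lam) \<partial>lborel)"
proof -
  let ?q = "\<lambda>t x y. ennreal (normalizer t x * free_density t x y * K y lam)"
  have m2[measurable]: "(\<lambda>v. ?q t (fst v) (snd v)) \<in> borel_measurable (lborel \<Otimes>\<^sub>M lborel)" by measurable
  have m2': "(\<lambda>(y, z). ?q s x y * ?q t y z) \<in> borel_measurable (lborel \<Otimes>\<^sub>M lborel)"
    by (simp add: case_prod_beta') measurable
  have "density lborel (?q (s + t) x) = Kt s x \<bind> Kt t"
    using Chapman_Kolmogorov[OF s t, of x] Kt_eq[of "s + t" x] s t by simp
  also have "\<dots> = density lborel (\<lambda>z. \<integral>\<^sup>+y. ?q s x y * ?q t y z \<partial>lborel)"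
  proof (rule measure_eqI)
    have ne: "space (Kt s x) \<noteq> {}" using prob_space.not_empty[OF prob_space_Kt[OF s]] .
    have sub: "Kt t \<in> Kt s x \<rightarrow>\<^sub>M subprob_algebra borel"
      using measurable_prob_algebraD[OF Kt_prob_algebra[OF t]] measurable_cong_sets[OF sets_Kt[OF s, of x] refl] by blast
    show "sets (Kt s x \<bind> Kt t) = sets (density lborel (\<lambda>z. \<integral>\<^sup>+y. ?q s x y * ?q t y z \<partial>lborel))"
      using sets_bind[of "Kt s x" "Kt t" borel] ne sets_Kt[OF t] by simp
    fix A assume "A \<in> sets (Kt s x \<bind> Kt t)"
    then have A: "A \<in> sets borel" using sets_bind[of "Kt s x" "Kt t" borel] ne sets_Kt[OF t] by simp
    have "emeasure (Kt s x \<bind> Kt t) A = (\<integral>\<^sup>+y. emeasure (Kt t y) A \<partial>Kt s x)"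
      by (rule emeasure_bind[OF ne sub A])
    also have "\<dots> = (\<integral>\<^sup>+y. ?q s x y * emeasure (Kt t y) A \<partial>lborel)"
    proof -
      have "(\<lambda>y. emeasure (Kt t y) A) \<in> borel_measurable lborel"
        using measurable_emeasure_kernel[OF measurable_prob_algebraD[OF Kt_prob_algebra[OF t]] A] by simp
      then show ?thesis unfolding Kt_eq[OF s] by (subst nn_integral_density) auto
    qed
    also have "\<dots> = (\<integral>\<^sup>+y. \<integral>\<^sup>+z. ?q s x y * ?q t y z * indicator A z \<partial>lborel \<partial>lborel)"
    proof (rule nn_integral_cong)
      fix y
      have "emeasure (Kt t y) A = (\<integral>\<^sup>+z. ?q t y z * indicator A z \<partial>lborel)"
        unfolding Kt_eq[OF t] using A by (subst emeasure_density) auto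
      then show "?q s x y * emeasure (Kt t y) A = (\<integral>\<^sup>+z. ?q s x y * ?q t y z * indicator A z \<partial>lborel)"
        using A by (simp add: mult.assoc nn_integral_cmult)
    qed
    also have "\<dots> = (\<integral>\<^sup>+z. \<integral>\<^sup>+y. ?q s x y * ?q t y z * indicator A z \<partial>lborel \<partial>lborel)"
      using A by (intro lborel_pair.Fubini') (simp add: case_prod_beta', measurable)
    also have "\<dots> = (\<integral>\<^sup>+z. (\<integral>\<^sup>+y. ?q s x y * ?q t y z \<partial>lborel) * indicator A z \<partial>lborel)"
      by (intro nn_integral_cong nn_integral_multc) measurable
    also have "\<dots> = emeasure (density lborel (\<lambda>z. \<integral>\<^sup>+y. ?q s x y * ?q t y z \<partial>lborel)) A"
      using A lborel.borel_measurable_nn_integral_fst[OF m2'[THEN measurable_pair_swap]] 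
      by (subst emeasure_density) (auto simp: case_prod_beta')
    finally show "emeasure (Kt s x \<bind> Kt t) A = emeasure (density lborel (\<lambda>z. \<integral>\<^sup>+y. ?q s x y * ?q t y z \<partial>lborel)) A" .
  qed
  finally show ?thesis
    using lborel.borel_measurable_nn_integral_fst[OF m2'[THEN measurable_pair_swap]]
    by (subst (asm) sigma_finite_measure.density_unique_iff[OF sigma_finite_lborel]) (auto simp: case_prod_beta')
qed

text \<open>The Chapman-Kolmogorov equation with both times \<open>2 t\<close>, started from \<open>2 x\<close>. At the intermediate point the
Gaussians combine to time \<open>t\<close> and the factors \<open>K y lam\<close> cancel; the end point \<open>z\<close> enters through
\<open>m = z / (2 t)\<close>. The relation holds for almost every \<open>z\<close>, hence by continuity for all. Only the
shape of the right-hand side matters here; the constant is fixed by normalization afterwards.\<close>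

lemma free_density_laplace:
  assumes t: "t > 0"
  shows "\<exists>D. \<forall>m. (LINT y|lborel. free_density t x y * K y m) = D * exp (t * (m \<bullet> m) / 2) * K x m"
proof -
  have t2: "2 * t > 0" and t4: "4 * t > 0" using t by auto
  define X where "X = 2 *\<^sub>R x"
  define J where "J = (\<lambda>m. LINT y|lborel. free_density t x y * K y m)"
  define N where "N = normalizer (2 * t) X * normalizer0 (2 * t)"
  define D where "D = normalizer (4 * t) X / N"
  have n0: "normalizer0 (2 * t) > 0"
    using normalizer_pos[OF t2, of 0] K_pos[of 0 lam] by (simp add: normalizer_eq zero_less_divide_iff zero_less_mult_iff)
  have N: "N > 0" using n0 normalizer_pos[OF t2, of X] by (simp add: N_def)
  have J0: "0 \<le> J m" for m
    unfolding J_def using free_density_nonneg[of t x] K_pos by (intro Bochner_Integration.integral_nonneg mult_nonneg_nonneg) (auto intro: less_imp_le)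
  have "AE z in lborel. ennreal (normalizer (2 * t + 2 * t) X * free_density (2 * t + 2 * t) X z * K z lam) =
    (\<integral>\<^sup>+y. ennreal (normalizer (2 * t) X * free_density (2 * t) X y * K y lam) * ennreal (normalizer (2 * t) y * free_density (2 * t) y z * K z lam) \<partial>lborel)"
    by (rule Chapman_Kolmogorov_density[OF t2 t2])
  then have "AE z in lborel. J (z /\<^sub>R (2 * t)) = D * exp ((norm z)\<^sup>2 / (8 * t)) * K x (z /\<^sub>R (2 * t))"
    using AE_dunkl_weight_pos
  proof eventually_elim
    case (elim z)
    \<comment> \<open>the factors that depend on the end point only\<close>
    define c where "c = N * exp (- (norm z)\<^sup>2 / (2 * (2 * t))) * dunkl_weight Rp k z * K z lam"
    have c: "c > 0" using N elim(2) K_pos[of z lam] by (simp add: c_def)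
    have Xs: "K X (y /\<^sub>R (2 * t)) = K x (y /\<^sub>R t)" for y using t by (simp add: X_def K_scale)
    have Xs4: "K X (z /\<^sub>R (4 * t)) = K x (z /\<^sub>R (2 * t))" using t by (simp add: X_def K_scale)
    have pt: "(normalizer (2 * t) X * free_density (2 * t) X y * K y lam) * (normalizer (2 * t) y * free_density (2 * t) y z * K z lam)
      = c * (free_density t x y * K y (z /\<^sub>R (2 * t)))" for y
    proof -
      have e: "exp (- (norm y)\<^sup>2 / (2 * (2 * t))) * exp (- (norm y)\<^sup>2 / (2 * (2 * t))) = exp (- (norm y)\<^sup>2 / (2 * t))"
        using t by (simp add: exp_add[symmetric] field_simps)
      have k0: "K y lam / K y lam = 1" using K_nonzero by simp
      have "(normalizer (2 * t) X * free_density (2 * t) X y * K y lam) * (normalizer (2 * t) y * free_density (2 * t) y z * K z lam)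
        = c * ((exp (- (norm y)\<^sup>2 / (2 * (2 * t))) * exp (- (norm y)\<^sup>2 / (2 * (2 * t)))) * K x (y /\<^sub>R t) * dunkl_weight Rp k y * K y (z /\<^sub>R (2 * t))) * (K y lam / K y lam)"
        unfolding normalizer_eq[of "2 * t" y] free_density_def[of "2 * t"] Xs c_def N_def
        by (simp only: mult_ac divide_inverse)
      then show ?thesis unfolding e k0 by (simp add: free_density_def)
    qed
    have q0: "0 \<le> normalizer (2 * t) X * free_density (2 * t) X y * K y lam" for y
      using normalizer_pos[OF t2, of X] free_density_nonneg[of "2 * t" X y] K_pos[of y lam] by simp
    have "(\<integral>\<^sup>+y. ennreal (normalizer (2 * t) X * free_density (2 * t) X y * K y lam) * ennreal (normalizer (2 * t) y * free_density (2 * t) y z * K z lam) \<partial>lborel)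
      = (\<integral>\<^sup>+y. ennreal (c * (free_density t x y * K y (z /\<^sub>R (2 * t)))) \<partial>lborel)"
      by (intro nn_integral_cong) (simp only: ennreal_mult'[OF q0, symmetric] pt)
    also have "\<dots> = ennreal (c * J (z /\<^sub>R (2 * t)))"
      unfolding J_def
      using c free_density_nonneg[of t x] K_pos
      by (subst nn_integral_eq_integral) (auto intro!: free_density_K_integrable[OF t] mult_nonneg_nonneg less_imp_le[OF K_pos])
    finally have "ennreal (normalizer (4 * t) X * free_density (4 * t) X z * K z lam) = ennreal (c * J (z /\<^sub>R (2 * t)))"
      using elim(1) by simp
    moreover have "0 \<le> normalizer (4 * t) X * free_density (4 * t) X z * K z lam"
      using normalizer_pos[OF t4, of X] free_density_nonneg[of "4 * t" X z] K_pos[of z lam] by simp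
    ultimately have "normalizer (4 * t) X * free_density (4 * t) X z * K z lam = c * J (z /\<^sub>R (2 * t))"
      using c J0 by (subst (asm) ennreal_inj) auto
    moreover have "normalizer (4 * t) X * free_density (4 * t) X z * K z lam = c * (D * exp ((norm z)\<^sup>2 / (8 * t)) * K x (z /\<^sub>R (2 * t)))"
    proof -
      have e: "exp (- (norm z)\<^sup>2 / (2 * (4 * t))) = exp (- (norm z)\<^sup>2 / (2 * (2 * t))) * exp ((norm z)\<^sup>2 / (8 * t))"
        using t by (simp add: exp_add[symmetric] field_simps)
      have nN: "N * D = normalizer (4 * t) X" using N by (simp add: D_def)
      show ?thesis
        unfolding free_density_def Xs4 c_def nN[symmetric] e by (simp only: mult_ac)
    qed
    ultimately show ?case using c by simp
  qed
  then have eq: "J (z /\<^sub>R (2 * t)) = D * exp ((norm z)\<^sup>2 / (8 * t)) * K x (z /\<^sub>R (2 * t))" for z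
  proof (rule AE_lborel_continuous_eq)
    have "continuous_on UNIV J" unfolding J_def by (rule free_density_integral_continuous[OF t])
    then show "continuous_on UNIV (\<lambda>z. J (z /\<^sub>R (2 * t)))"
      by (rule continuous_on_compose2) (auto intro!: continuous_intros)
    show "continuous_on UNIV (\<lambda>z. D * exp ((norm z)\<^sup>2 / (8 * t)) * K x (z /\<^sub>R (2 * t)))"
      using t by (intro continuous_intros kernel_entire_series) auto
  qed
  have "J m = D * exp (t * (m \<bullet> m) / 2) * K x m" for m
    using eq[of "(2 * t) *\<^sub>R m"] t by (simp add: power_mult_distrib power2_norm_eq_inner[symmetric] power2_eq_square[of t] field_simps)
  then show ?thesis unfolding J_def by blast
qed

text \<open>The constant is determined by the case \<open>m = lam\<close>, where the left-hand side is the total mass.\<close>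

lemma Kt_laplace:
  assumes t: "t > 0"
  shows "normalizer t x * (LINT y|lborel. free_density t x y * K y m) = exp (t * (m \<bullet> m - lam \<bullet> lam) / 2) * K x m / K x lam"
proof -
  obtain D where D: "\<And>m. (LINT y|lborel. free_density t x y * K y m) = D * exp (t * (m \<bullet> m) / 2) * K x m"
    using free_density_laplace[OF t, of x] by blast
  have "normalizer t x * D * exp (t * (lam \<bullet> lam) / 2) * K x lam = 1"
    using Kt_density_integrable(2)[OF t, of x] D[of lam] by (simp add: mult.assoc)
  then have "normalizer t x * D = exp (- (t * (lam \<bullet> lam) / 2)) / K x lam"
    using K_nonzero[of x lam] by (simp add: exp_minus field_simps)
  then show ?thesis
    unfolding D by (simp add: mult.assoc[symmetric] exp_add[symmetric] exp_minus[symmetric])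
      (simp add: exp_add[symmetric] exp_diff right_diff_distrib diff_divide_distrib exp_minus field_simps)
qed

lemma Kt_laplace_deriv1:
  assumes t: "t > 0"
  shows "normalizer t x * (LINT y|lborel. free_density t x y * K1 b y m) =
    exp (t * (m \<bullet> m - lam \<bullet> lam) / 2) * (t * (m \<bullet> b) * K x m + K1 b x m) / K x lam"
proof -
  have "((\<lambda>s. LINT y|lborel. free_density t x y * K y (m + s *\<^sub>R b)) has_real_derivative
      (LINT y|lborel. free_density t x y * K1 b y (m + 0 *\<^sub>R b))) (at 0)"
  proof (rule has_derivative_under_integral)
    show "((\<lambda>s. K y (m + s *\<^sub>R b)) has_real_derivative K1 b y (m + s *\<^sub>R b)) (at s)" for s y
      using rpart_m_line[OF kernel_differentiable, of y m b s] by (simp add: kernel1_def)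
    show "integrable lborel (\<lambda>y. free_density t x y * K y (m + s *\<^sub>R b))" for s by (rule free_density_K_integrable[OF t])
    show "integrable lborel (\<lambda>y. norm b * (exp ((norm m + norm b + 1) * norm y) * free_density t x y))"
      by (intro integrable_mult_right free_density_exp_integrable t)
    fix s :: real and y assume s: "\<bar>s\<bar> < 1"
    have "norm (m + s *\<^sub>R b) \<le> norm m + norm b"
      using norm_triangle_ineq[of m "s *\<^sub>R b"] mult_right_mono[of "\<bar>s\<bar>" 1 "norm b"] s by simp
    from mult_left_mono[OF K_exp_bound(2)[OF this, of b y] free_density_nonneg[of t x y]]
    show "\<bar>free_density t x y * K1 b y (m + s *\<^sub>R b)\<bar> \<le> norm b * (exp ((norm m + norm b + 1) * norm y) * free_density t x y)"
      using free_density_nonneg[of t x y] by (simp add: abs_mult mult_ac)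
  qed
  from DERIV_cmult[OF this, of "normalizer t x"]
  have 1: "((\<lambda>s. exp (t * ((m + s *\<^sub>R b) \<bullet> (m + s *\<^sub>R b) - lam \<bullet> lam) / 2) * K x (m + s *\<^sub>R b) / K x lam) has_real_derivative
      normalizer t x * (LINT y|lborel. free_density t x y * K1 b y m)) (at 0)"
    unfolding Kt_laplace[OF t] by simp
  have "((\<lambda>s. exp (t * ((m + s *\<^sub>R b) \<bullet> (m + s *\<^sub>R b) - lam \<bullet> lam) / 2) * K x (m + s *\<^sub>R b) / K x lam) has_real_derivative
     exp (t * (m \<bullet> m - lam \<bullet> lam) / 2) * (t * (m \<bullet> b) * K x m + K1 b x m) / K x lam) (at 0)"
    using rpart_m_line[OF kernel_differentiable, of x m b 0] K_nonzero[of x lam]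
    by (auto intro!: derivative_eq_intros simp: kernel1_def inner_add_left inner_add_right inner_commute[of b m] field_simps)
  from DERIV_unique[OF 1 this] show ?thesis .
qed

lemma Kt_laplace_deriv2:
  assumes t: "t > 0"
  shows "normalizer t x * (LINT y|lborel. free_density t x y * K2 c b y m) =
    exp (t * (m \<bullet> m - lam \<bullet> lam) / 2) * (t * (m \<bullet> c) * (t * (m \<bullet> b) * K x m + K1 b x m)
      + t * (c \<bullet> b) * K x m + t * (m \<bullet> b) * K1 c x m + K2 c b x m) / K x lam"
proof -
  have "((\<lambda>s. LINT y|lborel. free_density t x y * K1 b y (m + s *\<^sub>R c)) has_real_derivative
      (LINT y|lborel. free_density t x y * K2 c b y (m + 0 *\<^sub>R c))) (at 0)"
  proof (rule has_derivative_under_integral)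
    show "((\<lambda>s. K1 b y (m + s *\<^sub>R c)) has_real_derivative K2 c b y (m + s *\<^sub>R c)) (at s)" for s y
      using rpart_m_line[OF kernels_differentiable(2), of "cvec b" y m c s] by (simp add: kernel1_def kernel2_def)
    show "integrable lborel (\<lambda>y. free_density t x y * K1 b y (m + s *\<^sub>R c))" for s by (rule free_density_K_integrable[OF t])
    show "integrable lborel (\<lambda>y. norm c * norm b * (exp ((norm m + norm c + 2) * norm y) * free_density t x y))"
      by (intro integrable_mult_right free_density_exp_integrable t)
    fix s :: real and y assume s: "\<bar>s\<bar> < 1"
    have "norm (m + s *\<^sub>R c) \<le> norm m + norm c"
      using norm_triangle_ineq[of m "s *\<^sub>R c"] mult_right_mono[of "\<bar>s\<bar>" 1 "norm c"] s by simp
    from mult_left_mono[OF K_exp_bound(3)[OF this, of c b y] free_density_nonneg[of t x y]]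
    show "\<bar>free_density t x y * K2 c b y (m + s *\<^sub>R c)\<bar> \<le> norm c * norm b * (exp ((norm m + norm c + 2) * norm y) * free_density t x y)"
      using free_density_nonneg[of t x y] by (simp add: abs_mult mult_ac)
  qed
  from DERIV_cmult[OF this, of "normalizer t x"]
  have 1: "((\<lambda>s. exp (t * ((m + s *\<^sub>R c) \<bullet> (m + s *\<^sub>R c) - lam \<bullet> lam) / 2) * (t * ((m + s *\<^sub>R c) \<bullet> b) * K x (m + s *\<^sub>R c) + K1 b x (m + s *\<^sub>R c)) / K x lam) has_real_derivative
      normalizer t x * (LINT y|lborel. free_density t x y * K2 c b y m)) (at 0)"
    unfolding Kt_laplace_deriv1[OF t] by simp
  have "((\<lambda>s. exp (t * ((m + s *\<^sub>R c) \<bullet> (m + s *\<^sub>R c) - lam \<bullet> lam) / 2) * (t * ((m + s *\<^sub>R c) \<bullet> b) * K x (m + s *\<^sub>R c) + K1 b x (m + s *\<^sub>R c)) / K x lam) has_real_derivative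
     exp (t * (m \<bullet> m - lam \<bullet> lam) / 2) * (t * (m \<bullet> c) * (t * (m \<bullet> b) * K x m + K1 b x m)
      + t * (c \<bullet> b) * K x m + t * (m \<bullet> b) * K1 c x m + K2 c b x m) / K x lam) (at 0)"
    using rpart_m_line[OF kernel_differentiable, of x m c 0] rpart_m_line[OF kernels_differentiable(2), of "cvec b" x m c 0] K_nonzero[of x lam]
    by (auto intro!: derivative_eq_intros simp: kernel1_def kernel2_def inner_add_left inner_add_right inner_commute[of c m] field_simps)
  from DERIV_unique[OF 1 this] show ?thesis .
qed

section \<open>Moments of the transition kernels\<close>

text \<open>The moment functions along arbitrary directions; directions other than the axes are needed for the
polarization argument below.\<close>

definition m1 :: "real^'n \<Rightarrow> real^'n \<Rightarrow> real" where "m1 b x = K1 b x lam / K x lam"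
definition m2 :: "real^'n \<Rightarrow> real^'n \<Rightarrow> real^'n \<Rightarrow> real" where "m2 b c x = K2 b c x lam / K x lam"

lemma borel_measurable_m [measurable]: "m1 b \<in> borel_measurable borel" "m2 b c \<in> borel_measurable borel"
  unfolding m1_def[abs_def] m2_def[abs_def] by measurable

lemma Kt_integral:
  assumes t: "t > 0" and [measurable]: "f \<in> borel_measurable borel"
  shows "integrable (Kt t x) f \<longleftrightarrow> integrable lborel (\<lambda>y. normalizer t x * (free_density t x y * (K y lam * f y)))"
    and "(LINT y|Kt t x. f y) = (LINT y|lborel. normalizer t x * (free_density t x y * (K y lam * f y)))"
proof -
  have nn: "0 \<le> normalizer t x * free_density t x y * K y lam" for y
    using normalizer_pos[OF t, of x] free_density_nonneg[of t x y] K_pos[of y lam] by simp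
  show "integrable (Kt t x) f \<longleftrightarrow> integrable lborel (\<lambda>y. normalizer t x * (free_density t x y * (K y lam * f y)))"
    unfolding Kt_eq[OF t] by (subst integrable_density) (auto simp: mult.assoc nn[unfolded mult.assoc])
  show "(LINT y|Kt t x. f y) = (LINT y|lborel. normalizer t x * (free_density t x y * (K y lam * f y)))"
    unfolding Kt_eq[OF t] by (subst integral_density) (auto simp: mult.assoc nn[unfolded mult.assoc])
qed

lemma Kt_m1:
  assumes t: "t > 0"
  shows "integrable (Kt t x) (m1 b)" and "(LINT y|Kt t x. m1 b y) = m1 b x + t * (lam \<bullet> b)"
proof -
  have e: "K y lam * m1 b y = K1 b y lam" for y using K_nonzero by (simp add: m1_def)
  show "integrable (Kt t x) (m1 b)"
    by (subst Kt_integral[OF t]) (auto simp: e intro!: free_density_K_integrable[OF t])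
  show "(LINT y|Kt t x. m1 b y) = m1 b x + t * (lam \<bullet> b)"
  proof -
    have "(LINT y|Kt t x. m1 b y) = normalizer t x * (LINT y|lborel. free_density t x y * K1 b y lam)"
      by (simp add: Kt_integral(2)[OF t] e)
    then show ?thesis
      unfolding Kt_laplace_deriv1[OF t] using K_nonzero[of x lam] by (simp add: m1_def field_simps)
  qed
qed

lemma Kt_m2:
  assumes t: "t > 0"
  shows "integrable (Kt t x) (m2 c b)"
    and "(LINT y|Kt t x. m2 c b y) = m2 c b x + t * ((lam \<bullet> c) * m1 b x + (lam \<bullet> b) * m1 c x) + t * (c \<bullet> b) + t\<^sup>2 * (lam \<bullet> c) * (lam \<bullet> b)"
proof -
  have e: "K y lam * m2 c b y = K2 c b y lam" for y using K_nonzero by (simp add: m2_def)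
  show "integrable (Kt t x) (m2 c b)"
    by (subst Kt_integral[OF t]) (auto simp: e intro!: free_density_K_integrable[OF t])
  show "(LINT y|Kt t x. m2 c b y) = m2 c b x + t * ((lam \<bullet> c) * m1 b x + (lam \<bullet> b) * m1 c x) + t * (c \<bullet> b) + t\<^sup>2 * (lam \<bullet> c) * (lam \<bullet> b)"
  proof -
    have "(LINT y|Kt t x. m2 c b y) = normalizer t x * (LINT y|lborel. free_density t x y * K2 c b y lam)"
      by (simp add: Kt_integral(2)[OF t] e)
    then show ?thesis
      unfolding Kt_laplace_deriv2[OF t] using K_nonzero[of x lam] by (simp add: m1_def m2_def field_simps power2_eq_square)
  qed
qed

lemma m1_bound: "\<bar>m1 b x\<bar> \<le> norm b * norm x"
  using K1_bound[of b x lam] K_pos[of x lam] by (simp add: m1_def abs_divide field_simps)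

lemma m2_bound: "\<bar>m2 b c x\<bar> \<le> norm b * norm c * (norm x)\<^sup>2"
  using K2_bound[of b c x lam] K_pos[of x lam] by (simp add: m2_def abs_divide field_simps)

lemma m2_nonneg: "0 \<le> m2 b b x"
  using K2_nonneg[of b x lam] K_pos[of x lam] by (simp add: m2_def)

lemma m1_le_m2: "\<bar>m1 b x\<bar> \<le> 1 + m2 b b x"
proof -
  have "(m1 b x)\<^sup>2 \<le> m2 b b x"
    using K2_log_convex[of b x lam] K_pos[of x lam] by (simp add: m1_def m2_def power2_eq_square field_simps)
  moreover have "\<bar>a\<bar> \<le> 1 + a\<^sup>2" for a :: real
    using zero_le_power2[of "\<bar>a\<bar> - 1"] zero_le_power2[of a] by (simp add: power2_diff)
  ultimately show ?thesis using order_trans[of "\<bar>m1 b x\<bar>" "1 + (m1 b x)\<^sup>2"] by simp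
qed

text \<open>Nonnegativity of the second derivatives along \<open>b + c\<close> and \<open>c - b\<close>. This dominates mixed moments by pure
ones, for which integrability is a matter of Tonelli's theorem.\<close>

lemma m2_polarization: "2 * \<bar>m2 b c x\<bar> \<le> m2 b b x + m2 c c x"
proof -
  have add1: "K2 (a + b) c x m = K2 a c x m + K2 b c x m" for a b c m
    using dir_deriv_add_direction[OF kernels_differentiable(2), of "(0, cvec a)" "(0, cvec b)"]
    by (simp add: rpart_def kernel1_def kernel2_def cvec_add)
  have sym: "K2 a c x m = K2 c a x m" for a c m
    using entire_series_commute[OF kernel_entire_series] by (simp add: kernel2_def)
  have sum: "K2 (a + c) (a + c) x m = K2 a a x m + 2 * K2 a c x m + K2 c c x m" for a c m
    using add1[of a c "a + c" m] sym[of a "a + c"] sym[of c "a + c"] add1[of a c a m] add1[of a c c m] sym[of c a] by simp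
  have "0 \<le> K2 b b x lam + 2 * K2 b c x lam + K2 c c x lam"
    using K2_nonneg[of "b + c" x lam] unfolding sum .
  moreover have "0 \<le> K2 b b x lam - 2 * K2 b c x lam + K2 c c x lam"
    using K2_nonneg[of "- b + c" x lam] sym[of "- b" "- b"] unfolding sum
    by (simp add: K2_minus) (metis K2_minus sym minus_minus)
  ultimately have "2 * \<bar>K2 b c x lam\<bar> \<le> K2 b b x lam + K2 c c x lam" by linarith
  then show ?thesis
    using K_pos[of x lam] by (simp add: m2_def abs_divide field_simps)
qed

end

section \<open>Conditional expectations along the process\<close>

lemma space_canonical_filtration: "space (canonical_filtration M X t) = space M"
  by (simp add: canonical_filtration_def space_measure_of_conv)

lemma sets_canonical_filtration:
  "sets (canonical_filtration M X t) =
    sigma_sets (space M) {X u -` A \<inter> space M | u A. 0 \<le> u \<and> u \<le> t \<and> A \<in> sets borel}"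
  unfolding canonical_filtration_def by (rule sets_measure_of) auto

lemma subalgebra_canonical_filtration:
  assumes "\<And>u. 0 \<le> u \<Longrightarrow> X u \<in> borel_measurable M"
  shows "subalgebra M (canonical_filtration M X t)"
  unfolding subalgebra_def space_canonical_filtration sets_canonical_filtration
  using assms by (auto intro!: sets.sigma_sets_subset measurable_sets)

lemma measurable_canonical_filtration:
  fixes X :: "real \<Rightarrow> 'a \<Rightarrow> real^'n"
  assumes "0 \<le> u" "u \<le> t"
  shows "X u \<in> canonical_filtration M X t \<rightarrow>\<^sub>M borel"
proof (rule measurableI)
  fix A :: "(real^'n) set" assume "A \<in> sets borel"
  then show "X u -` A \<inter> space (canonical_filtration M X t) \<in> sets (canonical_filtration M X t)"
    unfolding space_canonical_filtration sets_canonical_filtration using assms by (intro sigma_sets.Basic) blast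
qed auto

text \<open>The Markov property for indicators, extended to functions: for a fixed past event \<open>B\<close> both sides are
integrals of \<open>f\<close> with respect to one measure, once as a push-forward and once as a mixture.\<close>

lemma feller_process_nn_integral:
  fixes X :: "real \<Rightarrow> 'a \<Rightarrow> real^'n"
  assumes FP: "feller_process Q M X" and s: "0 \<le> s" and t: "0 < t"
    and B: "B \<in> sets (canonical_filtration M X s)" and f[measurable]: "f \<in> borel_measurable borel"
  shows "(\<integral>\<^sup>+\<omega>. f (X (s + t) \<omega>) * indicator B \<omega> \<partial>M) = (\<integral>\<^sup>+\<omega>. (\<integral>\<^sup>+y. f y \<partial>Q t (X s \<omega>)) * indicator B \<omega> \<partial>M)"
proof -
  interpret prob_space M using FP by (simp add: feller_process_def)
  have X: "X u \<in> borel_measurable M" if "0 \<le> u" for u using FP that by (simp add: feller_process_def)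
  note sub = subalgebra_canonical_filtration[of X M, OF X]
  interpret finite_measure_subalgebra M "canonical_filtration M X s"
    by unfold_locales (rule sub)
  have BM[measurable]: "B \<in> sets M" using B sub[of s] by (auto simp: subalgebra_def)
  have [measurable]: "X (s + t) \<in> borel_measurable M" "X s \<in> borel_measurable M" using s t by (auto intro: X)
  have Q: "Q t \<in> borel \<rightarrow>\<^sub>M prob_algebra borel" using FP t by (auto simp: feller_process_def feller_semigroup_def)
  have Qp: "prob_space (Q t x)" "sets (Q t x) = sets borel" for x
    using measurable_space[OF Q, of x] by (auto simp: space_prob_algebra)
  have QX: "(\<lambda>\<omega>. Q t (X s \<omega>)) \<in> M \<rightarrow>\<^sub>M subprob_algebra borel"
    by (rule measurable_compose[OF _ measurable_prob_algebraD[OF Q]]) simp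
  let ?D = "density M (indicator B)"
  have QX': "(\<lambda>\<omega>. Q t (X s \<omega>)) \<in> ?D \<rightarrow>\<^sub>M subprob_algebra borel" using QX by simp
  have ne: "space ?D \<noteq> {}" using not_empty by simp
  have "distr ?D borel (X (s + t)) = ?D \<bind> (\<lambda>\<omega>. Q t (X s \<omega>))"
  proof (rule measure_eqI)
    show sets: "sets (distr ?D borel (X (s + t))) = sets (?D \<bind> (\<lambda>\<omega>. Q t (X s \<omega>)))"
      using sets_bind[of ?D "\<lambda>\<omega>. Q t (X s \<omega>)" borel] ne Qp(2) by simp
    fix A :: "(real^'n) set" assume "A \<in> sets (distr ?D borel (X (s + t)))"
    then have A[measurable]: "A \<in> sets borel" by simp
    define q where "q = (\<lambda>\<omega>. measure (Q t (X s \<omega>)) A)"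
    have qm[measurable]: "q \<in> borel_measurable M"
      unfolding q_def by (rule measurable_compose[OF QX measurable_measure_subprob_algebra[OF A]])
    have q01: "0 \<le> q \<omega>" "q \<omega> \<le> 1" for \<omega> unfolding q_def using prob_space.prob_le_1[OF Qp(1)] by auto
    have qi: "integrable M (\<lambda>\<omega>. q \<omega> * indicator B \<omega>)"
      by (rule integrable_const_bound[where B = 1]) (use q01 in \<open>auto simp: indicator_def\<close>)
    have ii: "integrable M (\<lambda>\<omega>. indicator A (X (s + t) \<omega>) :: real)"
      by (rule integrable_const_bound[where B = 1]) (auto simp: indicator_def)
    have ii': "integrable M (\<lambda>\<omega>. indicator A (X (s + t) \<omega>) * indicator B \<omega> :: real)"
      by (rule integrable_const_bound[where B = 1]) (auto simp: indicator_def)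
    have ce: "AE \<omega> in M. real_cond_exp M (canonical_filtration M X s) (\<lambda>\<omega>'. indicator A (X (s + t) \<omega>')) \<omega> = q \<omega>"
      using FP s t A unfolding feller_process_def q_def by blast
    have "(\<integral>\<omega>\<in>B. indicator A (X (s + t) \<omega>) \<partial>M) = (\<integral>\<omega>\<in>B. real_cond_exp M (canonical_filtration M X s) (\<lambda>\<omega>'. indicator A (X (s + t) \<omega>')) \<omega> \<partial>M)"
      by (rule real_cond_exp_intA[OF ii B])
    also have "\<dots> = (\<integral>\<omega>\<in>B. q \<omega> \<partial>M)"
      unfolding set_lebesgue_integral_def
      using ce by (intro integral_cong_AE) (auto intro: borel_measurable_cond_exp2 borel_measurable_scaleR)
    finally have eq: "(LINT \<omega>|M. indicator A (X (s + t) \<omega>) * indicator B \<omega>) = (LINT \<omega>|M. q \<omega> * indicator B \<omega>)"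
      by (simp add: set_lebesgue_integral_def mult.commute)
    have "emeasure (distr ?D borel (X (s + t))) A = (\<integral>\<^sup>+\<omega>. indicator A (X (s + t) \<omega>) * indicator B \<omega> \<partial>M)"
      by (subst nn_integral_indicator[symmetric], simp, subst nn_integral_distr, simp, simp, subst nn_integral_density)
        (auto simp: mult.commute)
    also have "\<dots> = (\<integral>\<^sup>+\<omega>. ennreal (indicator A (X (s + t) \<omega>) * indicator B \<omega>) \<partial>M)"
      by (intro nn_integral_cong) (auto simp: indicator_def)
    also have "\<dots> = ennreal (LINT \<omega>|M. indicator A (X (s + t) \<omega>) * indicator B \<omega>)"
      by (rule nn_integral_eq_integral[OF ii']) auto
    also have "\<dots> = (\<integral>\<^sup>+\<omega>. ennreal (q \<omega> * indicator B \<omega>) \<partial>M)"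
      unfolding eq by (rule nn_integral_eq_integral[OF qi, symmetric]) (use q01 in auto)
    also have "\<dots> = (\<integral>\<^sup>+\<omega>. indicator B \<omega> * emeasure (Q t (X s \<omega>)) A \<partial>M)"
    proof (intro nn_integral_cong)
      fix \<omega>
      interpret Qx: prob_space "Q t (X s \<omega>)" by (rule Qp(1))
      show "ennreal (q \<omega> * indicator B \<omega>) = indicator B \<omega> * emeasure (Q t (X s \<omega>)) A"
        by (auto simp: indicator_def q_def Qx.emeasure_eq_measure)
    qed
    also have "\<dots> = (\<integral>\<^sup>+\<omega>. emeasure (Q t (X s \<omega>)) A \<partial>?D)"
      by (rule nn_integral_density[symmetric]) (use measurable_emeasure_kernel[OF QX A] in auto)
    also have "\<dots> = emeasure (?D \<bind> (\<lambda>\<omega>. Q t (X s \<omega>))) A"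
      by (rule emeasure_bind[OF ne QX' A, symmetric])
    finally show "emeasure (distr ?D borel (X (s + t))) A = emeasure (?D \<bind> (\<lambda>\<omega>. Q t (X s \<omega>))) A" .
  qed
  then have "(\<integral>\<^sup>+y. f y \<partial>distr ?D borel (X (s + t))) = (\<integral>\<^sup>+y. f y \<partial>(?D \<bind> (\<lambda>\<omega>. Q t (X s \<omega>))))" by simp
  also have "\<dots> = (\<integral>\<^sup>+\<omega>. \<integral>\<^sup>+y. f y \<partial>Q t (X s \<omega>) \<partial>?D)" by (rule nn_integral_bind[OF f QX'])
  also have "\<dots> = (\<integral>\<^sup>+\<omega>. indicator B \<omega> * (\<integral>\<^sup>+y. f y \<partial>Q t (X s \<omega>)) \<partial>M)"
    by (rule nn_integral_density)
      (auto intro: measurable_compose[OF QX nn_integral_measurable_subprob_algebra[OF f]])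
  also have "(\<integral>\<^sup>+y. f y \<partial>distr ?D borel (X (s + t))) = (\<integral>\<^sup>+\<omega>. indicator B \<omega> * f (X (s + t) \<omega>) \<partial>M)"
    by (subst nn_integral_distr, simp, simp, subst nn_integral_density) auto
  finally show ?thesis by (simp add: mult.commute)
qed

text \<open>For nonnegative \<open>h\<close> integrability at time \<open>s + t\<close> is a consequence of integrability at time \<open>s\<close>.\<close>

lemma feller_process_nonneg_integral:
  fixes h g :: "real^'n \<Rightarrow> real"
  assumes FP: "feller_process Q M X" and s: "0 \<le> s" and t: "0 < t"
    and [measurable]: "h \<in> borel_measurable borel" "g \<in> borel_measurable borel"
    and h: "\<And>y. 0 \<le> h y" and hi: "\<And>x. integrable (Q t x) h" and g: "\<And>x. (LINT y|Q t x. h y) = g x"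
    and gi: "integrable M (\<lambda>\<omega>. g (X s \<omega>))"
  shows "integrable M (\<lambda>\<omega>. h (X (s + t) \<omega>))"
    and "B \<in> sets (canonical_filtration M X s) \<Longrightarrow> (\<integral>\<omega>\<in>B. h (X (s + t) \<omega>) \<partial>M) = (\<integral>\<omega>\<in>B. g (X s \<omega>) \<partial>M)"
proof -
  have X: "X u \<in> borel_measurable M" if "0 \<le> u" for u using FP that by (simp add: feller_process_def)
  have [measurable]: "X (s + t) \<in> borel_measurable M" "X s \<in> borel_measurable M" using s t by (auto intro: X)
  have g0: "0 \<le> g x" for x unfolding g[symmetric] by (simp add: h)
  have eq: "(\<integral>\<^sup>+\<omega>. ennreal (h (X (s + t) \<omega>) * indicator B \<omega>) \<partial>M) = (\<integral>\<^sup>+\<omega>. ennreal (g (X s \<omega>) * indicator B \<omega>) \<partial>M)"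
    if "B \<in> sets (canonical_filtration M X s)" for B
  proof -
    have "(\<integral>\<^sup>+\<omega>. ennreal (h (X (s + t) \<omega>) * indicator B \<omega>) \<partial>M) = (\<integral>\<^sup>+\<omega>. ennreal (h (X (s + t) \<omega>)) * indicator B \<omega> \<partial>M)"
      by (intro nn_integral_cong) (auto simp: indicator_def)
    also have "\<dots> = (\<integral>\<^sup>+\<omega>. (\<integral>\<^sup>+y. ennreal (h y) \<partial>Q t (X s \<omega>)) * indicator B \<omega> \<partial>M)"
      by (rule feller_process_nn_integral[OF FP s t that]) simp
    also have "\<dots> = (\<integral>\<^sup>+\<omega>. ennreal (g (X s \<omega>) * indicator B \<omega>) \<partial>M)"
      by (intro nn_integral_cong) (auto simp: indicator_def nn_integral_eq_integral[OF hi] h g)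
    finally show ?thesis .
  qed
  have top: "space M \<in> sets (canonical_filtration M X s)"
    using sets.top[of "canonical_filtration M X s"] by (simp add: space_canonical_filtration)
  have "(\<integral>\<^sup>+\<omega>. ennreal (h (X (s + t) \<omega>)) \<partial>M) = (\<integral>\<^sup>+\<omega>. ennreal (g (X s \<omega>)) \<partial>M)"
    using eq[OF top] by (simp cong: nn_integral_cong)
  also have "\<dots> < \<infinity>" using nn_integral_eq_integral[OF gi] g0 by simp
  finally show "integrable M (\<lambda>\<omega>. h (X (s + t) \<omega>))"
    by (intro integrableI_nonneg) (auto simp: h)
  assume B: "B \<in> sets (canonical_filtration M X s)"
  then have [measurable]: "B \<in> sets M" using subalgebra_canonical_filtration[of X M, OF X] by (auto simp: subalgebra_def)
  show "(\<integral>\<omega>\<in>B. h (X (s + t) \<omega>) \<partial>M) = (\<integral>\<omega>\<in>B. g (X s \<omega>) \<partial>M)"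
    unfolding set_lebesgue_integral_def using eq[OF B]
    by (subst (1 2) integral_eq_nn_integral) (auto simp: h g0 mult.commute)
qed

text \<open>A signed function dominated by \<open>h\<close> is the difference of the nonnegative functions \<open>f + h\<close> and \<open>h\<close>.\<close>

lemma feller_process_cond_exp:
  fixes f f' h h' :: "real^'n \<Rightarrow> real"
  assumes FP: "feller_process Q M X" and s: "0 \<le> s" and t: "0 < t"
    and [measurable]: "f \<in> borel_measurable borel" "f' \<in> borel_measurable borel" "h \<in> borel_measurable borel" "h' \<in> borel_measurable borel"
    and bound: "\<And>y. \<bar>f y\<bar> \<le> h y"
    and int: "\<And>x. integrable (Q t x) f" "\<And>x. integrable (Q t x) h"
    and lim: "\<And>x. (LINT y|Q t x. f y) = f' x" "\<And>x. (LINT y|Q t x. h y) = h' x"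
    and h'i: "integrable M (\<lambda>\<omega>. h' (X s \<omega>))"
  shows "integrable M (\<lambda>\<omega>. f (X (s + t) \<omega>))"
    and "AE \<omega> in M. real_cond_exp M (canonical_filtration M X s) (\<lambda>\<omega>. f (X (s + t) \<omega>)) \<omega> = f' (X s \<omega>)"
    and "(LINT \<omega>|M. f (X (s + t) \<omega>)) = (LINT \<omega>|M. f' (X s \<omega>))"
proof -
  interpret prob_space M using FP by (simp add: feller_process_def)
  have X: "X u \<in> borel_measurable M" if "0 \<le> u" for u using FP that by (simp add: feller_process_def)
  have XM[measurable]: "X (s + t) \<in> borel_measurable M" "X s \<in> borel_measurable M" using s t by (auto intro: X)
  interpret finite_measure_subalgebra M "canonical_filtration M X s"
    by unfold_locales (rule subalgebra_canonical_filtration[OF X])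
  have h0: "0 \<le> h y" for y using bound[of y] by linarith
  have f'b: "\<bar>f' x\<bar> \<le> h' x" for x
    unfolding lim[symmetric] using bound int by (intro integral_abs_bound[THEN order_trans] integral_mono) auto
  have f'i: "integrable M (\<lambda>\<omega>. f' (X s \<omega>))"
    by (rule Bochner_Integration.integrable_bound[OF h'i]) (use f'b in \<open>auto intro!: AE_I2 intro: order_trans[OF _ abs_ge_self]\<close>)
  have fh: "0 \<le> f y + h y" for y using bound[of y] by linarith
  have fhi: "integrable (Q t x) (\<lambda>y. f y + h y)" "(LINT y|Q t x. f y + h y) = f' x + h' x" for x
    using int[of x] lim[of x] by simp_all
  have fhm: "(\<lambda>y. f y + h y) \<in> borel_measurable borel" "(\<lambda>y. f' y + h' y) \<in> borel_measurable borel" by measurable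
  have fh'i: "integrable M (\<lambda>\<omega>. f' (X s \<omega>) + h' (X s \<omega>))" using f'i h'i by simp
  note 1 = feller_process_nonneg_integral[OF FP s t assms(6,7) h0 int(2) lim(2) h'i]
  note 2 = feller_process_nonneg_integral[OF FP s t fhm fh fhi fh'i]
  have "integrable M (\<lambda>\<omega>. (f (X (s + t) \<omega>) + h (X (s + t) \<omega>)) - h (X (s + t) \<omega>))"
    by (intro Bochner_Integration.integrable_diff 1 2)
  then show fi: "integrable M (\<lambda>\<omega>. f (X (s + t) \<omega>))" by simp
  have B: "(\<integral>\<omega>\<in>B. f (X (s + t) \<omega>) \<partial>M) = (\<integral>\<omega>\<in>B. f' (X s \<omega>) \<partial>M)" if B: "B \<in> sets (canonical_filtration M X s)" for B
  proof -
    have BM: "B \<in> sets M" using B subalg by (auto simp: subalgebra_def)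
    have si: "set_integrable M B u" if "integrable M u" for u :: "_ \<Rightarrow> real"
      using integrable_mult_indicator[OF BM that] by (simp add: set_integrable_def)
    have "(\<integral>\<omega>\<in>B. f (X (s + t) \<omega>) + h (X (s + t) \<omega>) \<partial>M) = (\<integral>\<omega>\<in>B. f' (X s \<omega>) + h' (X s \<omega>) \<partial>M)"
      by (rule 2(2)[OF B])
    then show ?thesis
      using 1(2)[OF B] by (simp add: set_integral_add si fi f'i h'i 1(1))
  qed
  show "AE \<omega> in M. real_cond_exp M (canonical_filtration M X s) (\<lambda>\<omega>. f (X (s + t) \<omega>)) \<omega> = f' (X s \<omega>)"
    using B by (rule real_cond_exp_charact[OF _ fi f'i])
      (auto intro!: measurable_compose[OF measurable_canonical_filtration[OF s order_refl]])
  show "(LINT \<omega>|M. f (X (s + t) \<omega>)) = (LINT \<omega>|M. f' (X s \<omega>))"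
    using B[OF sets.top] by (simp add: space_canonical_filtration set_integral_space fi f'i)
qed

context dunkl_drift
begin

context
  fixes M :: "'a measure" and X :: "real \<Rightarrow> 'a \<Rightarrow> real^'n"
  assumes FP: "feller_process Kt M X"
    and sq: "integrable M (\<lambda>\<omega>. (norm (X 0 \<omega>))\<^sup>2)"
begin

lemma process_measurable: "0 \<le> t \<Longrightarrow> X t \<in> borel_measurable M"
  using FP by (simp add: feller_process_def)

lemma m1_integrable_of_m2:
  assumes t: "0 \<le> t" and i: "integrable M (\<lambda>\<omega>. m2 b b (X t \<omega>))"
  shows "integrable M (\<lambda>\<omega>. m1 b (X t \<omega>))"
proof -
  interpret prob_space M using FP by (simp add: feller_process_def)
  note [measurable] = process_measurable[OF t]
  have "integrable M (\<lambda>\<omega>. 1 + m2 b b (X t \<omega>))" using i by simp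
  then show ?thesis
    by (rule Bochner_Integration.integrable_bound)
      (use m1_le_m2 in \<open>auto intro!: AE_I2 intro: order_trans[OF _ abs_ge_self]\<close>)
qed

text \<open>Pure second moments are nonnegative, so their integrability is carried from time \<open>0\<close>, where the second
moment of the starting distribution bounds them, to time \<open>t\<close>.\<close>

lemma m2_square_integrable:
  assumes t: "0 \<le> t" shows "integrable M (\<lambda>\<omega>. m2 b b (X t \<omega>))"
proof -
  interpret prob_space M using FP by (simp add: feller_process_def)
  have 0: "integrable M (\<lambda>\<omega>. m2 b b (X 0 \<omega>))"
  proof (rule Bochner_Integration.integrable_bound[OF integrable_mult_right[OF sq, of "norm b * norm b"]])
    show "(\<lambda>\<omega>. m2 b b (X 0 \<omega>)) \<in> borel_measurable M"
      using measurable_compose[OF process_measurable borel_measurable_m(2)] by simp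
    show "AE \<omega> in M. norm (m2 b b (X 0 \<omega>)) \<le> norm (norm b * norm b * (norm (X 0 \<omega>))\<^sup>2)"
      using m2_bound by (intro AE_I2) simp
  qed
  show ?thesis
  proof (cases "t = 0")
    case False
    then have t: "0 < t" using t by simp
    have "integrable M (\<lambda>\<omega>. m2 b b (X (0 + t) \<omega>))"
    proof (rule feller_process_nonneg_integral(1)[OF FP order_refl t])
      show "integrable M (\<lambda>\<omega>. m2 b b (X 0 \<omega>) + t * ((lam \<bullet> b) * m1 b (X 0 \<omega>) + (lam \<bullet> b) * m1 b (X 0 \<omega>)) + t * (b \<bullet> b) + t\<^sup>2 * (lam \<bullet> b) * (lam \<bullet> b))"
        using 0 m1_integrable_of_m2[OF order_refl 0] by simp
    qed (auto simp: m2_nonneg Kt_m2[OF t])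
    then show ?thesis by simp
  qed (simp add: 0)
qed

lemma m1_integrable: "0 \<le> t \<Longrightarrow> integrable M (\<lambda>\<omega>. m1 b (X t \<omega>))"
  using m1_integrable_of_m2 m2_square_integrable by blast

lemma m2_integrable:
  assumes t: "0 \<le> t" shows "integrable M (\<lambda>\<omega>. m2 b c (X t \<omega>))"
proof -
  note [measurable] = process_measurable[OF t]
  have "integrable M (\<lambda>\<omega>. m2 b b (X t \<omega>) + m2 c c (X t \<omega>))" using m2_square_integrable[OF t] by simp
  then show ?thesis
  proof (rule Bochner_Integration.integrable_bound)
    show "AE \<omega> in M. norm (m2 b c (X t \<omega>)) \<le> norm (m2 b b (X t \<omega>) + m2 c c (X t \<omega>))"
    proof (rule AE_I2)
      fix \<omega>
      show "norm (m2 b c (X t \<omega>)) \<le> norm (m2 b b (X t \<omega>) + m2 c c (X t \<omega>))"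
        using m2_polarization[of b c "X t \<omega>"] by simp
    qed
  qed measurable
qed

text \<open>Stated for affine combinations of the moment functions, because the process of the theorem is one with
coefficients depending on time only.\<close>

lemma moment_cond_exp:
  fixes b c :: "real^'n" and p q r :: real
  assumes s: "0 \<le> s" and t: "0 < t"
  defines "f \<equiv> \<lambda>x. m2 c b x + p * m1 b x + q * m1 c x + r"
  defines "f' \<equiv> \<lambda>x. (m2 c b x + t * ((lam \<bullet> c) * m1 b x + (lam \<bullet> b) * m1 c x) + t * (c \<bullet> b) + t\<^sup>2 * (lam \<bullet> c) * (lam \<bullet> b))
      + p * (m1 b x + t * (lam \<bullet> b)) + q * (m1 c x + t * (lam \<bullet> c)) + r"
  shows "AE \<omega> in M. real_cond_exp M (canonical_filtration M X s) (\<lambda>\<omega>. f (X (s + t) \<omega>)) \<omega> = f' (X s \<omega>)"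
    and "(LINT \<omega>|M. f (X (s + t) \<omega>)) = (LINT \<omega>|M. f' (X s \<omega>))"
proof -
  interpret prob_space M using FP by (simp add: feller_process_def)
  \<comment> \<open>a majorant of \<open>f\<close> made of pure second moments, and its image \<open>h'\<close> under the kernel\<close>
  define h where "h = (\<lambda>x. (m2 c c x + m2 b b x) + \<bar>p\<bar> * (1 + m2 b b x) + \<bar>q\<bar> * (1 + m2 c c x) + \<bar>r\<bar>)"
  define P where "P = (\<lambda>b x. m2 b b x + t * ((lam \<bullet> b) * m1 b x + (lam \<bullet> b) * m1 b x) + t * (b \<bullet> b) + t\<^sup>2 * (lam \<bullet> b) * (lam \<bullet> b))"
  define h' where "h' = (\<lambda>x. (P c x + P b x) + \<bar>p\<bar> * (1 + P b x) + \<bar>q\<bar> * (1 + P c x) + \<bar>r\<bar>)"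
  have b: "\<bar>f x\<bar> \<le> h x" for x
  proof -
    have "\<bar>f x\<bar> \<le> \<bar>m2 c b x\<bar> + \<bar>p\<bar> * \<bar>m1 b x\<bar> + \<bar>q\<bar> * \<bar>m1 c x\<bar> + \<bar>r\<bar>"
      unfolding f_def by (simp flip: abs_mult)
    also have "\<dots> \<le> h x"
      unfolding h_def using m2_polarization[of c b x] m2_nonneg[of b x] m2_nonneg[of c x]
      by (intro add_mono mult_left_mono m1_le_m2) auto
    finally show ?thesis .
  qed
  have i: "integrable (Kt t x) (\<lambda>_. a)" for x and a :: real
    using prob_space.finite_measure[OF prob_space_Kt[OF t]] by (simp add: finite_measure.integrable_const)
  have c: "measure (Kt t x) (space (Kt t x)) = 1" for x
    by (rule prob_space.prob_space[OF prob_space_Kt[OF t]])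
  have int: "integrable (Kt t x) f" "integrable (Kt t x) h" for x
    unfolding f_def h_def by (intro Bochner_Integration.integrable_add integrable_mult_right i Kt_m1[OF t] Kt_m2[OF t])+
  have lim: "(LINT y|Kt t x. f y) = f' x" "(LINT y|Kt t x. h y) = h' x" for x
    unfolding f_def f'_def h_def h'_def P_def
    by (simp_all add: i c Kt_m1[OF t] Kt_m2[OF t])
  have h'i: "integrable M (\<lambda>\<omega>. h' (X s \<omega>))"
    unfolding h'_def P_def using m1_integrable[OF s] m2_integrable[OF s] by simp
  have [measurable]: "f \<in> borel_measurable borel" "f' \<in> borel_measurable borel"
    "h \<in> borel_measurable borel" "h' \<in> borel_measurable borel"
    unfolding f_def f'_def h_def h'_def P_def by measurable
  show "AE \<omega> in M. real_cond_exp M (canonical_filtration M X s) (\<lambda>\<omega>. f (X (s + t) \<omega>)) \<omega> = f' (X s \<omega>)"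
    "(LINT \<omega>|M. f (X (s + t) \<omega>)) = (LINT \<omega>|M. f' (X s \<omega>))"
    by (rule feller_process_cond_exp[OF FP s t _ _ _ _ b int lim h'i]; measurable)+
qed

lemma expectation_m1:
  assumes s: "0 \<le> s" and t: "0 < t"
  shows "(LINT \<omega>|M. m1 b (X (s + t) \<omega>)) = (LINT \<omega>|M. m1 b (X s \<omega>)) + t * (lam \<bullet> b)"
proof -
  interpret prob_space M using FP by (simp add: feller_process_def)
  have st: "0 \<le> s + t" using s t by simp
  note i = m1_integrable[OF s] m2_integrable[OF s] m1_integrable[OF st] m2_integrable[OF st]
  show ?thesis
    using moment_cond_exp(2)[OF s t, of b b 1 0 0] moment_cond_exp(2)[OF s t, of b b 0 0 0]
    by (simp add: i prob_space)
qed

lemma expectation_m2: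
  assumes s: "0 \<le> s" and t: "0 < t"
  shows "(LINT \<omega>|M. m2 c b (X (s + t) \<omega>)) = (LINT \<omega>|M. m2 c b (X s \<omega>))
    + t * ((lam \<bullet> c) * (LINT \<omega>|M. m1 b (X s \<omega>)) + (lam \<bullet> b) * (LINT \<omega>|M. m1 c (X s \<omega>)))
    + t * (c \<bullet> b) + t\<^sup>2 * (lam \<bullet> c) * (lam \<bullet> b)"
proof -
  interpret prob_space M using FP by (simp add: feller_process_def)
  have st: "0 \<le> s + t" using s t by simp
  note i = m1_integrable[OF s] m2_integrable[OF s] m1_integrable[OF st] m2_integrable[OF st]
  show ?thesis
    using moment_cond_exp(2)[OF s t, of c b 0 0 0] by (simp add: i prob_space)
qed

text \<open>With \<open>\<tau> = t - s\<close> the coefficients at time \<open>t\<close> are polynomials in \<open>\<tau>\<close> by the formulas for the expectations; after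
conditioning, all powers of \<open>\<tau>\<close> cancel.\<close>

lemma moment_martingale:
  "martingale M (canonical_filtration M X)
     (\<lambda>t \<omega>. m2 c b (X t \<omega>) - (LINT \<omega>'|M. m2 c b (X t \<omega>'))
        - m1 b (X t \<omega>) * (LINT \<omega>'|M. m1 c (X t \<omega>')) - m1 c (X t \<omega>) * (LINT \<omega>'|M. m1 b (X t \<omega>'))
        + 2 * (LINT \<omega>'|M. m1 b (X t \<omega>')) * (LINT \<omega>'|M. m1 c (X t \<omega>')))"
  (is "martingale M _ ?Y")
  unfolding martingale_def
proof (intro conjI allI impI)
  interpret prob_space M using FP by (simp add: feller_process_def)
  have mF: "?Y t \<in> borel_measurable (canonical_filtration M X t)" if t: "0 \<le> t" for t
  proof -
    note [measurable] = measurable_canonical_filtration[OF t order_refl, of X M]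
    show ?thesis by measurable
  qed
  have iY: "integrable M (?Y t)" if t: "0 \<le> t" for t
    using m1_integrable[OF t] m2_integrable[OF t] by simp
  show "integrable M (?Y t)" "?Y t \<in> borel_measurable (canonical_filtration M X t)" if "0 \<le> t" for t
    using mF[OF that] iY[OF that] by auto
  fix s t :: real assume st: "0 \<le> s \<and> s \<le> t"
  then have s: "0 \<le> s" by simp
  interpret finite_measure_subalgebra M "canonical_filtration M X s"
    by unfold_locales (rule subalgebra_canonical_filtration[OF process_measurable])
  show "AE \<omega> in M. real_cond_exp M (canonical_filtration M X s) (?Y t) \<omega> = ?Y s \<omega>"
  proof (cases "s = t")
    case True
    then show ?thesis using real_cond_exp_F_meas[OF iY[OF s] mF[OF s]] by simp
  next
    case False
    define \<tau> where "\<tau> = t - s"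
    have \<tau>: "0 < \<tau>" using st False by (simp add: \<tau>_def)
    have t: "t = s + \<tau>" by (simp add: \<tau>_def)
    define ab ac e where "ab = (LINT \<omega>|M. m1 b (X s \<omega>))" "ac = (LINT \<omega>|M. m1 c (X s \<omega>))" "e = (LINT \<omega>|M. m2 c b (X s \<omega>))"
    let ?p = "- (ac + \<tau> * (lam \<bullet> c))" and ?q = "- (ab + \<tau> * (lam \<bullet> b))"
    let ?r = "2 * (ab + \<tau> * (lam \<bullet> b)) * (ac + \<tau> * (lam \<bullet> c))
        - (e + \<tau> * ((lam \<bullet> c) * ab + (lam \<bullet> b) * ac) + \<tau> * (c \<bullet> b) + \<tau>\<^sup>2 * (lam \<bullet> c) * (lam \<bullet> b))"
    have Yt: "?Y t = (\<lambda>\<omega>. m2 c b (X (s + \<tau>) \<omega>) + ?p * m1 b (X (s + \<tau>) \<omega>) + ?q * m1 c (X (s + \<tau>) \<omega>) + ?r)"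
      unfolding t expectation_m1[OF s \<tau>] expectation_m2[OF s \<tau>] ab_ac_e_def by (simp add: fun_eq_iff algebra_simps)
    have Ys: "?Y s \<omega> = (m2 c b (X s \<omega>) + \<tau> * ((lam \<bullet> c) * m1 b (X s \<omega>) + (lam \<bullet> b) * m1 c (X s \<omega>)) + \<tau> * (c \<bullet> b) + \<tau>\<^sup>2 * (lam \<bullet> c) * (lam \<bullet> b))
      + ?p * (m1 b (X s \<omega>) + \<tau> * (lam \<bullet> b)) + ?q * (m1 c (X s \<omega>) + \<tau> * (lam \<bullet> c)) + ?r" for \<omega>
      unfolding ab_ac_e_def[symmetric] by (simp add: algebra_simps power2_eq_square)
    show ?thesis
      unfolding Yt Ys by (rule moment_cond_exp(1)[OF s \<tau>])
  qed
qed

end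

end

lemma distr_return_AE:
  assumes X: "Y \<in> borel_measurable M" and d: "distr M borel Y = return borel (0::real^'n)"
  shows "AE \<omega> in M. Y \<omega> = 0"
proof -
  have "AE y in distr M borel Y. y = 0" unfolding d by (simp add: AE_return)
  then show ?thesis using X by (simp add: AE_distr_iff)
qed

section \<open>Modified moments of Dunkl processes with drift\<close>

theorem proposition5p8:
  fixes R Rp :: "(real^'n) set" and k :: "real^'n \<Rightarrow> real" and lam :: "real^'n"
  assumes "root_system R" and "positive_subsystem R Rp" and "multiplicity_function R k"
  shows "(\<forall>x j l. dunkl_drift_generator Rp k lam (moment2 Rp k lam j l) x =
            (if j = l then 1 else 0)
              + lam $ j * moment1 Rp k lam l x + lam $ l * moment1 Rp k lam j x)
    \<and> (\<forall>(M :: 'a measure) X.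
         dunkl_process Rp k lam M X \<and> integrable M (\<lambda>\<omega>. (norm (X 0 \<omega>))\<^sup>2) \<longrightarrow>
         (\<forall>j l.
            (\<forall>t\<ge>0. integrable M (\<lambda>\<omega>. moment1 Rp k lam j (X t \<omega>)) \<and>
                   integrable M (\<lambda>\<omega>. moment2 Rp k lam j l (X t \<omega>))) \<and>
            martingale M (canonical_filtration M X)
              (\<lambda>t \<omega>. moment2 Rp k lam j l (X t \<omega>)
                 - (LINT \<omega>'|M. moment2 Rp k lam j l (X t \<omega>'))
                 - moment1 Rp k lam l (X t \<omega>) * (LINT \<omega>'|M. moment1 Rp k lam j (X t \<omega>'))
                 - moment1 Rp k lam j (X t \<omega>) * (LINT \<omega>'|M. moment1 Rp k lam l (X t \<omega>'))
                 + 2 * (LINT \<omega>'|M. moment1 Rp k lam l (X t \<omega>'))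
                     * (LINT \<omega>'|M. moment1 Rp k lam j (X t \<omega>')))))
    \<and> (\<forall>(M :: 'a measure) X.
         dunkl_process Rp k lam M X \<and> distr M borel (X 0) = return borel 0 \<longrightarrow>
         (\<forall>l j. \<forall>t\<ge>0. (LINT \<omega>|M. moment2 Rp k lam l j (X t \<omega>)) =
            t * (if j = l then 1 else 0) + t\<^sup>2 * lam $ j * lam $ l))"
proof (intro conjI allI impI)
  interpret D: dunkl_setup R Rp k using assms by unfold_locales
  show "dunkl_drift_generator Rp k lam (moment2 Rp k lam j l) x =
      (if j = l then 1 else 0) + lam $ j * moment1 Rp k lam l x + lam $ l * moment1 Rp k lam j x" for x j l
    by (rule D.generator_moment2)
  have drift: "dunkl_drift R Rp k lam" if "dunkl_process Rp k lam M X" for M :: "'a measure" and X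
    using that by unfold_locales (auto simp: dunkl_process_def feller_process_def)
  have m1: "moment1 Rp k lam j = dunkl_drift.m1 Rp k lam (axis j 1)" if "dunkl_process Rp k lam M X" for M :: "'a measure" and X j
    using D.moment1_eq dunkl_drift.m1_def[OF drift[OF that]] by (auto simp: fun_eq_iff)
  have m2: "moment2 Rp k lam j l = dunkl_drift.m2 Rp k lam (axis j 1) (axis l 1)" if "dunkl_process Rp k lam M X" for M :: "'a measure" and X j l
    using D.moment2_eq dunkl_drift.m2_def[OF drift[OF that]] by (auto simp: fun_eq_iff)
  {
    fix M :: "'a measure" and X j l
    assume P: "dunkl_process Rp k lam M X \<and> integrable M (\<lambda>\<omega>. (norm (X 0 \<omega>))\<^sup>2)"
    then have P': "dunkl_process Rp k lam M X" and FP: "feller_process (dunkl_drift_kernel Rp k lam) M X"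
      and sq: "integrable M (\<lambda>\<omega>. (norm (X 0 \<omega>))\<^sup>2)" by (auto simp: dunkl_process_def)
    interpret dunkl_drift R Rp k lam by (rule drift[OF P'])
    show "integrable M (\<lambda>\<omega>. moment1 Rp k lam j (X t \<omega>))" "integrable M (\<lambda>\<omega>. moment2 Rp k lam j l (X t \<omega>))" if "0 \<le> t" for t
      unfolding m1[OF P'] m2[OF P'] using m1_integrable[OF FP sq that] m2_integrable[OF FP sq that] by auto
    show "martingale M (canonical_filtration M X)
              (\<lambda>t \<omega>. moment2 Rp k lam j l (X t \<omega>)
                 - (LINT \<omega>'|M. moment2 Rp k lam j l (X t \<omega>'))
                 - moment1 Rp k lam l (X t \<omega>) * (LINT \<omega>'|M. moment1 Rp k lam j (X t \<omega>'))
                 - moment1 Rp k lam j (X t \<omega>) * (LINT \<omega>'|M. moment1 Rp k lam l (X t \<omega>'))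
                 + 2 * (LINT \<omega>'|M. moment1 Rp k lam l (X t \<omega>'))
                     * (LINT \<omega>'|M. moment1 Rp k lam j (X t \<omega>')))"
      unfolding m1[OF P'] m2[OF P'] by (rule moment_martingale[OF FP sq])
  }
  fix M :: "'a measure" and X l j and t :: real
  assume P: "dunkl_process Rp k lam M X \<and> distr M borel (X 0) = return borel 0" and t: "0 \<le> t"
  then have P': "dunkl_process Rp k lam M X" and FP: "feller_process (dunkl_drift_kernel Rp k lam) M X"
    and d: "distr M borel (X 0) = return borel 0" by (auto simp: dunkl_process_def)
  interpret dunkl_drift R Rp k lam by (rule drift[OF P'])
  have X0: "X 0 \<in> borel_measurable M" using FP by (simp add: feller_process_def)
  have ae: "AE \<omega> in M. X 0 \<omega> = 0" by (rule distr_return_AE[OF X0 d])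
  have sq: "integrable M (\<lambda>\<omega>. (norm (X 0 \<omega>))\<^sup>2)"
    using ae X0 by (subst integrable_cong_AE[where g = "\<lambda>_. 0"]) auto
  have zero: "(LINT \<omega>|M. f (X 0 \<omega>)) = 0" if "f 0 = 0" "f \<in> borel_measurable borel" for f :: "real^'n \<Rightarrow> real"
  proof -
    have "(LINT \<omega>|M. f (X 0 \<omega>)) = (LINT \<omega>|M. 0)"
      using ae that X0 by (intro integral_cong_AE) auto
    then show ?thesis by simp
  qed
  have m0: "m1 b 0 = 0" "m2 b c 0 = 0" for b c using m1_bound[of b 0] m2_bound[of b c 0] by simp_all
  show "(LINT \<omega>|M. moment2 Rp k lam l j (X t \<omega>)) = t * (if j = l then 1 else 0) + t\<^sup>2 * lam $ j * lam $ l"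
  proof (cases "t = 0")
    case True
    then show ?thesis unfolding m2[OF P'] using zero[of "m2 (axis l 1) (axis j 1)"] m0 by simp
  next
    case False
    then have "0 < t" using t by simp
    then show ?thesis
      unfolding m2[OF P'] using expectation_m2[OF FP sq order_refl \<open>0 < t\<close>, of "axis l 1" "axis j 1"]
        zero[of "m2 (axis l 1) (axis j 1)"] zero[of "m1 (axis l 1)"] zero[of "m1 (axis j 1)"] m0
      by (simp add: inner_axis inner_axis_axis) (simp add: axis_def)
  qed
qed

end
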